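(* Let $0<p_0<p<p_1<\infty$ and let $\omega$ be an $A_{p/p_0}$ weight in $\mathbb{R}^d$. Let $B_0$ be a ball in $\mathbb{R}^d$ and $F,f\in L^p(4B_0)$. Suppose that for each ball $B\subset2B_0$ with $|B|\le c_1|B_0|$ there exist two functions $F_B,R_B$ defined on $2B$ such that $|F|\le|F_B|+|R_B|$ on $2B$ and $$\Big(\fint_{2B}|F_B|^{p_0}\Big)^{1/p_0}\le N_1\sup_{4B_0\supset B'\supset B}\Big(\fint_{B'}|f|^{p_0}\Big)^{1/p_0}+\eta\Big(\fint_{100B}|F|^{p_0}\Big)^{1/p_0},$$ $$\Big(\fint_{2B}|R_B|^{p_1}\omega\,dx\Big)^{1/p_1}\le N_2\Big\{\Big(\fint_{100B}|F|^{p_0}\Big)^{1/p_0}+\sup_{4B_0\supset B'\supset B}\Big(\fint_{B'}|f|^{p_0}\Big)^{1/p_0}\Big\}\Big(\fint_B\omega\Big)^{1/p_1},$$ where $N_1,N_2>1$, $0<c_1<1$, $\eta\ge0$, and the suprema are over balls $B'$. Then there exists $\eta_0>0$, depending only on $d,p_0,p_1,p,c_1,N_2$ and the $A_{p/p_0}$ constant of $\omega$, such that if $0\le\eta\le\eta_0$, then $$\Big(\fint_{B_0}|F|^p\omega\,dx\Big)^{1/p}\le C\Big(\fint_{4B_0}|f|^p\omega\Big)^{1/p}+C\Big(\fint_{4B_0}|F|^{p_0}\Big)^{1/p_0}\Big(\fint_{B_0}\omega\Big)^{1/p},$$ where $C$ depends only on $d,p_0,p_1,p,c_1,N_1,N_2$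 and the $A_{p/p_0}$ constant of $\omega$.
   Context: For $1<q<\infty$, a nonnegative $\omega\in L^1_{loc}(\mathbb{R}^d)$ is an $A_q$ weight if there is $C_\omega\ge1$ with $\fint_B\omega\cdot\big(\fint_B\omega^{-1/(q-1)}\big)^{q-1}\le C_\omega$ for every ball $B$; the smallest such $C_\omega$ is the $A_q$ constant. For $B=B(x,r)$ and $t>0$, $tB=B(x,tr)$. $\fint_E$ denotes the average over $E$ with respect to Lebesgue measure. *)

theory Defs
  imports "HOL-Analysis.Analysis"
begin

text \<open>Real power of an extended nonnegative real, for positive exponents:
  \<open>\<infinity>\<close> stays \<open>\<infinity>\<close>.\<close>
definition epow :: "ennreal \<Rightarrow> real \<Rightarrow> ennreal" where
  "epow x a = (if x = top then top else ennreal (enn2real x powr a))"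

definition avg :: "'a::euclidean_space set \<Rightarrow> ('a \<Rightarrow> ennreal) \<Rightarrow> ennreal" where
  "avg E g = (\<integral>\<^sup>+ x. g x * indicator E x \<partial>lebesgue) / emeasure lebesgue E"

definition Aq_ineq :: "real \<Rightarrow> ('a::euclidean_space \<Rightarrow> real) \<Rightarrow> real \<Rightarrow> bool" where
  "Aq_ineq q w K \<longleftrightarrow> K \<ge> 1 \<and>
     (\<forall>x r. r > 0 \<longrightarrow>
        avg (ball x r) (\<lambda>y. ennreal (w y))
        * epow (avg (ball x r) (\<lambda>y. epow (inverse (ennreal (w y))) (1 / (q - 1)))) (q - 1)
        \<le> ennreal K)"

definition Aq_weight :: "real \<Rightarrow> ('a::euclidean_space \<Rightarrow> real) \<Rightarrow> bool" where
  "Aq_weight q w \<longleftrightarrow> 1 < q \<and> (\<forall>x. w x \<ge> 0) \<and> w \<in> borel_measurable lebesgue \<and>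
     (\<forall>K. compact K \<longrightarrow> set_integrable lebesgue K w) \<and> (\<exists>C. Aq_ineq q w C)"

definition Aq_const :: "real \<Rightarrow> ('a::euclidean_space \<Rightarrow> real) \<Rightarrow> real" where
  "Aq_const q w = Inf {C. Aq_ineq q w C}"

end

theory Submission
  imports Defs
begin

text \<open>Let \<open>g\<close> and \<open>h\<close> be \<open>|F|\<close> and \<open>|f|\<close> to the power \<open>p\<^sub>0\<close>, cut off outside \<open>4B\<^sub>0\<close>, let \<open>q = p / p\<^sub>0\<close>, and let
  \<open>\<rho>(y) = 2 - |y - x\<^sub>0| / r\<^sub>0\<close>, which measures the distance of \<open>y\<close> to the boundary of \<open>2B\<^sub>0\<close>. Let \<open>E(t)\<close> be the union
  of the balls \<open>B(y, s)\<close> with \<open>y \<in> 2B\<^sub>0\<close> on which the average of \<open>g\<close> exceeds \<open>t / \<rho>(y)\<^sup>d\<close>. As soon as \<open>t\<close> exceeds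
  a multiple of the average of \<open>g\<close> over \<open>4B\<^sub>0\<close>, such a ball is small compared to \<open>r\<^sub>0 \<rho>(y)\<close>. Thus
  everything happens inside \<open>2B\<^sub>0\<close>, and only balls \<open>B\<close> with \<open>100B \<subseteq> 4B\<^sub>0\<close> matter. Cover \<open>E(t)\<close> by Vitali's
  lemma with dilations of balls of nearly maximal radius. On each of them \<open>g\<close> is dominated by two functions:
  the first one is large only on a set of small Lebesgue measure, hence of small \<open>w\<close>-measure by the \<open>A\<^sub>\<infinity>\<close> property;
  the second one is controlled since the maximal operator is bounded on \<open>L\<^sup>s(w)\<close> with \<open>s = p\<^sub>1 / p\<^sub>0 > q\<close>. This gives
  \<open>w(E(At)) \<le> \<delta> w(E(t)) + C w{Mh > ct}\<close> with \<open>A\<^sup>q \<delta> \<le> 1/2\<close>. Integration against \<open>t\<^sup>q\<^sup>-\<^sup>1\<close> and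
  Muckenhoupt's theorem for \<open>Mh\<close> yield the claim.\<close>

section \<open>Powers of extended nonnegative reals and layer cakes\<close>

text \<open>Otherwise the simplifier replaces \<open>lebesgue\<close> by \<open>lborel\<close> on Borel sets only.\<close>

declare emeasure_completion [simp del]

text \<open>The data put \<open>F\<close> in the unweighted \<open>L^p\<close> only, so nothing is
  known in advance about its norm with weight \<open>w\<close>. Absorption instead rests on
  \<open>w(E(t))\<close> being at most the finite \<open>w(2B_0)\<close>, which requires that
  stopping balls cannot leave \<open>2B_0\<close>. A constant threshold would not confine them. The
  factor \<open>\<rho>^d\<close> raises the threshold towards the boundary at the rate at which the
  volume of a ball of radius \<open>\<kappa> r_0 \<rho>\<close> decreases, and it is at least 1 on
  \<open>B_0\<close>, where the conclusion lives. The constants are fixed in the order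
  \<open>A\<close>, \<open>\<epsilon>\<close>, \<open>\<alpha>\<close>, \<open>a\<close>,
  \<open>\<eta>0\<close>, \<open>\<gamma>\<close>. The second function contributes a multiple of
  \<open>A^(q - p_1/p_0)\<close> to \<open>A^q \<delta>\<close>, so \<open>A\<close> is chosen from
  it; the \<open>A_infinity\<close> property then converts the allowance \<open>\<epsilon>\<close>
  for \<open>w\<close> into an allowance \<open>\<alpha>\<close> for volume, and hence into a bound
  on \<open>\<eta>0\<close>. \<open>N_1\<close> enters only through \<open>\<gamma>\<close>, which
  scales the level of \<open>Mh\<close> and so affects the final constant alone. Uniformity over
  weights with one \<open>A_q\<close> constant is the reason why \<open>\<alpha>\<close> is
  quantified before the weight.\<close>

abbreviation vol :: "'a::euclidean_space set \<Rightarrow> ennreal" where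
  "vol \<equiv> emeasure lebesgue"

abbreviation lint :: "'a::euclidean_space set \<Rightarrow> ('a \<Rightarrow> ennreal) \<Rightarrow> ennreal" where
  "lint A u \<equiv> set_nn_integral lebesgue A u"

lemma epow_0 [simp]: "epow 0 a = 0"
  by (simp add: epow_def)

lemma epow_top [simp]: "epow top a = top"
  by (simp add: epow_def)

lemma epow_one [simp]: "epow x 1 = x"
  by (cases x) (auto simp: epow_def)

lemma epow_1 [simp]: "epow 1 a = 1"
  by (simp add: epow_def)

lemma epow_ennreal: "0 \<le> x \<Longrightarrow> epow (ennreal x) a = ennreal (x powr a)"
  by (simp add: epow_def)

lemma epow_mono: "0 \<le> a \<Longrightarrow> x \<le> y \<Longrightarrow> epow x a \<le> epow y a"
  by (cases x; cases y) (auto simp: epow_def top_unique intro!: ennreal_leI powr_mono2)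

lemma epow_mult: "0 < a \<Longrightarrow> epow (x * y) a = epow x a * epow y a"
proof (cases x; cases y)
  assume "0 < a" "x = top" "y = top" then show ?thesis by simp
next
  fix r assume "0 < a" "0 \<le> r" "x = ennreal r" "y = top"
  then show ?thesis
    by (cases "r = 0") (auto simp: epow_ennreal ennreal_mult_top)
next
  fix r assume "0 < a" "0 \<le> r" "y = ennreal r" "x = top"
  then show ?thesis
    by (cases "r = 0") (auto simp: epow_ennreal ennreal_top_mult)
qed (auto simp: epow_ennreal ennreal_mult[symmetric] powr_mult)

lemma epow_epow: "epow (epow x a) b = epow x (a * b)"
  by (cases x) (auto simp: epow_ennreal powr_powr)

lemma epow_add: "0 < a \<Longrightarrow> 0 < b \<Longrightarrow> epow x (a + b) = epow x a * epow x b"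
  by (cases x) (auto simp: epow_ennreal powr_add ennreal_mult)

lemma epow_le_iff [simp]: assumes "0 < a" shows "epow x a \<le> epow y a \<longleftrightarrow> x \<le> y"
proof
  assume "epow x a \<le> epow y a"
  then have "epow (epow x a) (1/a) \<le> epow (epow y a) (1/a)"
    using assms by (intro epow_mono[of "1/a" "epow x a"]) auto
  then show "x \<le> y" using assms by (simp add: epow_epow)
qed (use assms in \<open>auto intro: epow_mono\<close>)

lemma epow_eq_0_iff [simp]: "epow x a = 0 \<longleftrightarrow> x = 0"
  by (cases x) (auto simp: epow_ennreal)

lemma epow_eq_top_iff [simp]: "epow x a = top \<longleftrightarrow> x = top"
  by (simp add: epow_def)

text \<open>Bounding the sum by twice the maximum serves exponents below 1 and above 1 alike; both
  may occur.\<close>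

lemma epow_add_le: assumes "0 < a" shows "epow (x + y) a \<le> ennreal (2 powr a) * (epow x a + epow y a)"
proof -
  have "epow (x + y) a \<le> epow (2 * max x y) a"
    using assms by (intro epow_mono) (auto simp: mult_2 intro: add_mono)
  also have "\<dots> = epow 2 a * epow (max x y) a"
    using assms by (simp add: epow_mult)
  also have "epow 2 a = ennreal (2 powr a)"
    using epow_ennreal[of 2 a] by simp
  also have "epow (max x y) a \<le> epow x a + epow y a"
    by (cases x y rule: le_cases) (auto simp: max_def)
  finally show ?thesis by (simp add: mult_left_mono)
qed

lemma borel_measurable_epow [measurable (raw)]:
  assumes [measurable]: "f \<in> borel_measurable M"
  shows "(\<lambda>x. epow (f x) a) \<in> borel_measurable M"
  unfolding epow_def by measurable

lemma nn_integral_powr_Ioo: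
  assumes "0 < r" "0 \<le> b"
  shows "(\<integral>\<^sup>+t. ennreal (r * t powr (r - 1)) * indicator {0<..<b} t \<partial>lborel) = ennreal (b powr r)"
proof -
  have "(\<integral>\<^sup>+t. ennreal (r * t powr (r - 1)) * indicator {0<..<b} t \<partial>lborel)
      = (\<integral>\<^sup>+t. ennreal (indicator {0<..<b} t * (r * t powr (r - 1))) \<partial>lborel)"
    by (intro nn_integral_cong) (auto split: split_indicator)
  have "((\<lambda>t. r * t powr (r - 1)) has_integral (b powr r - 0 powr r)) {0..b}"
    using assms
    by (intro fundamental_theorem_of_calculus_interior)
       (auto intro!: continuous_on_powr' has_real_derivative_powr continuous_on_id continuous_on_const
         simp flip: has_real_derivative_iff_has_vector_derivative)
  then have "((\<lambda>t. r * t powr (r - 1)) has_integral (b powr r)) {0<..<b}"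
    using assms by (simp add: has_integral_Icc_iff_Ioo)
  then show ?thesis
    using assms
    by (intro nn_integral_has_integral_lebesgue') auto
qed

lemma epow_eq_nn_integral:
  assumes "0 < r"
  shows "epow v r = (\<integral>\<^sup>+t. ennreal (r * t powr (r - 1)) * indicator {t. 0 < t \<and> ennreal t < v} t \<partial>lborel)"
proof (cases v)
  case (real b)
  have "{t. 0 < t \<and> ennreal t < v} = {0<..<b}"
    using real by (auto simp: ennreal_less_iff)
  then show ?thesis
    using real assms nn_integral_powr_Ioo[of r b] by (simp add: epow_ennreal)
next
  case top
  \<comment> \<open>Every level lies below an infinite \<open>v\<close>, so the integral dominates
    the one over levels up to \<open>real n powr (1/r)\<close>, whose value is
    \<open>n\<close>.\<close>
  have "ennreal (real n) \<le> (\<integral>\<^sup>+t. ennreal (r * t powr (r - 1)) * indicator {t. 0 < t \<and> ennreal t < v} t \<partial>lborel)"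
    (is "_ \<le> ?I") for n
  proof -
    have "ennreal (real n) = ennreal ((real n powr (1/r)) powr r)"
      using assms by (simp add: powr_powr)
    also have "\<dots> = (\<integral>\<^sup>+t. ennreal (r * t powr (r - 1)) * indicator {0<..<real n powr (1/r)} t \<partial>lborel)"
      using assms by (intro nn_integral_powr_Ioo[symmetric]) auto
    also have "\<dots> \<le> ?I"
      using top by (intro nn_integral_mono) (auto split: split_indicator)
    finally show ?thesis .
  qed
  then have "?I = top"
    by (metis ennreal_Ex_less_of_nat ennreal_of_nat_eq_real_of_nat leD less_top)
  then show ?thesis using top by simp
qed

lemma layer_cake:
  assumes "sigma_finite_measure M" and [measurable]: "u \<in> borel_measurable M" and "0 < r"
  shows "(\<integral>\<^sup>+x. epow (u x) r \<partial>M) =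
    (\<integral>\<^sup>+t. ennreal (r * t powr (r - 1)) * indicator {0<..} t * emeasure M {x\<in>space M. ennreal t < u x} \<partial>lborel)"
proof -
  interpret M: sigma_finite_measure M by fact
  interpret P: pair_sigma_finite M lborel by unfold_locales
  have "(\<integral>\<^sup>+x. epow (u x) r \<partial>M) =
      (\<integral>\<^sup>+x. (\<integral>\<^sup>+t. ennreal (r * t powr (r - 1)) * indicator {0<..} t * indicator {x\<in>space M. ennreal t < u x} x \<partial>lborel) \<partial>M)"
    using assms(3)
    by (intro nn_integral_cong) (auto simp: epow_eq_nn_integral intro!: nn_integral_cong split: split_indicator)
  also have "\<dots> = (\<integral>\<^sup>+t. (\<integral>\<^sup>+x. ennreal (r * t powr (r - 1)) * indicator {0<..} t * indicator {x\<in>space M. ennreal t < u x} x \<partial>M) \<partial>lborel)"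
    by (intro P.Fubini'[symmetric]) measurable
  also have "\<dots> = (\<integral>\<^sup>+t. ennreal (r * t powr (r - 1)) * indicator {0<..} t * emeasure M {x\<in>space M. ennreal t < u x} \<partial>lborel)"
    by (intro nn_integral_cong) (simp add: nn_integral_cmult)
  finally show ?thesis .
qed

section \<open>Volumes of balls and measures of overlapping unions\<close>

lemma emeasure_lebesgue_ball:
  "0 \<le> r \<Longrightarrow> vol (ball (x::'a::euclidean_space) r) = ennreal (unit_ball_vol DIM('a) * r ^ DIM('a))"
  by (simp add: emeasure_ball emeasure_completion)

lemma emeasure_lebesgue_ball_scale:
  assumes "0 \<le> c" "0 \<le> r"
  shows "vol (ball (x::'a::euclidean_space) (c * r)) = ennreal (c ^ DIM('a)) * vol (ball (y::'a) r)"
  unfolding emeasure_lebesgue_ball[OF mult_nonneg_nonneg[OF assms]] emeasure_lebesgue_ball[OF assms(2)]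
  using assms by (subst ennreal_mult[symmetric]) (simp_all add: power_mult_distrib mult_ac)

lemma emeasure_lebesgue_ball_pos:
  "0 < r \<Longrightarrow> 0 < vol (ball (x::'a::euclidean_space) r)"
  by (subst emeasure_lebesgue_ball) simp_all

lemma emeasure_lebesgue_ball_finite:
  "vol (ball (x::'a::euclidean_space) r) < top"
  using emeasure_lborel_ball_finite[of x r] by (simp add: emeasure_completion)

text \<open>The form in which Vitali coverings are evaluated: the \<open>A i\<close> are balls or
  dilated balls, or parts of them, and may overlap; the \<open>B i\<close> lie in the disjoint
  selected balls. Two measures occur because one may be a density with respect to the other.\<close>

lemma emeasure_UN_le_disjoint:
  assumes "countable C" "\<And>i. i \<in> C \<Longrightarrow> A i \<in> sets M" "\<And>i. i \<in> C \<Longrightarrow> B i \<in> sets N"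
    and "disjoint_family_on B C"
    and le: "\<And>i. i \<in> C \<Longrightarrow> emeasure M (A i) \<le> c * emeasure N (B i)"
  shows "emeasure M (\<Union>i\<in>C. A i) \<le> c * emeasure N (\<Union>i\<in>C. B i)"
proof -
  define A' where "A' i = A i - (\<Union>j\<in>{j\<in>C. to_nat_on C j < to_nat_on C i}. A j)" for i
  have A': "A' i \<in> sets M" if "i \<in> C" for i
    unfolding A'_def using assms that by (intro sets.Diff sets.countable_UN') auto
  have "x \<in> (\<Union>i\<in>C. A' i)" if "i \<in> C" "x \<in> A i" for i x
  proof -
    obtain k where "k \<in> C" "x \<in> A k" "\<And>j. j \<in> C \<Longrightarrow> x \<in> A j \<Longrightarrow> to_nat_on C k \<le> to_nat_on C j"
      using ex_has_least_nat[of "\<lambda>j. j \<in> C \<and> x \<in> A j" i "to_nat_on C"] \<open>i \<in> C\<close> \<open>x \<in> A i\<close> by blast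
    then show ?thesis
      unfolding A'_def by (force simp: not_less[symmetric])
  qed
  then have UN: "(\<Union>i\<in>C. A i) = (\<Union>i\<in>C. A' i)"
    by (auto simp: A'_def)
  have disj: "disjoint_family_on A' C"
    unfolding disjoint_family_on_def
  proof (intro ballI impI)
    fix i j assume "i \<in> C" "j \<in> C" "i \<noteq> j"
    then have "to_nat_on C i \<noteq> to_nat_on C j"
      using \<open>countable C\<close> by (simp add: to_nat_on_inj)
    then show "A' i \<inter> A' j = {}"
      using \<open>i \<in> C\<close> \<open>j \<in> C\<close> by (auto simp: A'_def neq_iff)
  qed
  have "emeasure M (\<Union>i\<in>C. A i) \<le> (\<integral>\<^sup>+i. emeasure M (A i) \<partial>count_space C)"
    unfolding UN using assms A' disj
    by (subst emeasure_UN_countable) (auto intro!: nn_integral_mono emeasure_mono simp: A'_def)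
  also have "\<dots> \<le> (\<integral>\<^sup>+i. c * emeasure N (B i) \<partial>count_space C)"
    using le by (intro nn_integral_mono) auto
  also have "\<dots> = c * emeasure N (\<Union>i\<in>C. B i)"
    using assms by (subst emeasure_UN_countable) (auto simp: nn_integral_cmult)
  finally show ?thesis .
qed

section \<open>Maximal functions of doubling measures\<close>

text \<open>The supremum of admissible radii need not be attained; a radius beyond half of it is
  enough for all others to be less than twice as large.\<close>

lemma nearly_maximal_radius:
  fixes R :: real
  assumes "P s0" and P: "\<And>s. P s \<Longrightarrow> 0 < s \<and> s \<le> R"
  obtains s where "P s" "\<forall>s'. P s' \<longrightarrow> s' < 2 * s"
proof -
  have bdd: "bdd_above {s. P s}" using P by (auto intro!: bdd_aboveI[of _ R])
  have "0 < s0" using P \<open>P s0\<close> by auto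
  also have "s0 \<le> Sup {s. P s}" using \<open>P s0\<close> by (intro cSup_upper bdd) auto
  finally have "Sup {s. P s} / 2 < Sup {s. P s}" by simp
  then obtain s where s: "P s" "Sup {s. P s} / 2 < s"
    using less_cSup_iff[OF _ bdd, of "Sup {s. P s} / 2"] \<open>P s0\<close> by auto
  have "s' < 2 * s" if "P s'" for s'
    using cSup_upper[OF _ bdd, of s'] that s(2) by auto
  then show thesis using that s(1) by blast
qed

lemma Vitali_disjoint_balls:
  fixes a :: "'a \<Rightarrow> 'b::euclidean_space"
  assumes "S \<subseteq> (\<Union>i\<in>I. ball (a i) (r i))" "\<And>i. i \<in> I \<Longrightarrow> 0 < r i \<and> r i \<le> R"
  obtains C where "countable C" "C \<subseteq> I" "disjoint_family_on (\<lambda>i. ball (a i) (r i)) C"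
    "S \<subseteq> (\<Union>i\<in>C. ball (a i) (5 * r i))"
  using Vitali_covering_lemma_balls[OF assms]
  unfolding disjoint_family_on_def pairwise_def disjnt_def by (metis (no_types, lifting))

lemma nn_integral_indicator_Int:
  "A \<in> sets M \<Longrightarrow> B \<in> sets M \<Longrightarrow> (\<integral>\<^sup>+x\<in>A. indicator B x \<partial>M) = emeasure M (A \<inter> B)"
  by (simp add: indicator_inter_arith[symmetric] mult.commute[of "indicator B _"] Int_commute)

text \<open>The uncentred maximal operator of \<open>\<mu>\<close> over balls of radius below
  \<open>R\<close>. Since all balls containing \<open>x\<close> compete, superlevel sets are unions
  of balls, hence open, whatever \<open>u\<close> is; the bound \<open>R\<close> is what Vitali's
  lemma needs and keeps the operator local.\<close>

definition hl_max :: "'a::metric_space measure \<Rightarrow> real \<Rightarrow> ('a \<Rightarrow> ennreal) \<Rightarrow> 'a \<Rightarrow> ennreal" where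
  "hl_max \<mu> R u x = (SUP (y, s)\<in>{(y, s). 0 < s \<and> s < R \<and> x \<in> ball y s}.
     (\<integral>\<^sup>+z\<in>ball y s. u z \<partial>\<mu>) / emeasure \<mu> (ball y s))"

text \<open>Lebesgue measure, the weight and its dual weight are all treated through this interface.
  The dilation factor 5 is that of Vitali's lemma, so one covering costs one factor
  \<open>D\<close>.\<close>

locale doubling_measure =
  fixes \<mu> :: "'a::euclidean_space measure" and D :: real
  assumes sets_eq: "sets \<mu> = sets lebesgue"
    and D_ge_1: "1 \<le> D"
    and ball_pos: "0 < r \<Longrightarrow> 0 < emeasure \<mu> (ball x r)"
    and ball_finite: "emeasure \<mu> (ball x r) < top"
    and doubling: "0 < r \<Longrightarrow> emeasure \<mu> (ball x (5 * r)) \<le> ennreal D * emeasure \<mu> (ball x r)"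
begin

lemma space_eq [simp]: "space \<mu> = UNIV"
  using sets_eq_imp_space_eq[OF sets_eq] by simp

lemma open_in_sets: "open S \<Longrightarrow> S \<in> sets \<mu>"
  by (simp add: sets_eq)

lemma ball_in_sets [measurable]: "ball x r \<in> sets \<mu>"
  by (simp add: sets_eq)

lemma sigma_finite: "sigma_finite_measure \<mu>"
proof
  have "x \<in> (\<Union>n. ball 0 (real n))" for x :: 'a
    using reals_Archimedean2[of "norm x"] by auto
  then show "\<exists>A. countable A \<and> A \<subseteq> sets \<mu> \<and> \<Union>A = space \<mu> \<and> (\<forall>a\<in>A. emeasure \<mu> a \<noteq> \<infinity>)"
    using ball_finite
    by (intro exI[of _ "range (\<lambda>n. ball 0 (real n))"]) (auto simp: less_top)
qed

lemma less_avg_iff: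
  assumes "0 < s"
  shows "t < a / emeasure \<mu> (ball y s) \<longleftrightarrow> t * emeasure \<mu> (ball y s) < a"
proof -
  obtain b where b: "0 < b" "emeasure \<mu> (ball y s) = ennreal b"
    using ball_pos[OF assms, of y] ball_finite[of y s] by (cases "emeasure \<mu> (ball y s)") auto
  show ?thesis
    unfolding b(2) using b(1)
    by (cases t; cases a)
      (auto simp: divide_ennreal ennreal_top_divide ennreal_less_iff field_simps
         ennreal_mult[symmetric] ennreal_top_mult less_top[symmetric])
qed

lemma less_hl_max_iff:
  "t < hl_max \<mu> R u x \<longleftrightarrow>
    (\<exists>y s. 0 < s \<and> s < R \<and> x \<in> ball y s \<and> t * emeasure \<mu> (ball y s) < (\<integral>\<^sup>+z\<in>ball y s. u z \<partial>\<mu>))"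
  unfolding hl_max_def less_SUP_iff using less_avg_iff by fastforce

lemma integral_ball_le_hl_max:
  assumes "0 < s" "s < R" "x \<in> ball y s"
  shows "(\<integral>\<^sup>+z\<in>ball y s. u z \<partial>\<mu>) \<le> hl_max \<mu> R u x * emeasure \<mu> (ball y s)"
  using less_hl_max_iff[of "hl_max \<mu> R u x" R u x] assms by (metis less_irrefl linorder_not_less)

lemma hl_max_leI:
  assumes "\<And>y s. 0 < s \<Longrightarrow> s < R \<Longrightarrow> x \<in> ball y s \<Longrightarrow> (\<integral>\<^sup>+z\<in>ball y s. u z \<partial>\<mu>) \<le> c * emeasure \<mu> (ball y s)"
  shows "hl_max \<mu> R u x \<le> c"
  using less_hl_max_iff[of c R u x] assms by (metis linorder_not_less)

lemma open_hl_max: "open {x. t < hl_max \<mu> R u x}"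
proof -
  have "{x. t < hl_max \<mu> R u x} = (\<Union>(y, s)\<in>{(y, s). 0 < s \<and> s < R \<and> t * emeasure \<mu> (ball y s) < (\<integral>\<^sup>+z\<in>ball y s. u z \<partial>\<mu>)}. ball y s)"
    unfolding less_hl_max_iff by blast
  then show ?thesis by (auto intro!: open_UN)
qed

lemma hl_max_measurable [measurable]: "hl_max \<mu> R u \<in> borel_measurable lebesgue"
proof (rule borel_measurableI_greater)
  fix t show "{x \<in> space lebesgue. t < hl_max \<mu> R u x} \<in> sets lebesgue"
    using open_hl_max[of t R u] by simp
qed

lemma hl_max_measurable' [measurable]: "hl_max \<mu> R u \<in> borel_measurable \<mu>"
  using hl_max_measurable by (simp add: measurable_cong_sets[OF sets_eq refl])

text \<open>A ball on which the average exceeds \<open>t\<close> has measure at most the integral of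
  \<open>u\<close> over it, divided by \<open>t\<close>. For the disjoint balls of Vitali's lemma
  these integrals add up to at most the whole one, and dilating costs \<open>D\<close>.\<close>

lemma weak_type:
  assumes [measurable]: "u \<in> borel_measurable \<mu>" and "0 < t"
  shows "emeasure \<mu> {x. ennreal t < hl_max \<mu> R u x} \<le> ennreal (D / t) * (\<integral>\<^sup>+x. u x \<partial>\<mu>)"
proof -
  note sets_eq [measurable_cong]
  define K where "K = {(y, s). 0 < s \<and> s < R \<and> ennreal t * emeasure \<mu> (ball y s) < (\<integral>\<^sup>+z\<in>ball y s. u z \<partial>\<mu>)}"
  have sub: "{x. ennreal t < hl_max \<mu> R u x} \<subseteq> (\<Union>i\<in>K. ball (fst i) (snd i))"
    unfolding less_hl_max_iff K_def by auto
  have bd: "0 < snd i \<and> snd i \<le> R" if "i \<in> K" for i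
    using that by (auto simp: K_def)
  obtain C where C: "countable C" "C \<subseteq> K"
     "disjoint_family_on (\<lambda>i. ball (fst i) (snd i)) C"
     "{x. ennreal t < hl_max \<mu> R u x} \<subseteq> (\<Union>i\<in>C. ball (fst i) (5 * snd i))"
    by (rule Vitali_disjoint_balls[OF sub bd])
  have "emeasure \<mu> {x. ennreal t < hl_max \<mu> R u x} \<le> emeasure \<mu> (\<Union>i\<in>C. ball (fst i) (5 * snd i))"
    using C by (intro emeasure_mono) (auto intro!: open_in_sets)
  also have "\<dots> \<le> ennreal (D / t) * emeasure (density \<mu> u) (\<Union>i\<in>C. ball (fst i) (snd i))"
  proof (rule emeasure_UN_le_disjoint)
    show "disjoint_family_on (\<lambda>i. ball (fst i) (snd i)) C" by (rule C(3))
    fix i assume "i \<in> C"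
    then have i: "0 < snd i" "ennreal t * emeasure \<mu> (ball (fst i) (snd i)) \<le> (\<integral>\<^sup>+z\<in>ball (fst i) (snd i). u z \<partial>\<mu>)"
      using C(2) by (auto simp: K_def)
    have "emeasure \<mu> (ball (fst i) (5 * snd i)) \<le> ennreal D * emeasure \<mu> (ball (fst i) (snd i))"
      using i by (intro doubling)
    also have "ennreal D = ennreal (D / t) * ennreal t"
      using D_ge_1 \<open>0 < t\<close> by (subst ennreal_mult[symmetric]) auto
    also have "\<dots> * emeasure \<mu> (ball (fst i) (snd i)) \<le> ennreal (D / t) * (\<integral>\<^sup>+z\<in>ball (fst i) (snd i). u z \<partial>\<mu>)"
      unfolding mult.assoc using i by (intro mult_left_mono) auto
    finally show "emeasure \<mu> (ball (fst i) (5 * snd i)) \<le> ennreal (D / t) * emeasure (density \<mu> u) (ball (fst i) (snd i))"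
      by (simp add: emeasure_density)
  qed (use C in auto)
  also have "\<dots> \<le> ennreal (D / t) * emeasure (density \<mu> u) (space \<mu>)"
    by (intro mult_left_mono emeasure_mono) (auto simp: sets_eq)
  also have "emeasure (density \<mu> u) (space \<mu>) = (\<integral>\<^sup>+x. u x \<partial>\<mu>)"
    by (subst emeasure_density) (auto simp: sets_eq)
  finally show ?thesis .
qed

text \<open>Keeping only the part \<open>u'\<close> of \<open>u\<close> above \<open>t / 2\<close>
  lowers any average by at most \<open>t / 2\<close>, so an average of \<open>u\<close> above
  \<open>t\<close> forces one of \<open>u'\<close> above \<open>t / 2\<close>.\<close>

lemma weak_type_truncated:
  assumes [measurable]: "u \<in> borel_measurable \<mu>" and "0 < t"
  shows "emeasure \<mu> {x. ennreal t < hl_max \<mu> R u x} \<le> ennreal (2 * D / t) * (\<integral>\<^sup>+x\<in>{x. ennreal (t / 2) < u x}. u x \<partial>\<mu>)"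
proof -
  note sets_eq [measurable_cong]
  define u' where "u' x = u x * indicator {x. ennreal (t / 2) < u x} x" for x
  have [measurable]: "u' \<in> borel_measurable \<mu>" unfolding u'_def by measurable
  have "{x. ennreal t < hl_max \<mu> R u x} \<subseteq> {x. ennreal (t / 2) < hl_max \<mu> R u' x}"
  proof safe
    fix x assume "ennreal t < hl_max \<mu> R u x"
    then obtain y s where ys: "0 < s" "s < R" "x \<in> ball y s"
      "ennreal t * emeasure \<mu> (ball y s) < (\<integral>\<^sup>+z\<in>ball y s. u z \<partial>\<mu>)"
      unfolding less_hl_max_iff by auto
    define T where "T = ennreal (t / 2) * emeasure \<mu> (ball y s)"
    have "T + T = ennreal t * emeasure \<mu> (ball y s)"
      unfolding T_def using \<open>0 < t\<close> by (simp add: distrib_right[symmetric] ennreal_plus[symmetric] del: ennreal_plus)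
    note ys(4)[folded this]
    also have "(\<integral>\<^sup>+z\<in>ball y s. u z \<partial>\<mu>) \<le> (\<integral>\<^sup>+z. u' z * indicator (ball y s) z + ennreal (t / 2) * indicator (ball y s) z \<partial>\<mu>)"
      by (intro nn_integral_mono) (auto simp: u'_def split: split_indicator)
    also have "\<dots> = (\<integral>\<^sup>+z\<in>ball y s. u' z \<partial>\<mu>) + T"
      unfolding T_def by (subst nn_integral_add) (auto simp: nn_integral_cmult)
    finally have "T < (\<integral>\<^sup>+z\<in>ball y s. u' z \<partial>\<mu>)"
      by (metis add.commute add_left_mono linorder_not_le)
    then show "ennreal (t / 2) < hl_max \<mu> R u' x"
      unfolding less_hl_max_iff T_def using ys by blast
  qed
  then have "emeasure \<mu> {x. ennreal t < hl_max \<mu> R u x} \<le> emeasure \<mu> {x. ennreal (t / 2) < hl_max \<mu> R u' x}"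
    by (intro emeasure_mono open_in_sets open_hl_max)
  also have "\<dots> \<le> ennreal (D / (t / 2)) * (\<integral>\<^sup>+x. u' x \<partial>\<mu>)"
    using \<open>0 < t\<close> by (intro weak_type) auto
  finally show ?thesis by (simp add: u'_def mult.commute)
qed

text \<open>Marcinkiewicz interpolation between the weak bound and the trivial sup bound: the
  truncated weak estimate is inserted into the layer cake formula and the integrals are
  exchanged.\<close>

lemma strong_type:
  assumes [measurable]: "u \<in> borel_measurable \<mu>" and "1 < r"
  shows "(\<integral>\<^sup>+x. epow (hl_max \<mu> R u x) r \<partial>\<mu>)
    \<le> ennreal (D * r * 2 powr r / (r - 1)) * (\<integral>\<^sup>+x. epow (u x) r \<partial>\<mu>)"
proof -
  note sets_eq [measurable_cong]
  interpret M: sigma_finite_measure \<mu> by (rule sigma_finite)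
  interpret P: pair_sigma_finite \<mu> lborel by unfold_locales
  \<comment> \<open>Pulling out \<open>r / (r - 1)\<close> leaves a kernel with \<open>r - 1\<close>
    in place of \<open>r\<close>, so that the \<open>t\<close>-integral is again a layer cake,
    namely of \<open>epow (2 * u x) (r - 1)\<close>.\<close>
  define k where "k x t = ennreal (2 * D * r / (r - 1)) * u x * (ennreal ((r - 1) * t powr (r - 1 - 1)) * indicator {t. 0 < t \<and> ennreal t < 2 * u x} t)" for x t
  have "(\<integral>\<^sup>+x. epow (hl_max \<mu> R u x) r \<partial>\<mu>) =
    (\<integral>\<^sup>+t. ennreal (r * t powr (r - 1)) * indicator {0<..} t * emeasure \<mu> {x. ennreal t < hl_max \<mu> R u x} \<partial>lborel)"
    using assms(2) by (subst layer_cake[OF sigma_finite]) auto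
  also have "\<dots> \<le> (\<integral>\<^sup>+t. ennreal (r * t powr (r - 1)) * indicator {0<..} t *
      (ennreal (2 * D / t) * (\<integral>\<^sup>+x\<in>{x. ennreal (t / 2) < u x}. u x \<partial>\<mu>)) \<partial>lborel)"
    using weak_type_truncated[OF assms(1)]
    by (intro nn_integral_mono) (auto intro!: mult_left_mono split: split_indicator)
  also have "\<dots> = (\<integral>\<^sup>+t. (\<integral>\<^sup>+x. k x t \<partial>\<mu>) \<partial>lborel)"
  proof (intro nn_integral_cong)
    fix t :: real
    show "ennreal (r * t powr (r - 1)) * indicator {0<..} t *
      (ennreal (2 * D / t) * (\<integral>\<^sup>+x\<in>{x. ennreal (t / 2) < u x}. u x \<partial>\<mu>)) =
      (\<integral>\<^sup>+x. k x t \<partial>\<mu>)"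
    proof (cases "0 < t")
      case True
      have [simp]: "ennreal (t / 2) < v \<longleftrightarrow> ennreal t < 2 * v" for v
        using True
        by (cases v) (auto simp: ennreal_less_iff ennreal_mult_top ennreal_numeral[symmetric] ennreal_mult[symmetric] simp del: ennreal_numeral)
      have c: "r * t powr (r - 1) * (2 * D / t) = 2 * D * r / (r - 1) * ((r - 1) * t powr (r - 1 - 1))"
        using True \<open>1 < r\<close> powr_diff[of t "r - 1" 1] by simp
      have "ennreal (r * t powr (r - 1)) * (ennreal (2 * D / t) * (\<integral>\<^sup>+x\<in>{x. ennreal (t / 2) < u x}. u x \<partial>\<mu>)) =
        (ennreal (2 * D * r / (r - 1)) * ennreal ((r - 1) * t powr (r - 1 - 1))) * (\<integral>\<^sup>+x\<in>{x. ennreal (t / 2) < u x}. u x \<partial>\<mu>)"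
        using True \<open>1 < r\<close> D_ge_1 c by (simp add: ennreal_mult[symmetric] mult.assoc[symmetric])
      also have "\<dots> = (\<integral>\<^sup>+x. ennreal (2 * D * r / (r - 1)) * ennreal ((r - 1) * t powr (r - 1 - 1)) * (u x * indicator {x. ennreal (t / 2) < u x} x) \<partial>\<mu>)"
        by (subst nn_integral_cmult) auto
      also have "\<dots> = (\<integral>\<^sup>+x. k x t \<partial>\<mu>)"
        using True by (intro nn_integral_cong) (auto split: split_indicator simp: k_def mult_ac)
      finally show ?thesis using True by simp
    qed (simp add: k_def)
  qed
  also have "\<dots> = (\<integral>\<^sup>+x. (\<integral>\<^sup>+t. k x t \<partial>lborel) \<partial>\<mu>)"
    unfolding k_def by (intro P.Fubini') measurable
  also have "\<dots> = (\<integral>\<^sup>+x. ennreal (2 * D * r / (r - 1)) * u x * epow (2 * u x) (r - 1) \<partial>\<mu>)"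
  proof (intro nn_integral_cong)
    fix x
    have "(\<integral>\<^sup>+t. k x t \<partial>lborel)
      = ennreal (2 * D * r / (r - 1)) * u x * (\<integral>\<^sup>+t. ennreal ((r - 1) * t powr (r - 1 - 1)) * indicator {t. 0 < t \<and> ennreal t < 2 * u x} t \<partial>lborel)"
      unfolding k_def by (intro nn_integral_cmult) measurable
    then show "(\<integral>\<^sup>+t. k x t \<partial>lborel)
      = ennreal (2 * D * r / (r - 1)) * u x * epow (2 * u x) (r - 1)"
      using \<open>1 < r\<close> by (subst epow_eq_nn_integral) auto
  qed
  also have "\<dots> = (\<integral>\<^sup>+x. ennreal (D * r * 2 powr r / (r - 1)) * epow (u x) r \<partial>\<mu>)"
  proof (intro nn_integral_cong)
    fix x
    have "epow 2 (r - 1) = ennreal (2 powr (r - 1))"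
      using epow_ennreal[of 2 "r - 1"] by simp
    moreover have "u x * epow (u x) (r - 1) = epow (u x) r"
      using epow_add[of 1 "r - 1" "u x"] \<open>1 < r\<close> by simp
    moreover have "ennreal (2 * D * r / (r - 1)) * ennreal (2 powr (r - 1)) = ennreal (D * r * 2 powr r / (r - 1))"
      using \<open>1 < r\<close> D_ge_1 by (subst ennreal_mult[symmetric]) (auto simp: powr_diff field_simps)
    ultimately show "ennreal (2 * D * r / (r - 1)) * u x * epow (2 * u x) (r - 1) = ennreal (D * r * 2 powr r / (r - 1)) * epow (u x) r"
      using \<open>1 < r\<close> by (subst epow_mult) (auto simp: mult_ac simp flip: mult.assoc)
  qed
  finally show ?thesis
    by (simp add: nn_integral_cmult)
qed

end

interpretation lebesgue: doubling_measure "lebesgue :: 'a::euclidean_space measure" "5 ^ DIM('a)"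
proof
  show "vol (ball x (5 * r)) \<le> ennreal (5 ^ DIM('a)) * vol (ball x r)" if "0 < r" for x :: 'a and r
    using emeasure_lebesgue_ball_scale[of 5 r x x] that by simp
qed (auto simp: emeasure_lebesgue_ball_pos emeasure_lebesgue_ball_finite)

text \<open>Half of Lebesgue's differentiation theorem, also for functions that are infinite or not
  locally integrable. Let \<open>m\<close> be the measure of a bounded set where \<open>u\<close>
  exceeds \<open>t\<close> but the maximal function is at most \<open>s < t\<close>. Small disjoint
  balls inside an open set of measure at most \<open>m + e\<close> cover almost all of it, and
  comparing integrals gives \<open>t * m \<le> s * (m + e)\<close>.\<close>

lemma AE_le_hl_max:
  assumes [measurable]: "u \<in> borel_measurable lebesgue" and "0 < R"
  shows "AE x in lebesgue. u x \<le> hl_max lebesgue R u (x::'a::euclidean_space)"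
proof -
  define N where "N s t n = {x\<in>ball 0 (real n). ennreal t < u x \<and> hl_max lebesgue R u x \<le> ennreal s}" for s t n
  have "N s t n \<in> null_sets lebesgue" if st: "0 \<le> s" "s < t" for s t n
  proof -
    have N[measurable]: "N s t n \<in> sets lebesgue"
    proof -
      have "N s t n = ball 0 (real n) \<inter> {x\<in>space lebesgue. ennreal t < u x} \<inter> {x\<in>space lebesgue. hl_max lebesgue R u x \<le> ennreal s}"
        by (auto simp: N_def)
      also have "\<dots> \<in> sets lebesgue"
        by (intro sets.Int) measurable
      finally show ?thesis .
    qed
    have "vol (N s t n) \<le> vol (ball (0::'a) (real n))"
      by (intro emeasure_mono) (auto simp: N_def)
    also have "\<dots> < top" by (rule emeasure_lebesgue_ball_finite)
    finally obtain m where m: "0 \<le> m" "vol (N s t n) = ennreal m"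
      by (cases "vol (N s t n)") auto
    have "t * m \<le> s * (m + e)" if "0 < e" for e
    proof -
      obtain T where T: "open T" "N s t n \<subseteq> T" "T - N s t n \<in> lmeasurable" "vol (T - N s t n) < ennreal e"
        by (rule sets_lebesgue_outer_open[OF N \<open>0 < e\<close>])
      define K where "K = {(y, r). 0 < r \<and> ball y r \<subseteq> T \<and> (\<integral>\<^sup>+z\<in>ball y r. u z \<partial>lebesgue) \<le> ennreal s * vol (ball y r)}"
      have "\<exists>i. i \<in> K \<and> x \<in> ball (fst i) (snd i) \<and> snd i < d" if x: "x \<in> N s t n" and "0 < d" for x d
      proof -
        obtain r where r: "0 < r" "ball x r \<subseteq> T"
          using T x by (meson open_contains_ball subsetD)
        define r' where "r' = min r (min (R/2) (d/2))"
        have r': "0 < r'" "r' < R" "r' < d" "r' \<le> r"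
          using r \<open>0 < R\<close> \<open>0 < d\<close> by (auto simp: r'_def)
        have "(\<integral>\<^sup>+z\<in>ball x r'. u z \<partial>lebesgue) \<le> hl_max lebesgue R u x * vol (ball x r')"
          using r' by (intro lebesgue.integral_ball_le_hl_max) auto
        also have "\<dots> \<le> ennreal s * vol (ball x r')"
          using x by (intro mult_right_mono) (auto simp: N_def)
        finally have "(x, r') \<in> K"
          using r r' subset_ball[of r' r x] by (auto simp: K_def)
        then show ?thesis using r' by force
      qed
      then obtain C where C: "countable C" "C \<subseteq> K"
        "pairwise (\<lambda>i j. disjnt (ball (fst i) (snd i)) (ball (fst j) (snd j))) C"
        "negligible (N s t n - (\<Union>i\<in>C. ball (fst i) (snd i)))"
        using Vitali_covering_theorem_balls[of "N s t n" K fst snd] by blast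
      define U where "U = (\<Union>i\<in>C. ball (fst i) (snd i))"
      have [measurable]: "U \<in> sets lebesgue" unfolding U_def by (auto intro!: lebesgue.open_in_sets)
      have "ennreal t * vol (N s t n) = (\<integral>\<^sup>+x. ennreal t * indicator (N s t n) x \<partial>lebesgue)"
        by (simp add: nn_integral_cmult)
      also have "\<dots> \<le> (\<integral>\<^sup>+x. u x * indicator U x \<partial>lebesgue)"
      proof (rule nn_integral_mono_AE)
        have "AE x in lebesgue. x \<notin> N s t n - U"
          using C(4) by (intro AE_not_in) (simp add: U_def negligible_iff_null_sets)
        then show "AE x in lebesgue. ennreal t * indicator (N s t n) x \<le> u x * indicator U x"
          by eventually_elim (auto simp: N_def split: split_indicator)
      qed
      also have "\<dots> = emeasure (density lebesgue u) U"
        by (simp add: emeasure_density)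
      also have "\<dots> \<le> ennreal s * vol U"
        unfolding U_def
      proof (rule emeasure_UN_le_disjoint)
        show "disjoint_family_on (\<lambda>i. ball (fst i) (snd i)) C"
          using C(3) by (auto simp: disjoint_family_on_def pairwise_def disjnt_def)
        show "emeasure (density lebesgue u) (ball (fst i) (snd i)) \<le> ennreal s * vol (ball (fst i) (snd i))" if "i \<in> C" for i
          using that C(2) by (auto simp: K_def emeasure_density)
      qed (use C in auto)
      also have "\<dots> \<le> ennreal s * vol (N s t n \<union> (T - N s t n))"
      proof (intro mult_left_mono emeasure_mono)
        have "ball (fst i) (snd i) \<subseteq> T" if "i \<in> C" for i
          using subsetD[OF C(2) that] by (auto simp: K_def split: prod.splits)
        then show "U \<subseteq> N s t n \<union> (T - N s t n)"
          unfolding U_def by blast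
      qed (use T in auto)
      also have "\<dots> \<le> ennreal s * (vol (N s t n) + vol (T - N s t n))"
        using T by (intro mult_left_mono emeasure_subadditive) auto
      also have "\<dots> \<le> ennreal s * (ennreal m + ennreal e)"
        using T m by (intro mult_left_mono add_mono) auto
      finally have "ennreal (t * m) \<le> ennreal (s * (m + e))"
        using m st \<open>0 < e\<close> by (simp add: ennreal_mult ennreal_plus[symmetric] del: ennreal_plus)
      then show ?thesis
        using m st \<open>0 < e\<close> by (subst (asm) ennreal_le_iff) auto
    qed
    \<comment> \<open>With this slack, \<open>s * e\<close> is at most half of
      \<open>m * (t - s)\<close>; the summand 1 in the denominator also covers
      \<open>s = 0\<close>.\<close>
    from this[of "m * (t - s) / (2 * (s + 1))"] have "m = 0"
    proof (rule_tac ccontr)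
      assume "m \<noteq> 0"
      then have "0 < m" using m by auto
      have "0 < m * (t - s) / (2 * (s + 1))" using \<open>0 < m\<close> st by auto
      then have "t * m \<le> s * (m + m * (t - s) / (2 * (s + 1)))"
        by fact
      also have "\<dots> = s * m + (s / (s + 1)) * (m * (t - s)) / 2"
        using st by (simp add: field_simps)
      also have "(s / (s + 1)) * (m * (t - s)) / 2 \<le> 1 * (m * (t - s)) / 2"
        using st \<open>0 < m\<close> by (intro divide_right_mono mult_right_mono) auto
      finally have "t * m \<le> s * m + m * (t - s) / 2" by simp
      moreover have "m * (t - s) = t * m - s * m" by (simp add: algebra_simps)
      moreover have "0 < m * (t - s)" using \<open>0 < m\<close> st by simp
      ultimately show False by linarith
    qed
    then show ?thesis using m by (auto simp: null_sets_def)
  qed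
  then have "AE x in lebesgue. \<forall>s t :: rat. \<forall>n. 0 \<le> s \<and> s < t \<longrightarrow> x \<notin> N (real_of_rat s) (real_of_rat t) n"
    by (auto simp: AE_all_countable of_rat_less intro!: AE_not_in)
  then show ?thesis
  proof eventually_elim
    case (elim x)
    show ?case
    proof (rule ccontr)
      assume "\<not> u x \<le> hl_max lebesgue R u x"
      then have "hl_max lebesgue R u x < u x" by simp
      then obtain s where s: "hl_max lebesgue R u x < ennreal (real_of_rat s)" "ennreal (real_of_rat s) < u x"
        using ennreal_rat_dense by blast
      then obtain t where t: "ennreal (real_of_rat s) < ennreal (real_of_rat t)" "ennreal (real_of_rat t) < u x"
        using ennreal_rat_dense by blast
      have "0 < real_of_rat s"
        using s(1) by (metis ennreal_neg linorder_not_le not_less_zero)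
      then have "0 \<le> s" "s < t"
        using t(1) by (auto simp: ennreal_less_iff of_rat_less)
      moreover obtain n where "norm x < real n"
        using reals_Archimedean2 by blast
      ultimately have "\<not> hl_max lebesgue R u x \<le> ennreal (real_of_rat s)"
        using elim t(2) by (auto simp: N_def)
      then show False using s(1) by simp
    qed
  qed
qed

section \<open>Muckenhoupt weights\<close>

lemma Youngs_inequality_ennreal:
  assumes "1 < p" "1 < q" "1 / p + 1 / q = (1::real)"
  shows "a * b \<le> ennreal (1 / p) * epow a p + ennreal (1 / q) * epow b q"
proof (cases a; cases b)
  fix r s assume "0 \<le> r" "a = ennreal r" "0 \<le> s" "b = ennreal s"
  then show ?thesis
    using Youngs_inequality[OF assms, of r s] assms
    by (simp add: epow_ennreal ennreal_mult[symmetric] ennreal_plus[symmetric] del: ennreal_plus)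
qed (use assms in \<open>auto simp: ennreal_mult_top\<close>)

lemma Holder_nn_integral:
  assumes [measurable]: "f \<in> borel_measurable M" "g \<in> borel_measurable M"
    and pq: "1 < p" "1 < q" "1 / p + 1 / q = (1::real)"
  shows "(\<integral>\<^sup>+x. f x * g x \<partial>M) \<le> epow (\<integral>\<^sup>+x. epow (f x) p \<partial>M) (1 / p) * epow (\<integral>\<^sup>+x. epow (g x) q \<partial>M) (1 / q)"
    (is "_ \<le> epow ?F _ * epow ?G _")
proof (cases "?F = 0 \<or> ?G = 0")
  case True
  then have "AE x in M. f x * g x = 0"
    by (auto simp: nn_integral_0_iff_AE)
  then have "(\<integral>\<^sup>+x. f x * g x \<partial>M) = 0"
    by (simp add: nn_integral_0_iff_AE)
  then show ?thesis by simp
next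
  case nz: False
  show ?thesis
  proof (cases "?F = top \<or> ?G = top")
    case True
    then have "epow ?F (1 / p) * epow ?G (1 / q) = top"
      using nz by (auto simp: ennreal_mult_eq_top_iff)
    then show ?thesis by simp
  next
    case False
    define A where "A = enn2real ?F powr (1 / p)"
    define B where "B = enn2real ?G powr (1 / q)"
    have F: "0 < enn2real ?F" "ennreal (enn2real ?F) = ?F" and G: "0 < enn2real ?G" "ennreal (enn2real ?G) = ?G"
      using nz False by (auto simp: enn2real_positive_iff less_top[symmetric] zero_less_iff_neq_zero)
    then have AB: "0 < A" "0 < B"
      by (auto simp: A_def B_def)
    have eA: "epow ?F (1 / p) = ennreal A" and eB: "epow ?G (1 / q) = ennreal B"
      using False by (simp_all add: epow_def A_def B_def)
    have Ap: "epow (ennreal (1 / A)) p * ?F = 1"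
    proof -
      have "epow (ennreal (1 / A)) p * ?F = ennreal ((1 / A) powr p * enn2real ?F)"
        using AB F by (subst F(2)[symmetric]) (simp add: epow_ennreal ennreal_mult)
      also have "(1 / A) powr p * enn2real ?F = 1"
        using AB F(1) pq by (simp add: powr_divide A_def powr_powr)
      finally show ?thesis by simp
    qed
    have Bq: "epow (ennreal (1 / B)) q * ?G = 1"
    proof -
      have "epow (ennreal (1 / B)) q * ?G = ennreal ((1 / B) powr q * enn2real ?G)"
        using AB G by (subst G(2)[symmetric]) (simp add: epow_ennreal ennreal_mult)
      also have "(1 / B) powr q * enn2real ?G = 1"
        using AB G(1) pq by (simp add: powr_divide B_def powr_powr)
      finally show ?thesis by simp
    qed
    have AB1: "ennreal A * ennreal (1 / A) = 1" "ennreal B * ennreal (1 / B) = 1"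
      using AB by (simp_all add: ennreal_mult[symmetric])
    have "(\<integral>\<^sup>+x. f x * g x \<partial>M) = (\<integral>\<^sup>+x. ennreal A * ennreal B * ((ennreal (1 / A) * f x) * (ennreal (1 / B) * g x)) \<partial>M)"
    proof (intro nn_integral_cong)
      fix x
      have "f x * g x = (ennreal A * ennreal (1 / A)) * (ennreal B * ennreal (1 / B)) * (f x * g x)"
        unfolding AB1 by simp
      then show "f x * g x = ennreal A * ennreal B * ((ennreal (1 / A) * f x) * (ennreal (1 / B) * g x))"
        by (simp only: mult_ac)
    qed
    also have "\<dots> = ennreal A * ennreal B * (\<integral>\<^sup>+x. (ennreal (1 / A) * f x) * (ennreal (1 / B) * g x) \<partial>M)"
      by (intro nn_integral_cmult) measurable
    also have "(\<integral>\<^sup>+x. (ennreal (1 / A) * f x) * (ennreal (1 / B) * g x) \<partial>M) \<le>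
      (\<integral>\<^sup>+x. ennreal (1 / p) * epow (ennreal (1 / A)) p * epow (f x) p + ennreal (1 / q) * epow (ennreal (1 / B)) q * epow (g x) q \<partial>M)"
    proof (intro nn_integral_mono)
      fix x
      show "(ennreal (1 / A) * f x) * (ennreal (1 / B) * g x) \<le>
        ennreal (1 / p) * epow (ennreal (1 / A)) p * epow (f x) p + ennreal (1 / q) * epow (ennreal (1 / B)) q * epow (g x) q"
        using Youngs_inequality_ennreal[OF pq, of "ennreal (1 / A) * f x" "ennreal (1 / B) * g x"] pq
        by (simp add: epow_mult mult.assoc)
    qed
    also have "\<dots> = ennreal (1 / p) * (epow (ennreal (1 / A)) p * ?F) + ennreal (1 / q) * (epow (ennreal (1 / B)) q * ?G)"
      by (subst nn_integral_add) (simp_all add: nn_integral_cmult mult.assoc)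
    also have "\<dots> = 1"
      unfolding Ap Bq using pq by (simp add: ennreal_plus[symmetric] del: ennreal_plus)
    finally show ?thesis
      unfolding eA eB by (simp add: mult_left_mono)
  qed
qed

definition maximal_const :: "real \<Rightarrow> real \<Rightarrow> real" where
  "maximal_const D r = D * r * 2 powr r / (r - 1)"

text \<open>Arises from the \<open>A_q\<close> inequality on the dilated ball and Hoelder's lower
  bound on the ball itself; \<open>(5 ^ d) powr q\<close> is the ratio of the \<open>q\<close>-th
  powers of the two volumes.\<close>

definition Aq_doubling :: "nat \<Rightarrow> real \<Rightarrow> real \<Rightarrow> real" where
  "Aq_doubling d q K = K * (5 ^ d) powr q"

text \<open>With \<open>q' = q / (q - 1)\<close>, the factors are the power \<open>q'\<close> of the
  constant in the pointwise bound, the norm bound for \<open>w\<close> on \<open>L^q'(w)\<close> and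
  the one for the dual weight on its own \<open>L^q\<close>.\<close>

definition Aq_maximal_const :: "nat \<Rightarrow> real \<Rightarrow> real \<Rightarrow> real" where
  "Aq_maximal_const d q K = K powr (q / (q - 1)) * maximal_const (Aq_doubling d q K) (q / (q - 1))
     * maximal_const (Aq_doubling d q K powr (1 / (q - 1))) q"

text \<open>The \<open>A_q\<close> condition multiplied by the \<open>q\<close>-th power of the
  volume, so that no averages occur. The weight is positive everywhere, which makes the dual weight
  \<open>\<sigma>\<close> and all reciprocals finite; a given weight is first changed on a null
  set.\<close>

locale muckenhoupt =
  fixes w \<sigma> :: "'a::euclidean_space \<Rightarrow> real" and q K :: real
  assumes w_measurable [measurable]: "w \<in> borel_measurable lebesgue"
    and w_pos: "0 < w x"
    and \<sigma>_eq: "\<sigma> x = w x powr (- 1 / (q - 1))"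
    and q_gt_1: "1 < q" and K_ge_1: "1 \<le> K"
    and w_ball_finite: "emeasure (density lebesgue (\<lambda>x. ennreal (w x))) (ball x r) < top"
    and \<sigma>_ball_finite: "emeasure (density lebesgue (\<lambda>x. ennreal (\<sigma> x))) (ball x r) < top"
    and Aq: "0 < r \<Longrightarrow> emeasure (density lebesgue (\<lambda>x. ennreal (w x))) (ball x r) *
      epow (emeasure (density lebesgue (\<lambda>x. ennreal (\<sigma> x))) (ball x r)) (q - 1)
      \<le> ennreal K * epow (vol (ball x r)) q"
begin

definition "W = density lebesgue (\<lambda>x. ennreal (w x))"
definition "S = density lebesgue (\<lambda>x. ennreal (\<sigma> x))"

lemma \<sigma>_measurable [measurable]: "\<sigma> \<in> borel_measurable lebesgue"
proof -
  have "\<sigma> = (\<lambda>x. w x powr (- 1 / (q - 1)))"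
    using \<sigma>_eq by auto
  then show ?thesis by simp
qed

lemma \<sigma>_pos: "0 < \<sigma> x"
  using w_pos[of x] by (simp add: \<sigma>_eq)

lemma sets_W: "sets W = sets lebesgue" and sets_S: "sets S = sets lebesgue"
  by (simp_all add: W_def S_def)

lemma space_W: "space W = UNIV" and space_S: "space S = UNIV"
  by (simp_all add: W_def S_def)

lemma nn_integral_W: "u \<in> borel_measurable lebesgue \<Longrightarrow> (\<integral>\<^sup>+x. u x \<partial>W) = (\<integral>\<^sup>+x. ennreal (w x) * u x \<partial>lebesgue)"
  unfolding W_def by (rule nn_integral_density) auto

lemma nn_integral_W_AE_eq:
  assumes "AE x in lebesgue. w0 x = w x" and [measurable]: "u \<in> borel_measurable lebesgue"
  shows "(\<integral>\<^sup>+x. u x \<partial>W) = (\<integral>\<^sup>+x. ennreal (w0 x) * u x \<partial>lebesgue)"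
  unfolding nn_integral_W[OF assms(2)]
  by (rule nn_integral_cong_AE) (use assms(1) in \<open>eventually_elim, simp\<close>)

lemma nn_integral_S: "u \<in> borel_measurable lebesgue \<Longrightarrow> (\<integral>\<^sup>+x. u x \<partial>S) = (\<integral>\<^sup>+x. ennreal (\<sigma> x) * u x \<partial>lebesgue)"
  unfolding S_def by (rule nn_integral_density) auto

lemma ball_pos_density:
  assumes [measurable]: "v \<in> borel_measurable lebesgue" and "\<And>x. 0 < v x" and "0 < r"
  shows "0 < emeasure (density lebesgue (\<lambda>x. ennreal (v x))) (ball (x::'a) r)"
proof (rule ccontr)
  assume "\<not> 0 < emeasure (density lebesgue (\<lambda>x. ennreal (v x))) (ball x r)"
  then have "(\<integral>\<^sup>+z\<in>ball x r. ennreal (v z) \<partial>lebesgue) = 0"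
    by (subst (asm) emeasure_density) auto
  then have "AE z in lebesgue. ennreal (v z) * indicator (ball x r) z = 0"
    by (subst (asm) nn_integral_0_iff_AE) auto
  then have "AE z in lebesgue. z \<notin> ball x r"
    by eventually_elim (use assms(2) in \<open>auto simp: indicator_def ennreal_eq_0_iff not_le[symmetric] split: if_splits\<close>)
  then have "vol (ball x r) = 0"
    by (subst (asm) AE_iff_null) (auto simp: null_sets_def ball_def)
  then show False using emeasure_lebesgue_ball_pos[OF \<open>0 < r\<close>, of x] by simp
qed

lemma W_ball_pos: "0 < r \<Longrightarrow> 0 < emeasure W (ball x r)"
  unfolding W_def by (intro ball_pos_density w_pos) auto

lemma S_ball_pos: "0 < r \<Longrightarrow> 0 < emeasure S (ball x r)"
  unfolding S_def by (intro ball_pos_density \<sigma>_pos) auto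

text \<open>Hoelder for the factors \<open>u * w powr (1 / q)\<close> and
  \<open>w powr (- 1 / q)\<close>: the conjugate power of the second one is
  \<open>\<sigma>\<close>.\<close>

lemma integral_le_S:
  assumes [measurable]: "u \<in> borel_measurable lebesgue" "B \<in> sets lebesgue"
  shows "epow (\<integral>\<^sup>+x\<in>B. u x \<partial>lebesgue) q \<le> (\<integral>\<^sup>+x\<in>B. epow (u x) q \<partial>W) * epow (emeasure S B) (q - 1)"
proof -
  define f where "f x = u x * ennreal (w x powr (1 / q)) * indicator B x" for x
  define g where "g x = ennreal (w x powr (- 1 / q)) * indicator B x" for x
  define q' where "q' = q / (q - 1)"
  have q': "1 < q'" "1 / q + 1 / q' = 1"
    using q_gt_1 by (auto simp: q'_def field_simps)
  have [measurable]: "f \<in> borel_measurable lebesgue" "g \<in> borel_measurable lebesgue"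
    unfolding f_def g_def by measurable
  have "(\<integral>\<^sup>+x\<in>B. u x \<partial>lebesgue) = (\<integral>\<^sup>+x. f x * g x \<partial>lebesgue)"
  proof (intro nn_integral_cong)
    fix x
    have "ennreal (w x powr (1 / q)) * ennreal (w x powr (- 1 / q)) = 1"
      using w_pos[of x] by (simp add: ennreal_mult[symmetric] powr_add[symmetric])
    then show "u x * indicator B x = f x * g x"
      by (auto simp: f_def g_def mult.assoc split: split_indicator)
  qed
  also have "\<dots> \<le> epow (\<integral>\<^sup>+x. epow (f x) q \<partial>lebesgue) (1 / q) * epow (\<integral>\<^sup>+x. epow (g x) q' \<partial>lebesgue) (1 / q')"
    using q' q_gt_1 by (intro Holder_nn_integral) auto
  also have "(\<integral>\<^sup>+x. epow (f x) q \<partial>lebesgue) = (\<integral>\<^sup>+x\<in>B. epow (u x) q \<partial>W)"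
  proof -
    have "(\<integral>\<^sup>+x\<in>B. epow (u x) q \<partial>W) = (\<integral>\<^sup>+x. ennreal (w x) * (epow (u x) q * indicator B x) \<partial>lebesgue)"
      by (intro nn_integral_W) measurable
    also have "\<dots> = (\<integral>\<^sup>+x. epow (f x) q \<partial>lebesgue)"
      using q_gt_1 w_pos
      by (intro nn_integral_cong)
         (auto simp: f_def epow_mult epow_ennreal powr_powr less_imp_le mult.commute split: split_indicator)
    finally show ?thesis by simp
  qed
  also have "(\<integral>\<^sup>+x. epow (g x) q' \<partial>lebesgue) = emeasure S B"
  proof -
    have "emeasure S B = (\<integral>\<^sup>+x\<in>B. ennreal (\<sigma> x) \<partial>lebesgue)"
      unfolding S_def by (rule emeasure_density) auto
    also have "\<dots> = (\<integral>\<^sup>+x. epow (g x) q' \<partial>lebesgue)"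
      using q_gt_1 w_pos
      by (intro nn_integral_cong)
         (auto simp: g_def epow_ennreal powr_powr \<sigma>_eq q'_def divide_simps split: split_indicator)
    finally show ?thesis by simp
  qed
  finally have "epow (\<integral>\<^sup>+x\<in>B. u x \<partial>lebesgue) q
      \<le> epow (epow (\<integral>\<^sup>+x\<in>B. epow (u x) q \<partial>W) (1 / q) * epow (emeasure S B) (1 / q')) q"
    using q_gt_1 by simp
  also have "\<dots> = (\<integral>\<^sup>+x\<in>B. epow (u x) q \<partial>W) * epow (emeasure S B) (q - 1)"
    using q_gt_1 by (simp add: epow_mult epow_epow q'_def)
  finally show ?thesis .
qed

text \<open>In terms of averages: up to \<open>K\<close>, the \<open>q\<close>-th power of the
  Lebesgue average is bounded by the \<open>w\<close>-average of the \<open>q\<close>-th power.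
  Indicators in it compare \<open>w\<close> with volume; general \<open>u\<close> compare the
  maximal operators of Lebesgue measure and of \<open>w\<close>.\<close>

lemma integral_powr_le:
  assumes [measurable]: "u \<in> borel_measurable lebesgue" and "0 < r"
  shows "epow (lint (ball x r) u) q * emeasure W (ball x r)
    \<le> ennreal K * epow (vol (ball x r)) q * (\<integral>\<^sup>+z\<in>ball x r. epow (u z) q \<partial>W)"
proof -
  have "epow (lint (ball x r) u) q * emeasure W (ball x r)
    \<le> (\<integral>\<^sup>+z\<in>ball x r. epow (u z) q \<partial>W) * epow (emeasure S (ball x r)) (q - 1) * emeasure W (ball x r)"
    by (intro mult_right_mono integral_le_S) auto
  also have "\<dots> = (\<integral>\<^sup>+z\<in>ball x r. epow (u z) q \<partial>W) * (emeasure W (ball x r) * epow (emeasure S (ball x r)) (q - 1))"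
    by (simp add: mult_ac)
  also have "\<dots> \<le> (\<integral>\<^sup>+z\<in>ball x r. epow (u z) q \<partial>W) * (ennreal K * epow (vol (ball x r)) q)"
    using Aq[OF \<open>0 < r\<close>] by (intro mult_left_mono) (auto simp: W_def S_def)
  finally show ?thesis by (simp add: mult_ac)
qed

lemma ball_le_W_S:
  "epow (vol (ball x r)) q \<le> emeasure W (ball x r) * epow (emeasure S (ball x r)) (q - 1)"
proof -
  have "(\<integral>\<^sup>+z\<in>ball x r. epow 1 q \<partial>W) = emeasure W (ball x r)"
    by (simp add: sets_W)
  then show ?thesis using integral_le_S[of "\<lambda>_. 1" "ball x r"] by simp
qed

lemma Dw_ge_1: "1 \<le> Aq_doubling DIM('a) q K"
proof -
  have "1 * 1 \<le> K * (5 ^ DIM('a)) powr q"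
    using K_ge_1 q_gt_1 by (intro mult_mono ge_one_powr_ge_zero) auto
  then show ?thesis by (simp add: Aq_doubling_def)
qed

text \<open>The product is comparable to the \<open>q\<close>-th power of the volume, from above by
  the \<open>A_q\<close> inequality and from below by Hoelder, so it is doubling. Each measure then
  inherits doubling: the ball of the other one is enlarged and the common factor, positive and
  finite, is cancelled.\<close>

lemma W_S_doubling:
  assumes "0 < r"
  shows "emeasure W (ball x (5 * r)) * epow (emeasure S (ball x (5 * r))) (q - 1)
    \<le> ennreal (Aq_doubling DIM('a) q K) * (emeasure W (ball x r) * epow (emeasure S (ball x r)) (q - 1))"
proof -
  have "emeasure W (ball x (5 * r)) * epow (emeasure S (ball x (5 * r))) (q - 1) \<le> ennreal K * epow (vol (ball x (5 * r))) q"
    using Aq[of "5 * r" x] assms by (simp add: W_def S_def)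
  also have "vol (ball x (5 * r)) = ennreal (5 ^ DIM('a)) * vol (ball x r)"
    using assms by (intro emeasure_lebesgue_ball_scale) auto
  also have "ennreal K * epow (ennreal (5 ^ DIM('a)) * vol (ball x r)) q = ennreal (Aq_doubling DIM('a) q K) * epow (vol (ball x r)) q"
    using q_gt_1 K_ge_1 epow_ennreal[of "5 ^ DIM('a)" q]
    by (simp add: epow_mult Aq_doubling_def ennreal_mult mult.assoc)
  also have "\<dots> \<le> ennreal (Aq_doubling DIM('a) q K) * (emeasure W (ball x r) * epow (emeasure S (ball x r)) (q - 1))"
    by (intro mult_left_mono ball_le_W_S) auto
  finally show ?thesis .
qed

lemma W_doubling:
  assumes "0 < r"
  shows "emeasure W (ball x (5 * r)) \<le> ennreal (Aq_doubling DIM('a) q K) * emeasure W (ball x r)"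
proof -
  define s where "s = epow (emeasure S (ball x (5 * r))) (q - 1)"
  have s: "s \<noteq> 0" "s \<noteq> top"
    using S_ball_pos[of "5 * r" x] assms \<sigma>_ball_finite[of x "5 * r"] by (auto simp: s_def S_def)
  have "emeasure W (ball x (5 * r)) * s \<le> ennreal (Aq_doubling DIM('a) q K) * (emeasure W (ball x r) * epow (emeasure S (ball x r)) (q - 1))"
    unfolding s_def by (rule W_S_doubling[OF assms])
  also have "\<dots> \<le> ennreal (Aq_doubling DIM('a) q K) * (emeasure W (ball x r) * s)"
    unfolding s_def using assms q_gt_1 by (intro mult_left_mono epow_mono emeasure_mono) (auto simp: sets_S)
  finally have "s * emeasure W (ball x (5 * r)) \<le> s * (ennreal (Aq_doubling DIM('a) q K) * emeasure W (ball x r))"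
    by (simp add: mult_ac)
  then show ?thesis using s by (simp add: ennreal_mult_le_mult_iff)
qed

lemma S_doubling:
  assumes "0 < r"
  shows "emeasure S (ball x (5 * r)) \<le> ennreal (Aq_doubling DIM('a) q K powr (1 / (q - 1))) * emeasure S (ball x r)"
proof -
  define s where "s = emeasure W (ball x (5 * r))"
  have s: "s \<noteq> 0" "s \<noteq> top"
    using W_ball_pos[of "5 * r" x] assms w_ball_finite[of x "5 * r"] by (auto simp: s_def W_def)
  have "s * epow (emeasure S (ball x (5 * r))) (q - 1) \<le> ennreal (Aq_doubling DIM('a) q K) * (emeasure W (ball x r) * epow (emeasure S (ball x r)) (q - 1))"
    unfolding s_def by (rule W_S_doubling[OF assms])
  also have "\<dots> \<le> ennreal (Aq_doubling DIM('a) q K) * (s * epow (emeasure S (ball x r)) (q - 1))"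
    unfolding s_def using assms by (intro mult_left_mono mult_right_mono emeasure_mono) (auto simp: sets_W)
  finally have "s * epow (emeasure S (ball x (5 * r))) (q - 1) \<le> s * (ennreal (Aq_doubling DIM('a) q K) * epow (emeasure S (ball x r)) (q - 1))"
    by (simp add: mult_ac)
  then have "epow (emeasure S (ball x (5 * r))) (q - 1) \<le> ennreal (Aq_doubling DIM('a) q K) * epow (emeasure S (ball x r)) (q - 1)"
    using s by (simp add: ennreal_mult_le_mult_iff)
  also have "ennreal (Aq_doubling DIM('a) q K) = epow (ennreal (Aq_doubling DIM('a) q K powr (1 / (q - 1)))) (q - 1)"
    using Dw_ge_1 q_gt_1 by (simp add: epow_ennreal powr_powr)
  finally show ?thesis
    using q_gt_1 by (simp add: epow_mult[symmetric])
qed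

sublocale W: doubling_measure W "Aq_doubling DIM('a) q K"
  by standard (use w_ball_finite in \<open>auto simp: sets_W Dw_ge_1 W_ball_pos W_doubling W_def[symmetric]\<close>)

sublocale S: doubling_measure S "Aq_doubling DIM('a) q K powr (1 / (q - 1))"
  by standard (use \<sigma>_ball_finite Dw_ge_1 q_gt_1 in \<open>auto simp: sets_S S_ball_pos S_doubling S_def[symmetric] ge_one_powr_ge_zero\<close>)

text \<open>Lerner's pointwise bound, by which the boundedness of the maximal operator on \<open>L\<^sup>q(w)\<close>
  follows from that of the maximal operators of the doubling measures \<open>w\<close> and \<open>\<sigma>\<close>.\<close>

lemma hl_max_le_iterated:
  assumes [measurable]: "h \<in> borel_measurable lebesgue"
  shows "epow (hl_max lebesgue R h x) (q - 1) \<le>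
    ennreal K * hl_max W R (\<lambda>z. epow (hl_max S R (\<lambda>z. ennreal (1 / \<sigma> z) * h z) z) (q - 1) * ennreal (1 / w z)) x"
    (is "_ \<le> ennreal K * ?M")
proof -
  define G where "G = hl_max S R (\<lambda>z. ennreal (1 / \<sigma> z) * h z)"
  have [measurable]: "G \<in> borel_measurable lebesgue"
    unfolding G_def by (rule S.hl_max_measurable)
  have "hl_max lebesgue R h x \<le> epow (ennreal K * ?M) (1 / (q - 1))"
  proof (rule lebesgue.hl_max_leI)
    fix y s assume ys: "0 < s" "s < R" "x \<in> ball y s"
    define B where "B = ball y s"
    define I where "I = lint B h"
    define b where "b = vol B"
    have [measurable]: "B \<in> sets lebesgue" by (simp add: B_def)
    have b: "b \<noteq> 0" "b \<noteq> top"
      using emeasure_lebesgue_ball_pos[OF ys(1), of y] emeasure_lebesgue_ball_finite[of y s] by (auto simp: b_def B_def)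
    have G: "I \<le> G z * emeasure S B" if "z \<in> B" for z
    proof -
      have "I = (\<integral>\<^sup>+z. ennreal (\<sigma> z) * (ennreal (1 / \<sigma> z) * h z * indicator B z) \<partial>lebesgue)"
        unfolding I_def
      proof (intro nn_integral_cong)
        fix z
        have "ennreal (\<sigma> z) * ennreal (1 / \<sigma> z) = 1"
          using \<sigma>_pos[of z] by (simp add: ennreal_mult[symmetric])
        then show "h z * indicator B z = ennreal (\<sigma> z) * (ennreal (1 / \<sigma> z) * h z * indicator B z)"
          by (simp add: mult.assoc[symmetric])
      qed
      also have "\<dots> = (\<integral>\<^sup>+z\<in>B. ennreal (1 / \<sigma> z) * h z \<partial>S)"
        by (intro nn_integral_S[symmetric]) measurable
      also have "\<dots> \<le> G z * emeasure S B"
        unfolding B_def G_def using ys that by (intro S.integral_ball_le_hl_max) (auto simp: B_def)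
      finally show ?thesis .
    qed
    \<comment> \<open>At each point of \<open>B\<close>, the integral \<open>I\<close> is at most
      \<open>G\<close> times the \<open>\<sigma>\<close>-measure of \<open>B\<close>. Integrating
      this over \<open>B\<close> and passing from Lebesgue measure to \<open>W\<close> by the factor
      \<open>1 / w\<close> brings in the outer maximal function.\<close>
    have "epow I (q - 1) * b = (\<integral>\<^sup>+z\<in>B. epow I (q - 1) \<partial>lebesgue)"
      by (simp add: b_def nn_integral_cmult_indicator)
    also have "\<dots> \<le> (\<integral>\<^sup>+z. epow (emeasure S B) (q - 1) * (epow (G z) (q - 1) * indicator B z) \<partial>lebesgue)"
    proof (intro nn_integral_mono)
      fix z
      have "epow I (q - 1) \<le> epow (G z) (q - 1) * epow (emeasure S B) (q - 1)" if "z \<in> B"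
        using G[OF that] q_gt_1 by (simp add: epow_mult[symmetric])
      then show "epow I (q - 1) * indicator B z \<le> epow (emeasure S B) (q - 1) * (epow (G z) (q - 1) * indicator B z)"
        by (auto split: split_indicator simp: mult.commute)
    qed
    also have "\<dots> = epow (emeasure S B) (q - 1) * (\<integral>\<^sup>+z\<in>B. epow (G z) (q - 1) \<partial>lebesgue)"
      by (intro nn_integral_cmult) measurable
    also have "(\<integral>\<^sup>+z\<in>B. epow (G z) (q - 1) \<partial>lebesgue) = (\<integral>\<^sup>+z. ennreal (w z) * (epow (G z) (q - 1) * ennreal (1 / w z) * indicator B z) \<partial>lebesgue)"
    proof (intro nn_integral_cong)
      fix z
      have "ennreal (w z) * ennreal (1 / w z) = 1"
        using w_pos[of z] by (simp add: ennreal_mult[symmetric])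
      then have "ennreal (w z) * ennreal (1 / w z) * (epow (G z) (q - 1) * indicator B z) = epow (G z) (q - 1) * indicator B z"
        by simp
      then show "epow (G z) (q - 1) * indicator B z = ennreal (w z) * (epow (G z) (q - 1) * ennreal (1 / w z) * indicator B z)"
        by (simp only: mult_ac)
    qed
    also have "\<dots> = (\<integral>\<^sup>+z\<in>B. epow (G z) (q - 1) * ennreal (1 / w z) \<partial>W)"
      by (intro nn_integral_W[symmetric]) measurable
    also have "\<dots> \<le> ?M * emeasure W B"
      unfolding B_def G_def using ys by (intro W.integral_ball_le_hl_max) auto
    also have "epow (emeasure S B) (q - 1) * (?M * emeasure W B) = ?M * (emeasure W B * epow (emeasure S B) (q - 1))"
      by (simp only: mult_ac)
    also have "\<dots> \<le> ?M * (ennreal K * epow b q)"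
      using Aq[OF ys(1), of y] by (intro mult_left_mono) (auto simp: W_def S_def B_def b_def)
    also have "epow b q = b * epow b (q - 1)"
      using epow_add[of 1 "q - 1" b] q_gt_1 by simp
    finally have "b * epow I (q - 1) \<le> b * (ennreal K * ?M * epow b (q - 1))"
      by (simp add: mult_left_mono mult_right_mono mult_ac)
    then have "epow I (q - 1) \<le> ennreal K * ?M * epow b (q - 1)"
      using b by (simp add: ennreal_mult_le_mult_iff)
    also have "\<dots> = epow (epow (ennreal K * ?M) (1 / (q - 1)) * b) (q - 1)"
      using q_gt_1 by (simp add: epow_mult epow_epow)
    finally show "lint (ball y s) h \<le> epow (ennreal K * ?M) (1 / (q - 1)) * vol (ball y s)"
      using q_gt_1 by (simp add: I_def b_def B_def)
  qed
  then have "epow (hl_max lebesgue R h x) (q - 1) \<le> epow (epow (ennreal K * ?M) (1 / (q - 1))) (q - 1)"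
    using q_gt_1 by (intro epow_mono) auto
  then show ?thesis
    using q_gt_1 by (simp add: epow_epow)
qed

end

section \<open>Weighted bounds for the maximal operator of Lebesgue measure\<close>

context muckenhoupt
begin

text \<open>In the iterated bound the operator of \<open>W\<close> acts on \<open>L^q'(W)\<close>
  and that of \<open>S\<close> on \<open>L^q(S)\<close>, each on a space of its own doubling
  measure. In between, \<open>w * w^(-q') = \<sigma>\<close> and
  \<open>\<sigma> * \<sigma>^(-q) = w\<close> convert one measure into the other.\<close>

lemma hl_max_bounded_Lq:
  assumes [measurable]: "h \<in> borel_measurable lebesgue"
  shows "(\<integral>\<^sup>+x. epow (hl_max lebesgue R h x) q \<partial>W)
    \<le> ennreal (Aq_maximal_const DIM('a) q K) * (\<integral>\<^sup>+x. epow (h x) q \<partial>W)"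
proof -
  note [measurable_cong] = sets_W sets_S
  define q' where "q' = q / (q - 1)"
  have q': "1 < q'" "(q - 1) * q' = q" "0 < q'"
    using q_gt_1 by (auto simp: q'_def field_simps)
  define G where "G = hl_max S R (\<lambda>z. ennreal (1 / \<sigma> z) * h z)"
  define v where "v z = epow (G z) (q - 1) * ennreal (1 / w z)" for z
  have [measurable]: "G \<in> borel_measurable lebesgue" "hl_max W R v \<in> borel_measurable lebesgue"
    unfolding G_def by (rule S.hl_max_measurable W.hl_max_measurable)+
  have [measurable]: "v \<in> borel_measurable lebesgue"
    unfolding v_def by measurable
  have [measurable]: "hl_max W R v \<in> borel_measurable W" "v \<in> borel_measurable W" "G \<in> borel_measurable S"
    by (simp_all add: measurable_cong_sets[OF sets_W refl] measurable_cong_sets[OF sets_S refl])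
  define C1 C2 where "C1 = maximal_const (Aq_doubling DIM('a) q K) q'"
    and "C2 = maximal_const (Aq_doubling DIM('a) q K powr (1 / (q - 1))) q"
  have nn: "0 \<le> K powr q'" "0 \<le> C1" "0 \<le> C2"
    using q' W.D_ge_1 S.D_ge_1 q_gt_1 by (auto simp: C1_def C2_def maximal_const_def)
  have "(\<integral>\<^sup>+x. epow (hl_max lebesgue R h x) q \<partial>W) \<le> (\<integral>\<^sup>+x. ennreal (K powr q') * epow (hl_max W R v x) q' \<partial>W)"
  proof (intro nn_integral_mono)
    fix x
    have "epow (hl_max lebesgue R h x) q = epow (epow (hl_max lebesgue R h x) (q - 1)) q'"
      using q' by (simp add: epow_epow)
    also have "\<dots> \<le> epow (ennreal K * hl_max W R v x) q'"
      using hl_max_le_iterated[of h R x] q' by (simp add: v_def[abs_def] G_def)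
    also have "\<dots> = ennreal (K powr q') * epow (hl_max W R v x) q'"
      using q' K_ge_1 by (simp add: epow_mult epow_ennreal)
    finally show "epow (hl_max lebesgue R h x) q \<le> ennreal (K powr q') * epow (hl_max W R v x) q'" .
  qed
  also have "\<dots> = ennreal (K powr q') * (\<integral>\<^sup>+x. epow (hl_max W R v x) q' \<partial>W)"
    by (intro nn_integral_cmult) measurable
  also have "\<dots> \<le> ennreal (K powr q') * (ennreal C1 * (\<integral>\<^sup>+x. epow (v x) q' \<partial>W))"
    unfolding C1_def maximal_const_def using q' by (intro mult_left_mono W.strong_type) auto
  also have "(\<integral>\<^sup>+x. epow (v x) q' \<partial>W) = (\<integral>\<^sup>+x. epow (G x) q \<partial>S)"
  proof -
    have "(\<integral>\<^sup>+x. epow (v x) q' \<partial>W) = (\<integral>\<^sup>+x. ennreal (w x) * epow (v x) q' \<partial>lebesgue)"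
      by (intro nn_integral_W) measurable
    also have "\<dots> = (\<integral>\<^sup>+x. ennreal (\<sigma> x) * epow (G x) q \<partial>lebesgue)"
    proof (intro nn_integral_cong)
      fix x
      have "w x * (1 / w x) powr q' = w x powr (1 - q')"
        using w_pos[of x] by (simp add: powr_diff powr_divide)
      also have "1 - q' = - 1 / (q - 1)"
        using q_gt_1 by (simp add: q'_def field_simps)
      finally have "ennreal (w x) * epow (ennreal (1 / w x)) q' = ennreal (\<sigma> x)"
        using w_pos[of x] by (simp add: epow_ennreal \<sigma>_eq ennreal_mult[symmetric])
      moreover have "epow (v x) q' = epow (G x) q * epow (ennreal (1 / w x)) q'"
        using q' by (simp add: v_def epow_mult epow_epow)
      ultimately show "ennreal (w x) * epow (v x) q' = ennreal (\<sigma> x) * epow (G x) q"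
        by (metis mult.assoc mult.commute)
    qed
    also have "\<dots> = (\<integral>\<^sup>+x. epow (G x) q \<partial>S)"
      by (intro nn_integral_S[symmetric]) measurable
    finally show ?thesis .
  qed
  also have "(\<integral>\<^sup>+x. epow (G x) q \<partial>S) \<le> ennreal C2 * (\<integral>\<^sup>+x. epow (ennreal (1 / \<sigma> x) * h x) q \<partial>S)"
    unfolding C2_def maximal_const_def G_def using q_gt_1 by (intro S.strong_type) auto
  also have "(\<integral>\<^sup>+x. epow (ennreal (1 / \<sigma> x) * h x) q \<partial>S) = (\<integral>\<^sup>+x. epow (h x) q \<partial>W)"
  proof -
    have "(\<integral>\<^sup>+x. epow (ennreal (1 / \<sigma> x) * h x) q \<partial>S) = (\<integral>\<^sup>+x. ennreal (\<sigma> x) * epow (ennreal (1 / \<sigma> x) * h x) q \<partial>lebesgue)"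
      by (intro nn_integral_S) measurable
    also have "\<dots> = (\<integral>\<^sup>+x. ennreal (w x) * epow (h x) q \<partial>lebesgue)"
    proof (intro nn_integral_cong)
      fix x
      have "\<sigma> x * (1 / \<sigma> x) powr q = \<sigma> x powr (1 - q)"
        using \<sigma>_pos[of x] by (simp add: powr_diff powr_divide)
      also have "\<dots> = w x powr (- 1 / (q - 1) * (1 - q))"
        by (simp only: \<sigma>_eq powr_powr)
      also have "- 1 / (q - 1) * (1 - q) = 1"
        using q_gt_1 by (simp add: field_simps)
      also have "w x powr 1 = w x"
        using w_pos[of x] by simp
      finally have "ennreal (\<sigma> x) * epow (ennreal (1 / \<sigma> x)) q = ennreal (w x)"
        using \<sigma>_pos[of x] by (simp add: epow_ennreal ennreal_mult[symmetric])
      then show "ennreal (\<sigma> x) * epow (ennreal (1 / \<sigma> x) * h x) q = ennreal (w x) * epow (h x) q"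
        using q_gt_1 by (simp add: epow_mult mult.assoc[symmetric])
    qed
    also have "\<dots> = (\<integral>\<^sup>+x. epow (h x) q \<partial>W)"
      by (intro nn_integral_W[symmetric]) measurable
    finally show ?thesis .
  qed
  finally show ?thesis
    using nn by (simp add: Aq_maximal_const_def C1_def[symmetric] C2_def[symmetric] q'_def[symmetric]
        ennreal_mult mult.assoc mult_left_mono)
qed

text \<open>\<open>integral_powr_le\<close> applied to each ball through \<open>x\<close>. For
  exponents \<open>q1\<close> above \<open>q\<close> this bound replaces the iterated one, as the
  operator of \<open>W\<close> is then used at the exponent \<open>q1 / q > 1\<close>.\<close>

lemma hl_max_powr_le:
  assumes [measurable]: "u \<in> borel_measurable lebesgue"
  shows "epow (hl_max lebesgue R u x) q \<le> ennreal K * hl_max W R (\<lambda>z. epow (u z) q) x"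
    (is "_ \<le> ennreal K * ?M")
proof -
  have "hl_max lebesgue R u x \<le> epow (ennreal K * ?M) (1 / q)"
  proof (rule lebesgue.hl_max_leI)
    fix y s assume ys: "0 < s" "s < R" "x \<in> ball y s"
    define I where "I = lint (ball y s) u"
    define b where "b = vol (ball y s)"
    define a where "a = emeasure W (ball y s)"
    have a: "a \<noteq> 0" "a \<noteq> top"
      using W.ball_pos[OF ys(1), of y] W.ball_finite[of y s] by (auto simp: a_def)
    have "a * epow I q = epow I q * a" by (rule mult.commute)
    also have "\<dots> \<le> ennreal K * epow b q * (\<integral>\<^sup>+z\<in>ball y s. epow (u z) q \<partial>W)"
      unfolding I_def a_def b_def by (intro integral_powr_le ys) measurable
    also have "\<dots> \<le> ennreal K * epow b q * (?M * a)"
      unfolding a_def using ys by (intro mult_left_mono W.integral_ball_le_hl_max) auto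
    also have "\<dots> = a * (ennreal K * ?M * epow b q)"
      by (simp only: mult_ac)
    finally have "epow I q \<le> ennreal K * ?M * epow b q"
      using a by (simp add: ennreal_mult_le_mult_iff)
    also have "\<dots> = epow (epow (ennreal K * ?M) (1 / q) * b) q"
      using q_gt_1 by (simp add: epow_mult epow_epow)
    finally show "lint (ball y s) u \<le> epow (ennreal K * ?M) (1 / q) * vol (ball y s)"
      using q_gt_1 by (simp add: I_def b_def)
  qed
  then have "epow (hl_max lebesgue R u x) q \<le> epow (epow (ennreal K * ?M) (1 / q)) q"
    using q_gt_1 by (intro epow_mono) auto
  then show ?thesis
    using q_gt_1 by (simp add: epow_epow)
qed

lemma hl_max_bounded_higher:
  assumes [measurable]: "u \<in> borel_measurable lebesgue" and "q < q1"
  shows "(\<integral>\<^sup>+x. epow (hl_max lebesgue R u x) q1 \<partial>W)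
    \<le> ennreal (K powr (q1 / q) * maximal_const (Aq_doubling DIM('a) q K) (q1 / q)) * (\<integral>\<^sup>+x. epow (u x) q1 \<partial>W)"
proof -
  note [measurable_cong] = sets_W
  define r where "r = q1 / q"
  have r: "1 < r" "q * r = q1"
    using q_gt_1 assms(2) by (auto simp: r_def)
  define v where "v z = epow (u z) q" for z
  have [measurable]: "v \<in> borel_measurable lebesgue"
    unfolding v_def by measurable
  have [measurable]: "v \<in> borel_measurable W"
    by (simp add: measurable_cong_sets[OF sets_W refl])
  have [measurable]: "hl_max W R v \<in> borel_measurable W"
    by (rule W.hl_max_measurable')
  have C: "0 \<le> maximal_const (Aq_doubling DIM('a) q K) r"
    using r W.D_ge_1 by (auto simp: maximal_const_def)
  have "(\<integral>\<^sup>+x. epow (hl_max lebesgue R u x) q1 \<partial>W) \<le> (\<integral>\<^sup>+x. ennreal (K powr r) * epow (hl_max W R v x) r \<partial>W)"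
  proof (intro nn_integral_mono)
    fix x
    have "epow (hl_max lebesgue R u x) q1 = epow (epow (hl_max lebesgue R u x) q) r"
      using r by (simp add: epow_epow)
    also have "\<dots> \<le> epow (ennreal K * hl_max W R v x) r"
      using hl_max_powr_le[of u R x] r by (simp add: v_def[abs_def])
    also have "\<dots> = ennreal (K powr r) * epow (hl_max W R v x) r"
      using r K_ge_1 by (simp add: epow_mult epow_ennreal)
    finally show "epow (hl_max lebesgue R u x) q1 \<le> ennreal (K powr r) * epow (hl_max W R v x) r" .
  qed
  also have "\<dots> = ennreal (K powr r) * (\<integral>\<^sup>+x. epow (hl_max W R v x) r \<partial>W)"
    by (intro nn_integral_cmult) measurable
  also have "\<dots> \<le> ennreal (K powr r) * (ennreal (maximal_const (Aq_doubling DIM('a) q K) r) * (\<integral>\<^sup>+x. epow (v x) r \<partial>W))"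
    unfolding maximal_const_def using r by (intro mult_left_mono W.strong_type) auto
  also have "(\<integral>\<^sup>+x. epow (v x) r \<partial>W) = (\<integral>\<^sup>+x. epow (u x) q1 \<partial>W)"
    using r by (simp add: v_def epow_epow)
  finally show ?thesis
    using C by (simp add: r_def[symmetric] ennreal_mult mult.assoc)
qed

text \<open>\<open>integral_powr_le\<close> for the indicator of \<open>G\<close>: a volume ratio of
  at least one half costs \<open>2 powr q\<close>.\<close>

lemma W_le_W_large_subset:
  assumes [measurable]: "G \<in> sets lebesgue" and "0 < r"
    and "vol (ball x r) \<le> 2 * vol (ball x r \<inter> G)"
  shows "emeasure W (ball x r) \<le> ennreal (K * 2 powr q) * emeasure W (ball x r \<inter> G)"
proof -
  define e where "e = vol (ball x r \<inter> G)"
  define b where "b = vol (ball x r)"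
  have [simp]: "(\<integral>\<^sup>+z\<in>ball x r. indicator G z \<partial>lebesgue) = e"
    unfolding e_def by (rule nn_integral_indicator_Int) auto
  have "epow (indicator G z) q = indicator G z" for z
    by (simp split: split_indicator)
  then have [simp]: "(\<integral>\<^sup>+z\<in>ball x r. epow (indicator G z) q \<partial>W) = emeasure W (ball x r \<inter> G)"
    by (simp add: nn_integral_indicator_Int sets_W)
  have b: "b \<le> 2 * e" "b \<noteq> 0" "b \<noteq> top"
    using assms(3) emeasure_lebesgue_ball_pos[OF assms(2), of x] emeasure_lebesgue_ball_finite[of x r]
    by (auto simp: e_def b_def)
  have "e \<le> b"
    unfolding e_def b_def by (intro emeasure_mono) auto
  then have e: "e \<noteq> 0" "e \<noteq> top"
    using b by (auto simp: top_unique)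
  have "epow e q * emeasure W (ball x r) \<le> ennreal K * epow b q * emeasure W (ball x r \<inter> G)"
    using integral_powr_le[of "indicator G" r x] assms(2) by (simp add: b_def)
  also have "\<dots> \<le> ennreal K * epow (2 * e) q * emeasure W (ball x r \<inter> G)"
    using b(1) q_gt_1 by (intro mult_right_mono mult_left_mono) auto
  also have "epow (2 * e) q = ennreal (2 powr q) * epow e q"
    using q_gt_1 epow_ennreal[of 2 q] by (simp add: epow_mult)
  also have "ennreal K * (ennreal (2 powr q) * epow e q) * emeasure W (ball x r \<inter> G)
      = epow e q * (ennreal (K * 2 powr q) * emeasure W (ball x r \<inter> G))"
    using K_ge_1 by (simp add: ennreal_mult mult_ac)
  finally show ?thesis
    using e by (simp add: ennreal_mult_le_mult_iff)
qed

end

section \<open>The \<open>A\<^sub>\<infinity>\<close> property\<close>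

context muckenhoupt
begin

text \<open>One step of the iteration for the \<open>A\<^sub>\<infinity>\<close> property: covering \<open>G\<close> by balls that are about half filled
  by \<open>G\<close>, and whose doubles still meet \<open>G\<close> in a fixed proportion, enlarges \<open>G\<close> to a set of
  comparable Lebesgue measure but of definitely larger \<open>w\<close>-measure.\<close>

lemma A_infinity_step:
  assumes G [measurable]: "G \<in> sets lebesgue" and GB: "G \<subseteq> ball x r" and "0 < R"
    and small: "2 * vol G \<le> vol (ball (0::'a) R)"
    and M: "M = Aq_doubling DIM('a) q K * (K * 2 powr q)"
  obtains G' where "G' \<in> sets lebesgue" "G' \<subseteq> ball x (r + 4 * R)"
    "vol G' \<le> ennreal (1 + 5 ^ DIM('a) * 2 ^ (DIM('a) + 1)) * vol G"
    "ennreal (1 + 1 / M) * emeasure W G \<le> emeasure W G'"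
proof -
  \<comment> \<open>A ball more than half filled by \<open>G\<close> makes \<open>G\<close> fill
    more than the fraction \<open>c\<close> of its double, so such doubles lie in
    \<open>H\<close>.\<close>
  define c :: real where "c = 1 / 2 ^ (DIM('a) + 1)"
  have c: "0 < c" "ennreal c * ennreal (2 ^ DIM('a)) = ennreal (1 / 2)"
    by (auto simp: c_def ennreal_mult[symmetric])
  define H where "H = {y. ennreal c < hl_max lebesgue (2 * R) (indicator G) y}"
  have H[measurable]: "H \<in> sets lebesgue"
    unfolding H_def by (intro lebesgue.open_in_sets lebesgue.open_hl_max)
  note int_ind = nn_integral_indicator_Int[OF _ G]
  define G0 where "G0 = {z\<in>G. ennreal (1 / 2) < hl_max lebesgue R (indicator G) z}"
  define P where "P z s \<longleftrightarrow> (\<exists>y. 0 < s \<and> z \<in> ball y s \<and> vol (ball y s) < 2 * vol (ball y s \<inter> G))" for z s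
  have half: "ennreal (1 / 2) * a < b \<longleftrightarrow> a < 2 * b" for a b :: ennreal
  proof -
    have "2 * (ennreal (1 / 2) * a) = a"
      using ennreal_mult[of 2 "1/2"] by (simp add: mult.assoc[symmetric])
    moreover have "2 * (ennreal (1 / 2) * a) < 2 * b \<longleftrightarrow> ennreal (1 / 2) * a < b"
      using ennreal_mult_le_mult_iff[of 2 b "ennreal (1 / 2) * a"] by (simp add: not_le[symmetric])
    ultimately show ?thesis by simp
  qed
  have P_less: "s < R" if Ps: "P z s" for z s
  proof (rule ccontr)
    assume "\<not> s < R"
    obtain y where y: "0 < s" "vol (ball y s) < 2 * vol (ball y s \<inter> G)"
      using Ps by (auto simp: P_def)
    note y(2)
    also have "2 * vol (ball y s \<inter> G) \<le> 2 * vol G"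
      by (intro mult_left_mono emeasure_mono) auto
    also have "\<dots> \<le> vol (ball (0::'a) R)" by (rule small)
    also have "\<dots> = vol (ball y R)"
      using \<open>0 < R\<close> by (simp add: emeasure_lebesgue_ball)
    also have "\<dots> \<le> vol (ball y s)"
      using \<open>\<not> s < R\<close> by (intro emeasure_mono subset_ball) auto
    finally show False by simp
  qed
  have "\<exists>y s. 0 < s \<and> s < 2 * R \<and> z \<in> ball y s \<and> vol (ball y s) \<le> 2 * vol (ball y s - G)
      \<and> ball y s \<subseteq> H" if z: "z \<in> G0" for z
  proof -
    have "ennreal (1 / 2) < hl_max lebesgue R (indicator G) z"
      using z by (simp add: G0_def)
    then obtain y0 s0 where y0: "0 < s0" "z \<in> ball y0 s0" "ennreal (1 / 2) * vol (ball y0 s0) < (\<integral>\<^sup>+z\<in>ball y0 s0. indicator G z \<partial>lebesgue)"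
      unfolding lebesgue.less_hl_max_iff by blast
    have "ennreal (1 / 2) * vol (ball y0 s0) < vol (ball y0 s0 \<inter> G)"
      using y0(3) int_ind[of "ball y0 s0"] by auto
    then have "P z s0"
      unfolding P_def half using y0 by blast
    have "0 < s \<and> s \<le> R" if "P z s" for s
      using P_less[OF that] that by (auto simp: P_def)
    \<comment> \<open>No ball through \<open>z\<close> of twice a nearly maximal radius is more than
      half filled. Hence the double \<open>B\<close> has at least half of its volume outside
      \<open>G\<close>, although it lies in \<open>H\<close>.\<close>
    from nearly_maximal_radius[of "P z", OF \<open>P z s0\<close> this]
    obtain s where s: "P z s" "\<forall>s'. P z s' \<longrightarrow> s' < 2 * s" .
    have "0 < s" using s(1) by (auto simp: P_def)
    then have "\<not> P z (2 * s)" using s(2) by auto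
    obtain y where y: "0 < s" "z \<in> ball y s" "vol (ball y s) < 2 * vol (ball y s \<inter> G)"
      using s(1) by (auto simp: P_def)
    define B where "B = ball y (2 * s)"
    have [measurable]: "B \<in> sets lebesgue" by (simp add: B_def)
    have sub: "ball y s \<subseteq> B"
      unfolding B_def using y by (intro subset_ball) auto
    have fin: "vol B < top" unfolding B_def by (rule emeasure_lebesgue_ball_finite)
    have 1: "vol B \<le> 2 * vol (B - G)"
    proof -
      have le: "2 * vol (B \<inter> G) \<le> vol B"
      proof -
        have "0 < 2 * s" "z \<in> B" using y sub by auto
        then show ?thesis
          using \<open>\<not> P z (2 * s)\<close> unfolding P_def B_def by (meson linorder_not_less)
      qed
      have "vol B = vol (B \<inter> G) + vol (B - G)"
        by (subst plus_emeasure) (auto intro!: arg_cong[where f = "vol"])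
      note eq = this
      have "vol (B \<inter> G) \<noteq> top"
        using fin eq by auto
      moreover have "vol (B \<inter> G) + vol (B \<inter> G) \<le> vol (B \<inter> G) + vol (B - G)"
        using le eq by (simp add: mult_2)
      ultimately have "vol (B \<inter> G) \<le> vol (B - G)"
        by (simp add: ennreal_add_left_cancel_le)
      then show ?thesis
        unfolding eq mult_2 by (intro add_right_mono)
    qed
    have "vol B = ennreal (2 ^ DIM('a)) * vol (ball y s)"
      unfolding B_def using y by (intro emeasure_lebesgue_ball_scale) auto
    then have "ennreal c * vol B = ennreal (1 / 2) * vol (ball y s)"
      by (simp add: c(2) mult.assoc[symmetric])
    also have "\<dots> < vol (ball y s \<inter> G)"
      using y(3) half by blast
    also have "\<dots> \<le> vol (B \<inter> G)"
      using sub by (intro emeasure_mono) auto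
    finally have "ennreal c * vol B < (\<integral>\<^sup>+z\<in>B. indicator G z \<partial>lebesgue)"
      by (subst int_ind) auto
    then have 2: "B \<subseteq> H"
      unfolding H_def lebesgue.less_hl_max_iff using y P_less[OF s(1)]
      by (auto simp: B_def intro!: exI[of _ y] exI[of _ "2 * s"])
    show ?thesis
      using 1 2 y P_less[OF s(1)] sub unfolding B_def by (intro exI[of _ y] exI[of _ "2 * s"]) auto
  qed
  then obtain yy ss where ys: "\<And>z. z \<in> G0 \<Longrightarrow> 0 < ss z" "\<And>z. z \<in> G0 \<Longrightarrow> ss z < 2 * R" "\<And>z. z \<in> G0 \<Longrightarrow> z \<in> ball (yy z) (ss z)"
      "\<And>z. z \<in> G0 \<Longrightarrow> vol (ball (yy z) (ss z)) \<le> 2 * vol (ball (yy z) (ss z) - G)"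
      "\<And>z. z \<in> G0 \<Longrightarrow> ball (yy z) (ss z) \<subseteq> H"
    by metis
  have cov: "G0 \<subseteq> (\<Union>z\<in>G0. ball (yy z) (ss z))" using ys(3) by blast
  have bd: "0 < ss z \<and> ss z \<le> 2 * R" if "z \<in> G0" for z using ys(1,2)[OF that] by auto
  obtain C where C: "countable C" "C \<subseteq> G0" "disjoint_family_on (\<lambda>i. ball (yy i) (ss i)) C"
     "G0 \<subseteq> (\<Union>i\<in>C. ball (yy i) (5 * ss i))"
    by (rule Vitali_disjoint_balls[OF cov bd])
  have compl: "- G \<in> sets lebesgue"
    using sets.compl_sets[OF G] by (simp add: Compl_eq_Diff_UNIV)
  have M0: "0 < M" using W.D_ge_1 K_ge_1 by (auto simp: M intro!: mult_pos_pos)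
  have AE_G0: "AE z in lebesgue. z \<in> G \<longrightarrow> z \<in> G0"
  proof -
    have "AE z in lebesgue. indicator G z \<le> hl_max lebesgue R (indicator G) z"
      using \<open>0 < R\<close> by (intro AE_le_hl_max) auto
    then show ?thesis
    proof eventually_elim
      case (elim z)
      have "ennreal (1 / 2) < 1"
        using ennreal_less_iff[of "1 / 2" 1] by simp
      then show ?case using elim by (auto simp: G0_def intro: less_le_trans)
    qed
  qed
  \<comment> \<open>The dilated balls cover almost all of \<open>G\<close>. Each has
    \<open>w\<close>-measure at most \<open>M\<close> times that of the part of the undilated ball
    outside \<open>G\<close>, and these disjoint parts lie in \<open>H - G\<close>.\<close>
  have "emeasure W G \<le> emeasure W (\<Union>i\<in>C. ball (yy i) (5 * ss i))"
  proof (rule emeasure_mono_AE)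
    show "AE z in W. z \<in> G \<longrightarrow> z \<in> (\<Union>i\<in>C. ball (yy i) (5 * ss i))"
      unfolding W_def using AE_G0
      by (subst AE_density, simp, eventually_elim) (use C(4) in blast)
  qed (auto simp: sets_W C intro!: lebesgue.open_in_sets)
  also have "\<dots> \<le> ennreal M * emeasure W (\<Union>i\<in>C. ball (yy i) (ss i) - G)"
  proof (rule emeasure_UN_le_disjoint)
    show "disjoint_family_on (\<lambda>i. ball (yy i) (ss i) - G) C"
      using C(3) unfolding disjoint_family_on_def by blast
    fix i assume i: "i \<in> C"
    then have i0: "i \<in> G0" using C by auto
    have "emeasure W (ball (yy i) (5 * ss i)) \<le> ennreal (Aq_doubling DIM('a) q K) * emeasure W (ball (yy i) (ss i))"
      by (intro W_doubling ys i0)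
    also have "\<dots> \<le> ennreal (Aq_doubling DIM('a) q K) * (ennreal (K * 2 powr q) * emeasure W (ball (yy i) (ss i) \<inter> - G))"
      using ys[OF i0] compl by (intro mult_left_mono W_le_W_large_subset) (auto simp: Diff_eq[symmetric])
    also have "\<dots> = ennreal M * emeasure W (ball (yy i) (ss i) - G)"
      using W.D_ge_1 K_ge_1 by (simp add: M ennreal_mult Diff_eq[symmetric] mult.assoc)
    finally show "emeasure W (ball (yy i) (5 * ss i)) \<le> ennreal M * emeasure W (ball (yy i) (ss i) - G)" .
  qed (auto simp: sets_W C)
  also have "\<dots> \<le> ennreal M * emeasure W (H - G)"
  proof (intro mult_left_mono emeasure_mono)
    show "(\<Union>i\<in>C. ball (yy i) (ss i) - G) \<subseteq> H - G"
      using C(2) ys(5) by blast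
  qed (auto simp: sets_W)
  finally have WG: "emeasure W G \<le> ennreal M * emeasure W (H - G)" .
  show thesis
  proof (rule that[of "G \<union> H"])
    \<comment> \<open>A point of \<open>H\<close> shares a ball of radius below \<open>2 * R\<close>
      with a point of \<open>G\<close>, hence is within \<open>4 * R\<close> of it.\<close>
    have "H \<subseteq> ball x (r + 4 * R)"
    proof
      fix z assume "z \<in> H"
      then obtain y s where y: "0 < s" "s < 2 * R" "z \<in> ball y s" "ennreal c * vol (ball y s) < (\<integral>\<^sup>+z\<in>ball y s. indicator G z \<partial>lebesgue)"
        unfolding H_def lebesgue.less_hl_max_iff by auto
      then have "vol (ball y s \<inter> G) \<noteq> 0"
        by (subst (asm) int_ind) auto
      then obtain g where "g \<in> ball y s" "g \<in> G" by (metis disjoint_iff emeasure_empty)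
      then have "dist x g < r" "dist y g < s" using GB by auto
      then show "z \<in> ball x (r + 4 * R)"
        using y(2,3) dist_triangle[of x z g] dist_triangle[of g z y] by (auto simp: dist_commute)
    qed
    then show "G \<union> H \<subseteq> ball x (r + 4 * R)"
      using GB \<open>0 < R\<close> by auto
    have "vol H \<le> ennreal (5 ^ DIM('a) / c) * (\<integral>\<^sup>+x. indicator G x \<partial>lebesgue)"
      unfolding H_def using c by (intro lebesgue.weak_type) auto
    then have "vol H \<le> ennreal (5 ^ DIM('a) * 2 ^ (DIM('a) + 1)) * vol G"
      by (simp add: c_def)
    then have "vol G + vol H \<le> 1 * vol G + ennreal (5 ^ DIM('a) * 2 ^ (DIM('a) + 1)) * vol G"
      by (intro add_mono) auto
    also have "\<dots> = ennreal (1 + 5 ^ DIM('a) * 2 ^ (DIM('a) + 1)) * vol G"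
      by (subst ennreal_plus) (auto simp: distrib_right)
    finally show "vol (G \<union> H) \<le> ennreal (1 + 5 ^ DIM('a) * 2 ^ (DIM('a) + 1)) * vol G"
      using emeasure_subadditive[OF G H] by (rule order_trans[rotated])
    have "ennreal (1 / M) * emeasure W G \<le> ennreal (1 / M) * (ennreal M * emeasure W (H - G))"
      by (intro mult_left_mono WG) auto
    also have "\<dots> = emeasure W (H - G)"
      using M0 by (simp add: mult.assoc[symmetric] ennreal_mult[symmetric])
    finally have "emeasure W G + ennreal (1 / M) * emeasure W G \<le> emeasure W G + emeasure W (H - G)"
      by (intro add_left_mono)
    also have "\<dots> = emeasure W (G \<union> H)"
      by (subst plus_emeasure) (auto simp: sets_W)
    finally show "ennreal (1 + 1 / M) * emeasure W G \<le> emeasure W (G \<union> H)"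
      using M0 by (subst ennreal_plus) (auto simp: distrib_right)
  qed auto
qed

end

text \<open>Each step multiplies the \<open>w\<close>-measure by \<open>1 + 1 / M\<close> at the
  cost of a constant factor in volume and a slight enlargement of the ball; a small enough volume
  fraction pays for \<open>n\<close> steps. The enlargement \<open>\<delta>\<close> varies in the
  induction because it is shared among the steps.\<close>

lemma A_infinity_iterate:
  fixes q K M :: real
  assumes M: "M = Aq_doubling DIM('a) q K * (K * 2 powr q)" and "0 < \<delta>"
  shows "\<exists>\<alpha>>0. \<forall>(w::'a::euclidean_space \<Rightarrow> real) \<sigma> x r E. muckenhoupt w \<sigma> q K \<and> 0 < r \<and> E \<in> sets lebesgue \<and>
     E \<subseteq> ball x r \<and> vol E \<le> ennreal \<alpha> * vol (ball x r) \<longrightarrow>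
     ennreal ((1 + 1 / M) ^ n) * emeasure (muckenhoupt.W w) E \<le> emeasure (muckenhoupt.W w) (ball x ((1 + \<delta>) * r))"
  using \<open>0 < \<delta>\<close>
proof (induction n arbitrary: \<delta>)
  case 0
  show ?case
  proof (intro exI[of _ 1] conjI allI impI)
    fix w :: "'a \<Rightarrow> real" and \<sigma> x r and E :: "'a set"
    assume *: "muckenhoupt w \<sigma> q K \<and> 0 < r \<and> E \<in> sets lebesgue \<and>
      E \<subseteq> ball x r \<and> vol E \<le> ennreal 1 * vol (ball x r)"
    then have "r \<le> (1 + \<delta>) * r" using 0 by (simp add: algebra_simps)
    then have "E \<subseteq> ball x ((1 + \<delta>) * r)" using * subset_ball[of r "(1 + \<delta>) * r" x] by blast
    then show "ennreal ((1 + 1 / M) ^ 0) * emeasure (muckenhoupt.W w) E \<le> emeasure (muckenhoupt.W w) (ball x ((1 + \<delta>) * r))"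
      using * by (auto intro!: emeasure_mono simp: muckenhoupt.sets_W)
  qed simp
next
  case (Suc n)
  \<comment> \<open>Two enlargements by \<open>1 + d\<close>, one for the step and one for the
    induction hypothesis, fit into one by \<open>1 + \<delta>\<close>; the cap at 1 gives
    \<open>d * d \<le> d\<close>.\<close>
  define d where "d = min 1 \<delta> / 3"
  have d: "0 < d" "d \<le> 1" "(1 + d) * (1 + d) \<le> 1 + \<delta>"
  proof -
    show "0 < d" "d \<le> 1" using Suc.prems by (auto simp: d_def)
    then have "(1 + d) * (1 + d) \<le> 1 + 3 * d" by (simp add: algebra_simps mult_left_le)
    also have "\<dots> \<le> 1 + \<delta>" by (simp add: d_def)
    finally show "(1 + d) * (1 + d) \<le> 1 + \<delta>" .
  qed
  obtain \<beta> where \<beta>: "0 < \<beta>" "\<And>(w::'a \<Rightarrow> real) \<sigma> x r E. muckenhoupt w \<sigma> q K \<Longrightarrow> 0 < r \<Longrightarrow> E \<in> sets lebesgue \<Longrightarrow>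
     E \<subseteq> ball x r \<Longrightarrow> vol E \<le> ennreal \<beta> * vol (ball x r) \<Longrightarrow>
     ennreal ((1 + 1 / M) ^ n) * emeasure (muckenhoupt.W w) E \<le> emeasure (muckenhoupt.W w) (ball x ((1 + d) * r))"
    using Suc.IH[OF d(1)] by metis
  define L :: real where "L = 1 + 5 ^ DIM('a) * 2 ^ (DIM('a) + 1)"
  have "0 < L" by (simp add: L_def add_pos_pos)
  \<comment> \<open>The first bound makes \<open>E\<close> small compared with a ball of radius
    \<open>d / 4 * r\<close>, so that the step enlarges \<open>ball x r\<close> by no more than the
    factor \<open>1 + d\<close>. The second leaves room for the volume growth \<open>L\<close>
    before the induction hypothesis applies.\<close>
  define \<alpha> where "\<alpha> = min ((d / 4) ^ DIM('a) / 2) (\<beta> / L)"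
  have \<alpha>: "0 < \<alpha>" "2 * \<alpha> \<le> (d / 4) ^ DIM('a)" "L * \<alpha> \<le> \<beta>"
  proof -
    show "0 < \<alpha>" using d \<beta> \<open>0 < L\<close> by (simp add: \<alpha>_def)
    have "\<alpha> \<le> (d / 4) ^ DIM('a) / 2" unfolding \<alpha>_def by (rule min.cobounded1)
    then show "2 * \<alpha> \<le> (d / 4) ^ DIM('a)" by linarith
    have "\<alpha> \<le> \<beta> / L" by (simp add: \<alpha>_def)
    then show "L * \<alpha> \<le> \<beta>" using \<open>0 < L\<close> by (simp add: field_simps)
  qed
  show ?case
  proof (intro exI[of _ \<alpha>] conjI allI impI)
    fix w :: "'a \<Rightarrow> real" and \<sigma> x r and E :: "'a set"
    assume *: "muckenhoupt w \<sigma> q K \<and> 0 < r \<and> E \<in> sets lebesgue \<and>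
      E \<subseteq> ball x r \<and> vol E \<le> ennreal \<alpha> * vol (ball x r)"
    then interpret muckenhoupt w \<sigma> q K by simp
    have r: "0 < r" and E: "E \<in> sets lebesgue" "E \<subseteq> ball x r" "vol E \<le> ennreal \<alpha> * vol (ball x r)"
      using * by auto
    define R where "R = d / 4 * r"
    have "0 < R" using d r by (simp add: R_def)
    have "2 * vol E \<le> 2 * (ennreal \<alpha> * vol (ball x r))"
      by (intro mult_left_mono E) simp
    also have "\<dots> = ennreal (2 * \<alpha>) * vol (ball x r)"
      using \<alpha> by (simp add: ennreal_mult mult.assoc)
    also have "\<dots> \<le> ennreal ((d / 4) ^ DIM('a)) * vol (ball x r)"
      using \<alpha> by (intro mult_right_mono ennreal_leI) auto
    also have "\<dots> = vol (ball (0::'a) R)"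
      unfolding R_def using d r by (intro emeasure_lebesgue_ball_scale[symmetric]) auto
    finally have small: "2 * vol E \<le> vol (ball (0::'a) R)" .
    obtain G' where G': "G' \<in> sets lebesgue" "G' \<subseteq> ball x (r + 4 * R)"
        "vol G' \<le> ennreal L * vol E"
        "ennreal (1 + 1 / M) * emeasure W E \<le> emeasure W G'"
      using A_infinity_step[OF E(1,2) \<open>0 < R\<close> small M] unfolding L_def by blast
    have R4: "r + 4 * R = (1 + d) * r"
      by (simp add: R_def algebra_simps)
    have "vol G' \<le> ennreal L * (ennreal \<alpha> * vol (ball x r))"
      using G'(3) E(3) by (meson mult_left_mono order_trans zero_le)
    also have "\<dots> = ennreal (L * \<alpha>) * vol (ball x r)"
      using \<alpha> \<open>0 < L\<close> by (simp add: ennreal_mult mult.assoc)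
    also have "\<dots> \<le> ennreal \<beta> * vol (ball x ((1 + d) * r))"
      using \<alpha> d r by (intro mult_mono emeasure_mono subset_ball ennreal_leI) (auto simp: algebra_simps)
    finally have "ennreal ((1 + 1 / M) ^ n) * emeasure W G' \<le> emeasure W (ball x ((1 + d) * ((1 + d) * r)))"
      using G' r d R4 by (intro \<beta>(2)[OF muckenhoupt_axioms]) auto
    also have "\<dots> \<le> emeasure W (ball x ((1 + \<delta>) * r))"
      using d(3) r by (intro emeasure_mono subset_ball) (auto simp: sets_W mult.assoc[symmetric])
    finally have le: "ennreal ((1 + 1 / M) ^ n) * emeasure W G' \<le> emeasure W (ball x ((1 + \<delta>) * r))" .
    have "0 < M" using W.D_ge_1 K_ge_1 by (auto simp: M intro!: mult_pos_pos)
    then have "ennreal ((1 + 1 / M) ^ Suc n) * emeasure W E = ennreal ((1 + 1 / M) ^ n) * (ennreal (1 + 1 / M) * emeasure W E)"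
      by (subst mult.assoc[symmetric], subst ennreal_mult[symmetric]) (auto simp: mult.commute)
    also have "\<dots> \<le> ennreal ((1 + 1 / M) ^ n) * emeasure W G'"
      by (intro mult_left_mono G') auto
    finally show "ennreal ((1 + 1 / M) ^ Suc n) * emeasure W E \<le> emeasure W (ball x ((1 + \<delta>) * r))"
      using le by (rule order_trans)
  qed (rule \<alpha>)
qed

text \<open>The measure of \<open>E\<close>, multiplied by \<open>(1 + 1 / M) ^ n\<close>, still
  fits into the doubled ball, whose \<open>w\<close>-measure is at most \<open>D\<close> times that
  of the ball itself; \<open>n\<close> is taken so large that the power exceeds
  \<open>D / \<epsilon>\<close>.\<close>

lemma A_infinity:
  fixes q K \<epsilon> :: real
  assumes "0 < \<epsilon>" "1 \<le> K"
  shows "\<exists>\<alpha>>0. \<forall>(w::'a::euclidean_space \<Rightarrow> real) \<sigma> x r E. muckenhoupt w \<sigma> q K \<and> 0 < r \<and> E \<in> sets lebesgue \<and>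
     E \<subseteq> ball x r \<and> vol E \<le> ennreal \<alpha> * vol (ball x r) \<longrightarrow>
     emeasure (muckenhoupt.W w) E \<le> ennreal \<epsilon> * emeasure (muckenhoupt.W w) (ball x r)"
proof -
  define D where "D = Aq_doubling DIM('a) q K"
  define M where "M = D * (K * 2 powr q)"
  have D: "0 < D" using assms by (simp add: D_def Aq_doubling_def)
  then have "0 < M" using assms by (simp add: M_def)
  obtain n where n: "D / \<epsilon> < (1 + 1 / M) ^ n"
    using real_arch_pow[of "1 + 1 / M" "D / \<epsilon>"] \<open>0 < M\<close> by auto
  obtain \<alpha> where \<alpha>: "0 < \<alpha>" "\<And>(w::'a \<Rightarrow> real) \<sigma> x r E. muckenhoupt w \<sigma> q K \<Longrightarrow> 0 < r \<Longrightarrow> E \<in> sets lebesgue \<Longrightarrow>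
     E \<subseteq> ball x r \<Longrightarrow> vol E \<le> ennreal \<alpha> * vol (ball x r) \<Longrightarrow>
     ennreal ((1 + 1 / M) ^ n) * emeasure (muckenhoupt.W w) E \<le> emeasure (muckenhoupt.W w) (ball x ((1 + 1) * r))"
    using A_infinity_iterate[of M q K 1 n, where 'a = 'a] by (auto simp: M_def D_def)
  show ?thesis
  proof (intro exI[of _ \<alpha>] conjI allI impI)
    fix w :: "'a \<Rightarrow> real" and \<sigma> x r and E :: "'a set"
    assume *: "muckenhoupt w \<sigma> q K \<and> 0 < r \<and> E \<in> sets lebesgue \<and>
      E \<subseteq> ball x r \<and> vol E \<le> ennreal \<alpha> * vol (ball x r)"
    then interpret muckenhoupt w \<sigma> q K by simp
    have "ennreal (D / \<epsilon>) * emeasure W E \<le> ennreal ((1 + 1 / M) ^ n) * emeasure W E"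
      using n by (intro mult_right_mono ennreal_leI) auto
    also have "\<dots> \<le> emeasure W (ball x ((1 + 1) * r))"
      using * by (intro \<alpha>(2)[OF muckenhoupt_axioms]) auto
    also have "\<dots> \<le> emeasure W (ball x (5 * r))"
      using * by (intro emeasure_mono subset_ball) (auto simp: sets_W)
    also have "\<dots> \<le> ennreal D * emeasure W (ball x r)"
      unfolding D_def using * by (intro W_doubling) auto
    finally have "ennreal (\<epsilon> / D) * (ennreal (D / \<epsilon>) * emeasure W E) \<le> ennreal (\<epsilon> / D) * (ennreal D * emeasure W (ball x r))"
      by (intro mult_left_mono) auto
    then show "emeasure W E \<le> ennreal \<epsilon> * emeasure W (ball x r)"
      using D \<open>0 < \<epsilon>\<close> by (simp add: mult.assoc[symmetric] ennreal_mult[symmetric])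
  qed (rule \<alpha>)
qed

section \<open>The good-\<open>\<lambda>\<close> inequality\<close>

text \<open>The hypothesis of the theorem in terms of \<open>g = |F|\<close> and \<open>h = |f|\<close> to the power \<open>p\<^sub>0\<close>;
  \<open>u\<close> and \<open>v\<close> are multiples of \<open>|F\<^sub>B|\<close> and \<open>|R\<^sub>B|\<close> to the same power.\<close>

definition local_decomposition ::
  "'a::euclidean_space measure \<Rightarrow> real \<Rightarrow> real \<Rightarrow> real \<Rightarrow> real \<Rightarrow> real \<Rightarrow> 'a \<Rightarrow> real \<Rightarrow>
    ('a \<Rightarrow> ennreal) \<Rightarrow> ('a \<Rightarrow> ennreal) \<Rightarrow> bool" where
  "local_decomposition \<mu> q1 \<kappa> C2 a \<gamma> x0 r0 g h \<longleftrightarrow>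
    (\<forall>x r \<Lambda>. 0 < r \<and> ball x r \<subseteq> ball x0 (2 * r0) \<and> r \<le> 14 * \<kappa> * r0 \<and> 0 < \<Lambda> \<and>
      (lint (ball x (100 * r)) g) \<le> ennreal \<Lambda> * vol (ball x (100 * r)) \<and>
      (\<forall>y s. 0 < s \<and> ball x r \<subseteq> ball y s \<and> ball y s \<subseteq> ball x0 (4 * r0) \<longrightarrow>
         (lint (ball y s) h) \<le> ennreal (\<gamma> * \<Lambda>) * vol (ball y s)) \<longrightarrow>
      (\<exists>u v. u \<in> borel_measurable lebesgue \<and> v \<in> borel_measurable lebesgue \<and> (\<forall>y\<in>ball x r. g y \<le> u y + v y) \<and>
        (lint (ball x r) u) \<le> ennreal (a * \<Lambda>) * vol (ball x r) \<and>
        (\<integral>\<^sup>+z\<in>ball x r. epow (v z) q1 \<partial>\<mu>) \<le> ennreal (C2 * \<Lambda> powr q1) * emeasure \<mu> (ball x r)))"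

text \<open>\<open>\<kappa>\<close> bounds the radius of a stopping ball relative to
  \<open>r0 * \<rho> y\<close>. The value \<open>1 / 700\<close> is \<open>1 / (7 * 100)\<close>:
  stopping balls are dilated by 7, and the hypothesis looks at 100 times that.\<close>

locale stopping_balls = muckenhoupt w \<sigma> q K
  for w \<sigma> :: "'a::euclidean_space \<Rightarrow> real" and q K +
  fixes x0 :: 'a and r0 \<kappa> :: real and g :: "'a \<Rightarrow> ennreal"
  assumes r0: "0 < r0" and \<kappa>: "0 < \<kappa>" "\<kappa> \<le> 1 / 700"
    and g_measurable [measurable]: "g \<in> borel_measurable lebesgue"
begin

definition \<rho> :: "'a \<Rightarrow> real" where
  "\<rho> y = 2 - dist x0 y / r0"

definition bad :: "real \<Rightarrow> ('a \<times> real) set" where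
  "bad t = {(y, s). 0 < s \<and> dist x0 y < 2 * r0 \<and>
     ennreal t * vol (ball y s) < ennreal (\<rho> y ^ DIM('a)) * lint (ball y s) g}"

definition E :: "real \<Rightarrow> 'a set" where
  "E t = (\<Union>(y, s)\<in>bad t. ball y s)"

lemma \<rho>_pos: "dist x0 y < 2 * r0 \<Longrightarrow> 0 < \<rho> y"
  using r0 by (simp add: \<rho>_def field_simps)

lemma \<rho>_le_2: "\<rho> y \<le> 2"
  using r0 by (simp add: \<rho>_def)

lemma bad_mono: "t \<le> t' \<Longrightarrow> bad t' \<subseteq> bad t"
proof clarify
  fix y s assume "t \<le> t'" and ys: "(y, s) \<in> bad t'"
  then have "ennreal t * vol (ball y s) \<le> ennreal t' * vol (ball y s)"
    by (intro mult_right_mono ennreal_leI) auto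
  with ys show "(y, s) \<in> bad t"
    unfolding bad_def by (auto elim: le_less_trans)
qed

lemma E_mono: "t \<le> t' \<Longrightarrow> E t' \<subseteq> E t"
  unfolding E_def using bad_mono[of t t'] by auto

lemma E_in_sets [measurable]: "E t \<in> sets lebesgue"
  unfolding E_def by (intro lebesgue.open_in_sets) auto

text \<open>A ball of radius at least \<open>\<kappa> * r0 * \<rho> y\<close> has at least
  \<open>\<rho> y ^ DIM('a)\<close> times the volume of \<open>ball x0 (\<kappa> * r0)\<close>, so
  even the total integral of \<open>g\<close> is too small to make it bad. The exponent of
  \<open>\<rho>\<close> is made for this scaling.\<close>

lemma bad_radius:
  assumes "(y, s) \<in> bad t" and t: "(\<integral>\<^sup>+z. g z \<partial>lebesgue) \<le> ennreal t * vol (ball x0 (\<kappa> * r0))"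
  shows "s < \<kappa> * r0 * \<rho> y"
proof (rule ccontr)
  assume s: "\<not> s < \<kappa> * r0 * \<rho> y"
  have y: "dist x0 y < 2 * r0" using assms by (auto simp: bad_def)
  note \<rho> = \<rho>_pos[OF y]
  have "ennreal (\<rho> y ^ DIM('a)) * lint (ball y s) g \<le> ennreal (\<rho> y ^ DIM('a)) * (\<integral>\<^sup>+z. g z \<partial>lebesgue)"
    by (intro mult_left_mono nn_integral_mono) (auto split: split_indicator)
  also have "\<dots> \<le> ennreal (\<rho> y ^ DIM('a)) * (ennreal t * vol (ball x0 (\<kappa> * r0)))"
    by (intro mult_left_mono t) auto
  also have "\<dots> = ennreal t * vol (ball y (\<rho> y * (\<kappa> * r0)))"
    using \<rho> r0 \<kappa> by (subst emeasure_lebesgue_ball_scale[where y = x0]) (auto simp: mult_ac)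
  also have "\<dots> \<le> ennreal t * vol (ball y s)"
    using s by (intro mult_left_mono emeasure_mono subset_ball) (auto simp: mult_ac)
  finally show False using assms(1) by (auto simp: bad_def)
qed

text \<open>\<open>r0 * \<rho> y\<close> is the distance from \<open>y\<close> to the boundary of
  \<open>ball x0 (2 * r0)\<close>, and a bad ball centred at \<open>y\<close> has a smaller
  radius.\<close>

lemma E_subset:
  assumes "(\<integral>\<^sup>+z. g z \<partial>lebesgue) \<le> ennreal t * vol (ball x0 (\<kappa> * r0))"
  shows "E t \<subseteq> ball x0 (2 * r0)"
proof
  fix z assume "z \<in> E t"
  then obtain y s where ys: "(y, s) \<in> bad t" "z \<in> ball y s"
    by (auto simp: E_def)
  have "dist x0 y < 2 * r0" using ys by (auto simp: bad_def)
  note \<rho> = \<rho>_pos[OF this]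
  have "s < \<kappa> * r0 * \<rho> y"
    by (rule bad_radius[OF ys(1) assms])
  also have "\<dots> \<le> 1 * (r0 * \<rho> y)"
    unfolding mult.assoc using \<kappa> r0 \<rho> by (intro mult_right_mono) auto
  also have "\<dots> = 2 * r0 - dist x0 y"
    using r0 by (simp add: \<rho>_def field_simps)
  finally show "z \<in> ball x0 (2 * r0)"
    using ys(2) dist_triangle[of x0 z y] by auto
qed

text \<open>Differentiation at all scales \<open>1 / (n + 1)\<close> gives arbitrarily small balls
  through \<open>z\<close> with average above \<open>t\<close>. When such a ball is centred in
  \<open>ball x0 r0\<close>, where \<open>\<rho> \<ge> 1\<close>, the threshold is at most
  \<open>t\<close> and the ball is bad.\<close>

lemma AE_in_E:
  "AE z in lebesgue. z \<in> ball x0 r0 \<and> ennreal t < g z \<longrightarrow> z \<in> E t"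
proof -
  have "AE z in lebesgue. \<forall>n. g z \<le> hl_max lebesgue (inverse (real (Suc n))) g z"
    by (subst AE_all_countable) (auto intro: AE_le_hl_max)
  then show ?thesis
  proof eventually_elim
    case (elim z)
    show ?case
    proof safe
      assume z: "z \<in> ball x0 r0" "ennreal t < g z"
      then have "0 < r0 - dist x0 z" by simp
      then obtain n where n: "inverse (real (Suc n)) < r0 - dist x0 z"
        using reals_Archimedean by blast
      have "ennreal t < hl_max lebesgue (inverse (real (Suc n))) g z"
        using z(2) elim by (auto intro: less_le_trans)
      then obtain y s where y: "0 < s" "s < inverse (real (Suc n))" "z \<in> ball y s"
        "ennreal t * vol (ball y s) < lint (ball y s) g"
        unfolding lebesgue.less_hl_max_iff by blast
      have d: "dist x0 y < r0"
        using y(2,3) n dist_triangle[of x0 y z] by (auto simp: dist_commute)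
      then have "1 \<le> \<rho> y" using r0 by (simp add: \<rho>_def field_simps)
      note y(4)
      also have "lint (ball y s) g \<le> ennreal (\<rho> y ^ DIM('a)) * lint (ball y s) g"
        using mult_right_mono[of 1 "ennreal (\<rho> y ^ DIM('a))" "\<integral>\<^sup>+z\<in>ball y s. g z \<partial>lebesgue"] one_le_power[OF \<open>1 \<le> \<rho> y\<close>]
        by simp
      finally have "(y, s) \<in> bad t"
        using y d r0 by (auto simp: bad_def)
      then show "z \<in> E t"
        using y(3) unfolding E_def by blast
    qed
  qed
qed

text \<open>Near-maximality of \<open>s\<close> at \<open>z\<close> excludes bad balls through
  \<open>z\<close> that are much larger. This bounds the average of \<open>g\<close> over the ball
  seen by the hypothesis and confines the bad balls of level \<open>A * t\<close> that reach
  \<open>ball y (5 * s)\<close>. There \<open>g\<close> splits into \<open>u\<close> and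
  \<open>v\<close>: the \<open>A_infinity\<close> property handles \<open>u\<close>, the weighted
  maximal inequality at exponent \<open>q1\<close> handles \<open>v\<close>. The point
  \<open>z'\<close> supplies the bounds for \<open>h\<close>.\<close>

lemma stopping_ball_estimate:
  fixes t \<gamma> A a \<alpha> \<epsilon> q1 C2 :: real and h :: "'a \<Rightarrow> ennreal"
  assumes "0 < t" and t: "(\<integral>\<^sup>+z. g z \<partial>lebesgue) \<le> ennreal t * vol (ball x0 (\<kappa> * r0))"
    and "q < q1" "0 \<le> C2" "0 < \<gamma>" and A: "7 ^ DIM('a) \<le> A"
    and a: "0 \<le> a" "5 ^ DIM('a) * 2 ^ (DIM('a) + 1) * a \<le> \<alpha> * A"
    and "0 \<le> \<epsilon>"
    and Ainf: "\<And>x r E. 0 < r \<Longrightarrow> E \<in> sets lebesgue \<Longrightarrow> E \<subseteq> ball x r \<Longrightarrow>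
        vol E \<le> ennreal \<alpha> * vol (ball x r) \<Longrightarrow> emeasure W E \<le> ennreal \<epsilon> * emeasure W (ball x r)"
    and hyp: "local_decomposition W q1 \<kappa> C2 a \<gamma> x0 r0 g h"
    and bad: "(y, s) \<in> bad t" and z: "z \<in> ball y s"
    and stop: "\<And>y' s'. (y', s') \<in> bad t \<Longrightarrow> z \<in> ball y' s' \<Longrightarrow> s' < 2 * s"
    and z': "z' \<in> ball y s" "hl_max lebesgue (5 * r0) h z' \<le> ennreal (\<gamma> / 2 ^ DIM('a) * t)"
  shows "emeasure W (E (A * t) \<inter> ball y (5 * s))
    \<le> ennreal ((Aq_doubling DIM('a) q K)\<^sup>2 * (\<epsilon> + K powr (q1 / q) * maximal_const (Aq_doubling DIM('a) q K) (q1 / q) * C2 * (2 ^ (DIM('a) + 1) / A) powr q1))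
      * emeasure W (ball y s)"
proof -
  define D where "D = Aq_doubling DIM('a) q K"
  define C3 where "C3 = K powr (q1 / q) * maximal_const D (q1 / q)"
  have q1: "1 < q1 / q" "0 < q1" using \<open>q < q1\<close> q_gt_1 by auto
  have D: "1 \<le> D" using W.D_ge_1 by (simp add: D_def)
  define Z where "Z = C3 * C2 * (2 ^ (DIM('a) + 1) / A) powr q1"
  have C3: "0 \<le> C3" using D q1 q_gt_1 unfolding C3_def maximal_const_def
    by (intro mult_nonneg_nonneg divide_nonneg_nonneg) auto
  have Z: "0 \<le> Z" using C3 \<open>0 \<le> C2\<close> by (simp add: Z_def)
  have "1 \<le> A" using A one_le_power[of "7::real" "DIM('a)"] by linarith
  \<comment> \<open>A bad ball of level \<open>A * t\<close> that meets
    \<open>ball y (5 * s)\<close> will turn out to have radius at most \<open>s\<close>, so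
    \<open>5 + 1 + 1\<close> radii contain it.\<close>
  define B where "B = ball y (7 * s)"
  have B[measurable]: "B \<in> sets lebesgue" by (simp add: B_def)
  have y: "dist x0 y < 2 * r0" "0 < s" using bad by (auto simp: bad_def)
  note \<rho> = \<rho>_pos[OF y(1)]
  have s: "s < \<kappa> * r0 * \<rho> y" by (rule bad_radius[OF bad t])
  have s700: "700 * s < r0 * \<rho> y"
  proof -
    have "\<kappa> * (r0 * \<rho> y) \<le> 1 / 700 * (r0 * \<rho> y)"
      using \<kappa> r0 \<rho> by (intro mult_right_mono) auto
    then show ?thesis using s by (simp add: mult.assoc)
  qed
  have r0\<rho>: "r0 * \<rho> y = 2 * r0 - dist x0 y" using r0 by (simp add: \<rho>_def field_simps)
  define \<Lambda> where "\<Lambda> = t / \<rho> y ^ DIM('a)"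
  have \<Lambda>: "0 < \<Lambda>" "\<rho> y ^ DIM('a) * \<Lambda> = t" using \<rho> \<open>0 < t\<close> by (auto simp: \<Lambda>_def)
  have B_sub: "B \<subseteq> ball x0 (2 * r0)"
    unfolding B_def using s700 r0\<rho> y(2) by (subst ball_subset_ball_iff) (auto simp: dist_commute)
  \<comment> \<open>From \<open>s < \<kappa> * r0 * \<rho> y\<close> and
    \<open>\<rho> y \<le> 2\<close>; this is the origin of the 14 in
    \<open>local_decomposition\<close>.\<close>
  have r7: "7 * s \<le> 14 * \<kappa> * r0"
  proof -
    have "\<kappa> * r0 * \<rho> y \<le> \<kappa> * r0 * 2"
      using \<kappa> r0 \<rho>_le_2[of y] by (intro mult_left_mono) auto
    then show ?thesis using s by linarith
  qed
  \<comment> \<open>The ball of 700 times the radius contains \<open>z\<close> and is too large to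
    be bad.\<close>
  have avg_g: "(lint (ball y (100 * (7 * s))) g) \<le> ennreal \<Lambda> * vol (ball y (100 * (7 * s)))"
  proof -
    have "z \<in> ball y (100 * (7 * s))" using z y by auto
    then have "(y, 100 * (7 * s)) \<notin> bad t"
      using stop[of y "100 * (7 * s)"] y by auto
    then have "ennreal (\<rho> y ^ DIM('a)) * (lint (ball y (100 * (7 * s))) g) \<le> ennreal t * vol (ball y (100 * (7 * s)))"
      using y by (auto simp: bad_def not_less)
    also have "\<dots> = ennreal (\<rho> y ^ DIM('a)) * (ennreal \<Lambda> * vol (ball y (100 * (7 * s))))"
      using \<Lambda> \<rho> by (simp add: mult.assoc[symmetric] ennreal_mult[symmetric])
    finally show ?thesis
      using \<rho> by (simp add: ennreal_mult_le_mult_iff)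
  qed
  \<comment> \<open>Each admissible ball contains \<open>z'\<close> and has radius at most
    \<open>4 * r0\<close>, below the cut-off of the maximal function. The denominator
    \<open>2 ^ DIM('a)\<close> in the assumption on \<open>z'\<close> pays for
    \<open>\<rho> y \<le> 2\<close>.\<close>
  have avg_h: "lint (ball y' s') h \<le> ennreal (\<gamma> * \<Lambda>) * vol (ball y' s')"
    if "0 < s'" "ball y (7 * s) \<subseteq> ball y' s'" "ball y' s' \<subseteq> ball x0 (4 * r0)" for y' s'
  proof -
    have "z' \<in> ball y (7 * s)" using z'(1) y by auto
    then have "z' \<in> ball y' s'" using that by blast
    moreover have "dist y' x0 + s' \<le> 4 * r0" using that by (simp add: ball_subset_ball_iff)
    then have "s' < 5 * r0" using r0 zero_le_dist[of y' x0] by linarith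
    ultimately have "lint (ball y' s') h \<le> hl_max lebesgue (5 * r0) h z' * vol (ball y' s')"
      using that by (intro lebesgue.integral_ball_le_hl_max) auto
    also have "\<dots> \<le> ennreal (\<gamma> / 2 ^ DIM('a) * t) * vol (ball y' s')"
      by (intro mult_right_mono z') auto
    also have "\<dots> \<le> ennreal (\<gamma> * \<Lambda>) * vol (ball y' s')"
    proof (intro mult_right_mono ennreal_leI)
      have "\<gamma> * t / 2 ^ DIM('a) \<le> \<gamma> * t / \<rho> y ^ DIM('a)"
        using \<open>0 < t\<close> \<open>0 < \<gamma>\<close> \<rho> \<rho>_le_2[of y] by (intro divide_left_mono power_mono) auto
      then show "\<gamma> / 2 ^ DIM('a) * t \<le> \<gamma> * \<Lambda>" by (simp add: \<Lambda>_def)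
    qed auto
    finally show ?thesis .
  qed
  obtain u v where [measurable]: "u \<in> borel_measurable lebesgue" "v \<in> borel_measurable lebesgue"
    and guv: "\<And>x. x \<in> B \<Longrightarrow> g x \<le> u x + v x"
    and u: "lint B u \<le> ennreal (a * \<Lambda>) * vol B"
    and v: "(\<integral>\<^sup>+z\<in>B. epow (v z) q1 \<partial>W) \<le> ennreal (C2 * \<Lambda> powr q1) * emeasure W B"
    using hyp[unfolded local_decomposition_def, rule_format, of "7 * s" y \<Lambda>] B_sub r7 \<Lambda>(1) avg_g avg_h y(2)
    unfolding B_def by auto
  define u' v' where "u' x = u x * indicator B x" and "v' x = v x * indicator B x" for x
  have [measurable]: "u' \<in> borel_measurable lebesgue" "v' \<in> borel_measurable lebesgue"
    unfolding u'_def v'_def by measurable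
  \<comment> \<open>In the denominator, one factor 2 is for the split into \<open>u\<close> and
    \<open>v\<close>, and \<open>2 ^ DIM('a)\<close> is for the comparison
    \<open>\<rho> y' \<le> 2 * \<rho> y\<close> with the centres of the smaller balls.\<close>
  define \<tau> where "\<tau> = A * \<Lambda> / 2 ^ (DIM('a) + 1)"
  have \<tau>: "0 < \<tau>" using \<open>1 \<le> A\<close> \<Lambda> by (simp add: \<tau>_def)
  define Xu where "Xu = {x. ennreal \<tau> < hl_max lebesgue (2 * s) u' x} \<inter> ball y (5 * s)"
  define Xv where "Xv = {x. ennreal \<tau> < hl_max lebesgue (2 * s) v' x}"
  have [measurable]: "Xu \<in> sets lebesgue" "Xv \<in> sets lebesgue"
    unfolding Xu_def Xv_def by (intro sets.Int lebesgue.open_in_sets lebesgue.open_hl_max open_ball)+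
  have "E (A * t) \<inter> ball y (5 * s) \<subseteq> Xu \<union> Xv"
  proof
    fix x assume x: "x \<in> E (A * t) \<inter> ball y (5 * s)"
    then obtain y' s' where y': "(y', s') \<in> bad (A * t)" "x \<in> ball y' s'"
      by (auto simp: E_def)
    have s'0: "0 < s'" "dist x0 y' < 2 * r0" using y' by (auto simp: bad_def)
    have big: "ennreal (A * t) * vol (ball y' s') < ennreal (\<rho> y' ^ DIM('a)) * lint (ball y' s') g"
      using y' by (auto simp: bad_def)
    have dxy: "dist y x < 5 * s" "dist y' x < s'" using x y' by auto
    \<comment> \<open>Otherwise the 7-fold dilate contains \<open>z\<close>, is bad at level
      \<open>t\<close> because \<open>A \<ge> 7 ^ DIM('a)\<close>, and is larger than
      near-maximality allows.\<close>
    have "s' \<le> s"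
    proof (rule ccontr)
      assume "\<not> s' \<le> s"
      have "z \<in> ball y' (7 * s')"
        using dxy z \<open>\<not> s' \<le> s\<close> dist_triangle[of y' z x] dist_triangle[of x z y] by (auto simp: dist_commute)
      have "ennreal t * vol (ball y' (7 * s')) = ennreal t * (ennreal (7 ^ DIM('a)) * vol (ball y' s'))"
        using s'0 by (subst emeasure_lebesgue_ball_scale[where y = y']) auto
      also have "\<dots> = ennreal (7 ^ DIM('a) * t) * vol (ball y' s')"
        using \<open>0 < t\<close> by (simp add: ennreal_mult mult_ac)
      also have "\<dots> \<le> ennreal (A * t) * vol (ball y' s')"
        using A \<open>0 < t\<close> by (intro mult_right_mono ennreal_leI) auto
      also note big
      also have "ennreal (\<rho> y' ^ DIM('a)) * lint (ball y' s') g \<le> ennreal (\<rho> y' ^ DIM('a)) * lint (ball y' (7 * s')) g"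
        using s'0 by (intro mult_left_mono nn_integral_mono) (auto split: split_indicator)
      finally have "(y', 7 * s') \<in> bad t"
        using s'0 by (auto simp: bad_def)
      from stop[OF this \<open>z \<in> ball y' (7 * s')\<close>] \<open>\<not> s' \<le> s\<close> y(2) show False by simp
    qed
    then have dyy: "dist y y' < 6 * s" using dxy dist_triangle[of y y' x] by (auto simp: dist_commute)
    have sub: "ball y' s' \<subseteq> B"
      unfolding B_def using dyy \<open>s' \<le> s\<close> s'0 by (subst ball_subset_ball_iff) (auto simp: dist_commute)
    have "\<rho> y' \<le> 2 * \<rho> y"
    proof -
      have "dist x0 y - dist x0 y' \<le> dist y y'"
        using dist_triangle[of x0 y y'] by (simp add: dist_commute)
      also have "\<dots> \<le> r0 * \<rho> y" using dyy s700 y(2) by linarith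
      finally have "(dist x0 y - dist x0 y') / r0 \<le> \<rho> y" using r0 by (simp add: field_simps)
      then show ?thesis by (simp add: \<rho>_def diff_divide_distrib)
    qed
    then have pw: "\<rho> y' ^ DIM('a) \<le> (2 * \<rho> y) ^ DIM('a)"
      using \<rho>_pos[OF s'0(2)] by (intro power_mono) auto
    have "ennreal (A * t) * vol (ball y' s') < ennreal ((2 * \<rho> y) ^ DIM('a)) * lint (ball y' s') g"
      by (rule less_le_trans[OF big mult_right_mono[OF ennreal_leI[OF pw]]]) simp
    also have "A * t = (2 * \<rho> y) ^ DIM('a) * (2 * \<tau>)"
      using \<rho> by (simp add: \<Lambda>(2)[symmetric] \<tau>_def power_mult_distrib)
    also have "ennreal ((2 * \<rho> y) ^ DIM('a) * (2 * \<tau>)) = ennreal ((2 * \<rho> y) ^ DIM('a)) * ennreal (2 * \<tau>)"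
      using \<rho> \<tau> by (intro ennreal_mult) auto
    finally have "\<not> ennreal ((2 * \<rho> y) ^ DIM('a)) * lint (ball y' s') g
        \<le> ennreal ((2 * \<rho> y) ^ DIM('a)) * (ennreal (2 * \<tau>) * vol (ball y' s'))"
      by (simp only: mult.assoc not_le)
    then have "ennreal (2 * \<tau>) * vol (ball y' s') < lint (ball y' s') g"
      by (rule contrapos_np) (intro mult_left_mono, simp_all add: not_less)
    also have "\<dots> \<le> (\<integral>\<^sup>+z. u' z * indicator (ball y' s') z + v' z * indicator (ball y' s') z \<partial>lebesgue)"
    proof (intro nn_integral_mono)
      fix x
      show "g x * indicator (ball y' s') x \<le> u' x * indicator (ball y' s') x + v' x * indicator (ball y' s') x"
        using guv[of x] subsetD[OF sub, of x] by (cases "x \<in> ball y' s'") (simp_all add: u'_def v'_def)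
    qed
    also have "\<dots> = lint (ball y' s') u' + lint (ball y' s') v'"
      by (rule nn_integral_add) simp_all
    also have "ennreal (2 * \<tau>) = ennreal \<tau> + ennreal \<tau>"
      using \<tau> by (simp add: ennreal_plus[symmetric] del: ennreal_plus)
    finally have lt: "ennreal \<tau> * vol (ball y' s') + ennreal \<tau> * vol (ball y' s')
        < lint (ball y' s') u' + lint (ball y' s') v'"
      by (simp only: distrib_right)
    have "ennreal \<tau> * vol (ball y' s') < lint (ball y' s') u' \<or>
       ennreal \<tau> * vol (ball y' s') < lint (ball y' s') v'"
    proof (rule ccontr)
      assume "\<not> ?thesis"
      then show False
        using add_mono[of "\<integral>\<^sup>+z\<in>ball y' s'. u' z \<partial>lebesgue" "ennreal \<tau> * vol (ball y' s')"
          "\<integral>\<^sup>+z\<in>ball y' s'. v' z \<partial>lebesgue" "ennreal \<tau> * vol (ball y' s')"] lt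
        by (simp only: not_less de_Morgan_disj) (meson leD)
    qed
    then show "x \<in> Xu \<union> Xv"
      unfolding Xu_def Xv_def lebesgue.less_hl_max_iff
      using s'0(1) \<open>s' \<le> s\<close> y(2) y'(2) x by (auto intro!: exI[of _ y'] exI[of _ s'])
  qed
  then have "emeasure W (E (A * t) \<inter> ball y (5 * s)) \<le> emeasure W (Xu \<union> Xv)"
    by (intro emeasure_mono) (auto simp: sets_W)
  also have "\<dots> \<le> emeasure W Xu + emeasure W Xv"
    by (intro emeasure_subadditive) (auto simp: sets_W)
  also have "emeasure W Xu \<le> ennreal \<epsilon> * emeasure W B"
    unfolding B_def
  proof (rule Ainf)
    have "vol Xu \<le> vol {x. ennreal \<tau> < hl_max lebesgue (2 * s) u' x}"
      by (intro emeasure_mono lebesgue.open_in_sets lebesgue.open_hl_max) (auto simp: Xu_def)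
    also have "\<dots> \<le> ennreal (5 ^ DIM('a) / \<tau>) * (\<integral>\<^sup>+z. u' z \<partial>lebesgue)"
      using \<tau> by (intro lebesgue.weak_type) auto
    also have "\<dots> \<le> ennreal (5 ^ DIM('a) / \<tau>) * (ennreal (a * \<Lambda>) * vol B)"
      unfolding u'_def by (intro mult_left_mono u) auto
    also have "\<dots> = ennreal (5 ^ DIM('a) / \<tau> * (a * \<Lambda>)) * vol B"
      using \<tau> a \<Lambda> by (subst mult.assoc[symmetric], subst ennreal_mult[symmetric]) auto
    also have "\<dots> \<le> ennreal \<alpha> * vol B"
    proof (intro mult_right_mono ennreal_leI)
      have "5 ^ DIM('a) / \<tau> * (a * \<Lambda>) = 5 ^ DIM('a) * 2 ^ (DIM('a) + 1) * a / A"
        using \<Lambda> \<open>1 \<le> A\<close> by (simp add: \<tau>_def)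
      also have "\<dots> \<le> \<alpha>" using a \<open>1 \<le> A\<close> by (simp add: divide_le_eq)
      finally show "5 ^ DIM('a) / \<tau> * (a * \<Lambda>) \<le> \<alpha>" .
    qed auto
    finally show "vol Xu \<le> ennreal \<alpha> * vol (ball y (7 * s))"
      by (simp add: B_def)
  qed (use y in \<open>auto simp: Xu_def\<close>)
  also have "emeasure W Xv \<le> ennreal (Z) * emeasure W B"
  proof -
    \<comment> \<open>Chebyshev with exponent \<open>q1\<close>; the ratio
      \<open>\<Lambda> / \<tau> = 2 ^ (DIM('a) + 1) / A\<close> leaves the power \<open>- q1\<close>
      of \<open>A\<close>.\<close>
    have "ennreal (\<tau> powr q1) * emeasure W Xv = (\<integral>\<^sup>+x. ennreal (\<tau> powr q1) * indicator Xv x \<partial>W)"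
      by (subst nn_integral_cmult_indicator) (auto simp: sets_W)
    also have "\<dots> \<le> (\<integral>\<^sup>+x. epow (hl_max lebesgue (2 * s) v' x) q1 \<partial>W)"
    proof (intro nn_integral_mono)
      fix x
      have "epow (ennreal \<tau>) q1 \<le> epow (hl_max lebesgue (2 * s) v' x) q1" if "x \<in> Xv"
        using that q1 by (auto simp: Xv_def)
      then show "ennreal (\<tau> powr q1) * indicator Xv x \<le> epow (hl_max lebesgue (2 * s) v' x) q1"
        using \<tau> by (auto simp: epow_ennreal split: split_indicator)
    qed
    also have "\<dots> \<le> ennreal C3 * (\<integral>\<^sup>+x. epow (v' x) q1 \<partial>W)"
      unfolding C3_def D_def using \<open>q < q1\<close> by (intro hl_max_bounded_higher) auto
    also have "(\<integral>\<^sup>+x. epow (v' x) q1 \<partial>W) = (\<integral>\<^sup>+x\<in>B. epow (v x) q1 \<partial>W)"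
      by (intro nn_integral_cong) (auto simp: v'_def split: split_indicator)
    also have "ennreal C3 * \<dots> \<le> ennreal C3 * (ennreal (C2 * \<Lambda> powr q1) * emeasure W B)"
      by (intro mult_left_mono v) auto
    also have "\<dots> = ennreal (C3 * C2 * \<Lambda> powr q1) * emeasure W B"
      using C3 \<open>0 \<le> C2\<close> by (subst mult.assoc[symmetric], subst ennreal_mult[symmetric]) (auto simp: mult.assoc)
    finally have "ennreal (\<tau> powr (- q1)) * (ennreal (\<tau> powr q1) * emeasure W Xv) \<le> ennreal (\<tau> powr (- q1)) * (ennreal (C3 * C2 * \<Lambda> powr q1) * emeasure W B)"
      by (intro mult_left_mono) auto
    also have "ennreal (\<tau> powr (- q1)) * (ennreal (\<tau> powr q1) * emeasure W Xv) = emeasure W Xv"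
      using \<tau> by (simp add: mult.assoc[symmetric] ennreal_mult[symmetric] powr_add[symmetric])
    also have "ennreal (\<tau> powr (- q1)) * (ennreal (C3 * C2 * \<Lambda> powr q1) * emeasure W B) = ennreal (\<tau> powr (- q1) * (C3 * C2 * \<Lambda> powr q1)) * emeasure W B"
      using C3 \<open>0 \<le> C2\<close> by (subst mult.assoc[symmetric], subst ennreal_mult[symmetric]) auto
    also have "\<tau> powr (- q1) * (C3 * C2 * \<Lambda> powr q1) = C3 * C2 * (\<tau> powr (- q1) * \<Lambda> powr q1)"
      by (simp only: mult_ac)
    also have "\<tau> powr (- q1) * \<Lambda> powr q1 = (2 ^ (DIM('a) + 1) / A) powr q1"
    proof -
      have "2 ^ (DIM('a) + 1) / A = \<Lambda> / \<tau>" using \<Lambda> by (simp add: \<tau>_def)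
      moreover have "(\<Lambda> / \<tau>) powr q1 = \<Lambda> powr q1 / \<tau> powr q1"
        by (rule powr_divide)
      ultimately show ?thesis by (simp add: powr_minus_divide)
    qed
    finally show ?thesis by (simp add: Z_def mult.assoc)
  qed
  also have "ennreal \<epsilon> * emeasure W B + ennreal (Z) * emeasure W B
     = ennreal (\<epsilon> + Z) * emeasure W B"
    using \<open>0 \<le> \<epsilon>\<close> Z by (subst ennreal_plus) (auto simp: distrib_right)
  also have "emeasure W B \<le> ennreal (D\<^sup>2) * emeasure W (ball y s)"
  proof -
    have "emeasure W B \<le> emeasure W (ball y (5 * (5 * s)))"
      unfolding B_def using y by (intro emeasure_mono subset_ball) (auto simp: sets_W)
    also have "\<dots> \<le> ennreal D * emeasure W (ball y (5 * s))"
      unfolding D_def using y by (intro W_doubling) auto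
    also have "\<dots> \<le> ennreal D * (ennreal D * emeasure W (ball y s))"
      unfolding D_def using y by (intro mult_left_mono W_doubling) auto
    finally show ?thesis using D by (simp add: power2_eq_square ennreal_mult mult.assoc)
  qed
  also have "ennreal (\<epsilon> + Z) * (ennreal (D\<^sup>2) * emeasure W (ball y s))
     = ennreal (D\<^sup>2 * (\<epsilon> + Z)) * emeasure W (ball y s)"
    using \<open>0 \<le> \<epsilon>\<close> Z
    by (subst mult.assoc[symmetric], subst ennreal_mult[symmetric]) (auto simp: mult.commute)
  finally show ?thesis
    by (simp add: Z_def C3_def D_def add_mono mult_left_mono add_left_mono add_right_mono)
qed

end

context stopping_balls
begin

text \<open>Every point of \<open>E t\<close> gets a bad ball of nearly maximal radius, and Vitali's
  lemma selects among these. A selected ball inside the set where the maximal function of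
  \<open>h\<close> is large is paid for by doubling; any other contains a point \<open>z'\<close>
  outside that set, so \<open>est\<close> applies to it.\<close>

lemma good_lambda:
  fixes t \<gamma> A \<delta> :: real and h :: "'a \<Rightarrow> ennreal"
  assumes "0 < t" and t: "(\<integral>\<^sup>+z. g z \<partial>lebesgue) \<le> ennreal t * vol (ball x0 (\<kappa> * r0))"
    and "1 \<le> A"
    and est: "\<And>y s z z'. (y, s) \<in> bad t \<Longrightarrow> z \<in> ball y s \<Longrightarrow>
       (\<And>y' s'. (y', s') \<in> bad t \<Longrightarrow> z \<in> ball y' s' \<Longrightarrow> s' < 2 * s) \<Longrightarrow>
       z' \<in> ball y s \<Longrightarrow> hl_max lebesgue (5 * r0) h z' \<le> ennreal (\<gamma> / 2 ^ DIM('a) * t) \<Longrightarrow>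
       emeasure W (E (A * t) \<inter> ball y (5 * s)) \<le> ennreal \<delta> * emeasure W (ball y s)"
  shows "emeasure W (E (A * t)) \<le> ennreal \<delta> * emeasure W (E t) +
    ennreal (Aq_doubling DIM('a) q K) * emeasure W {x. ennreal (\<gamma> / 2 ^ DIM('a) * t) < hl_max lebesgue (5 * r0) h x}"
proof -
  define H where "H = {x. ennreal (\<gamma> / 2 ^ DIM('a) * t) < hl_max lebesgue (5 * r0) h x}"
  have H: "H \<in> sets lebesgue"
    unfolding H_def by (intro lebesgue.open_in_sets lebesgue.open_hl_max)
  have rad: "0 < s \<and> s \<le> 2 * \<kappa> * r0" if "(y, s) \<in> bad t" for y s
  proof -
    have "\<kappa> * r0 * \<rho> y \<le> \<kappa> * r0 * 2"
      using \<kappa> r0 \<rho>_le_2[of y] by (intro mult_left_mono) auto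
    then show ?thesis
      using bad_radius[OF that t] that by (auto simp: bad_def)
  qed
  have "\<exists>y s. (y, s) \<in> bad t \<and> z \<in> ball y s \<and> (\<forall>y' s'. (y', s') \<in> bad t \<longrightarrow> z \<in> ball y' s' \<longrightarrow> s' < 2 * s)"
    if z: "z \<in> E t" for z
  proof -
    define P where "P s \<longleftrightarrow> (\<exists>y. (y, s) \<in> bad t \<and> z \<in> ball y s)" for s
    obtain s0 where "P s0" using z unfolding E_def P_def by blast
    moreover have "0 < s \<and> s \<le> 2 * \<kappa> * r0" if "P s" for s
      using rad that by (auto simp: P_def)
    ultimately obtain s where "P s" "\<forall>s'. P s' \<longrightarrow> s' < 2 * s"
      by (rule nearly_maximal_radius)
    then show ?thesis unfolding P_def by blast
  qed
  then obtain yy ss where ys: "\<And>z. z \<in> E t \<Longrightarrow> (yy z, ss z) \<in> bad t" "\<And>z. z \<in> E t \<Longrightarrow> z \<in> ball (yy z) (ss z)"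
    "\<And>z y' s'. z \<in> E t \<Longrightarrow> (y', s') \<in> bad t \<Longrightarrow> z \<in> ball y' s' \<Longrightarrow> s' < 2 * ss z"
    by metis
  have cov: "E t \<subseteq> (\<Union>z\<in>E t. ball (yy z) (ss z))" using ys(2) by blast
  have bd: "0 < ss z \<and> ss z \<le> 2 * \<kappa> * r0" if "z \<in> E t" for z using rad ys(1)[OF that] by auto
  obtain C where C: "countable C" "C \<subseteq> E t" "disjoint_family_on (\<lambda>i. ball (yy i) (ss i)) C"
     "E t \<subseteq> (\<Union>i\<in>C. ball (yy i) (5 * ss i))"
    by (rule Vitali_disjoint_balls[OF cov bd])
  define C1 where "C1 = {i\<in>C. \<not> ball (yy i) (ss i) \<subseteq> H}"
  define C2 where "C2 = {i\<in>C. ball (yy i) (ss i) \<subseteq> H}"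
  have CC: "countable C1" "countable C2" "C1 \<subseteq> C" "C2 \<subseteq> C" "C = C1 \<union> C2"
    using C(1) by (auto simp: C1_def C2_def)
  have disj: "disjoint_family_on (\<lambda>i. ball (yy i) (ss i)) C'" if "C' \<subseteq> C" for C'
    using C(3) that unfolding disjoint_family_on_def by blast
  have ballE: "ball (yy i) (ss i) \<subseteq> E t" if "i \<in> C" for i
    using ys(1)[of i] that C(2) unfolding E_def by blast
  have "E (A * t) \<subseteq> E t" using \<open>1 \<le> A\<close> \<open>0 < t\<close> by (intro E_mono) auto
  then have "E (A * t) \<subseteq> (\<Union>i\<in>C1. E (A * t) \<inter> ball (yy i) (5 * ss i)) \<union> (\<Union>i\<in>C2. ball (yy i) (5 * ss i))"
    using C(4) CC(5) by blast
  then have "emeasure W (E (A * t)) \<le> emeasure W ((\<Union>i\<in>C1. E (A * t) \<inter> ball (yy i) (5 * ss i)) \<union> (\<Union>i\<in>C2. ball (yy i) (5 * ss i)))"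
    using CC by (intro emeasure_mono) (auto simp: sets_W intro!: sets.Un sets.Int sets.countable_UN')
  also have "\<dots> \<le> emeasure W (\<Union>i\<in>C1. E (A * t) \<inter> ball (yy i) (5 * ss i)) + emeasure W (\<Union>i\<in>C2. ball (yy i) (5 * ss i))"
    using CC by (intro emeasure_subadditive) (auto simp: sets_W intro!: sets.Un sets.Int sets.countable_UN')
  also have "\<dots> \<le> ennreal \<delta> * emeasure W (E t) + ennreal (Aq_doubling DIM('a) q K) * emeasure W H"
  proof (rule add_mono)
    have "emeasure W (\<Union>i\<in>C1. E (A * t) \<inter> ball (yy i) (5 * ss i)) \<le> ennreal \<delta> * emeasure W (\<Union>i\<in>C1. ball (yy i) (ss i))"
    proof (rule emeasure_UN_le_disjoint)
      fix i assume i: "i \<in> C1"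
      then have iE: "i \<in> E t" using CC C by blast
      obtain z' where z': "z' \<in> ball (yy i) (ss i)" "hl_max lebesgue (5 * r0) h z' \<le> ennreal (\<gamma> / 2 ^ DIM('a) * t)"
        using i unfolding C1_def H_def by (metis (mono_tags, lifting) linorder_not_less mem_Collect_eq subsetI)
      show "emeasure W (E (A * t) \<inter> ball (yy i) (5 * ss i)) \<le> ennreal \<delta> * emeasure W (ball (yy i) (ss i))"
        using ys[OF iE] z' by (intro est[of _ _ i z']) auto
    qed (use CC disj in \<open>auto simp: sets_W\<close>)
    also have "\<dots> \<le> ennreal \<delta> * emeasure W (E t)"
      using ballE CC by (intro mult_left_mono emeasure_mono UN_least) (auto simp: sets_W)
    finally show "emeasure W (\<Union>i\<in>C1. E (A * t) \<inter> ball (yy i) (5 * ss i)) \<le> ennreal \<delta> * emeasure W (E t)" .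
    have "emeasure W (\<Union>i\<in>C2. ball (yy i) (5 * ss i)) \<le> ennreal (Aq_doubling DIM('a) q K) * emeasure W (\<Union>i\<in>C2. ball (yy i) (ss i))"
      using CC C bd by (intro emeasure_UN_le_disjoint disj W_doubling) (auto simp: sets_W)
    also have "\<dots> \<le> ennreal (Aq_doubling DIM('a) q K) * emeasure W H"
      using H by (intro mult_left_mono emeasure_mono UN_least) (auto simp: sets_W C2_def)
    finally show "emeasure W (\<Union>i\<in>C2. ball (yy i) (5 * ss i)) \<le> ennreal (Aq_doubling DIM('a) q K) * emeasure W H" .
  qed
  finally show ?thesis by (simp add: H_def)
qed

end

section \<open>Integration of the good-\<lambda> inequality over all levels\<close>

lemma borel_measurable_antimono_ennreal:
  fixes \<phi> :: "real \<Rightarrow> ennreal"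
  assumes "antimono \<phi>"
  shows "\<phi> \<in> borel_measurable borel"
proof (rule borel_measurableI_greater)
  fix c
  define S where "S = {x. c < \<phi> x}"
  have "\<exists>a b. S = {} \<or> S = UNIV \<or> S = {..<b} \<or> S = {..b} \<or> S = {a<..} \<or> S = {a..} \<or>
      S = {a<..<b} \<or> S = {a<..b} \<or> S = {a..<b} \<or> S = {a..b}"
    by (rule interval_cases) (use assms in \<open>auto simp: S_def antimono_def intro: less_le_trans\<close>)
  then show "{x \<in> space borel. c < \<phi> x} \<in> sets borel"
    by (auto simp: S_def[symmetric])
qed

text \<open>Absorption: since \<open>\<phi>\<close> is only known to be bounded, the integral is first truncated at a finite height,
  where it is finite.\<close>

lemma good_lambda_integrate:
  fixes \<phi> \<psi> :: "real \<Rightarrow> ennreal" and A q \<delta> t0 :: real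
  assumes "antimono \<phi>" and \<psi>: "\<psi> \<in> borel_measurable borel" and "1 \<le> A" "0 < q" "0 \<le> t0" "0 \<le> \<delta>" "0 \<le> D"
    and \<delta>: "A powr q * \<delta> \<le> 1 / 2"
    and bound: "\<And>t. t0 < t \<Longrightarrow> \<phi> t \<le> U" and "U < top"
    and gl: "\<And>t. t0 < t \<Longrightarrow> \<phi> (A * t) \<le> ennreal \<delta> * \<phi> t + ennreal D * \<psi> t"
  shows "(\<integral>\<^sup>+t. ennreal (q * t powr (q - 1)) * indicator {t0<..} t * \<phi> t \<partial>lborel)
    \<le> ennreal (2 * (A * t0) powr q) * U + ennreal (2 * A powr q * D) * (\<integral>\<^sup>+t. ennreal (q * t powr (q - 1)) * indicator {0<..} t * \<psi> t \<partial>lborel)"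
proof -
  note \<psi>[measurable]
  have [measurable]: "\<phi> \<in> borel_measurable borel" by (rule borel_measurable_antimono_ennreal) fact
  define \<Psi> where "\<Psi> = (\<integral>\<^sup>+t. ennreal (q * t powr (q - 1)) * indicator {0<..} t * \<psi> t \<partial>lborel)"
  define k where "k t = ennreal (q * t powr (q - 1))" for t
  have [measurable]: "k \<in> borel_measurable borel" unfolding k_def by measurable
  define I where "I T = (\<integral>\<^sup>+t. k t * indicator {t0<..<T} t * \<phi> t \<partial>lborel)" for T
  have I_bound: "I T \<le> ennreal (2 * (A * t0) powr q) * U + ennreal (2 * A powr q * D) * \<Psi>" if "0 < T" for T
  proof -
    have int_le: "(\<integral>\<^sup>+t. k t * indicator {t0<..<T} t * \<phi> t \<partial>lborel) \<le> ennreal (T powr q) * U" if "0 \<le> T" for T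
    proof -
      have "(\<integral>\<^sup>+t. k t * indicator {t0<..<T} t * \<phi> t \<partial>lborel) \<le> (\<integral>\<^sup>+t. U * (k t * indicator {0<..<T} t) \<partial>lborel)"
        using bound \<open>0 \<le> t0\<close> by (intro nn_integral_mono) (auto split: split_indicator simp: mult.commute intro!: mult_right_mono)
      also have "\<dots> = U * (\<integral>\<^sup>+t. k t * indicator {0<..<T} t \<partial>lborel)"
        by (intro nn_integral_cmult) measurable
      also have "(\<integral>\<^sup>+t. k t * indicator {0<..<T} t \<partial>lborel) = ennreal (T powr q)"
        unfolding k_def using \<open>0 < q\<close> that by (intro nn_integral_powr_Ioo) auto
      finally show ?thesis by (simp add: mult.commute)
    qed
    then have fin: "I T < top"
      unfolding I_def using \<open>U < top\<close> that by (intro le_less_trans[OF int_le]) (auto simp: ennreal_mult_less_top)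
    have scale: "ennreal A * k (A * t) = ennreal (A powr q) * k t" if "0 < t" for t
    proof -
      have "A * (q * (A * t) powr (q - 1)) = A powr q * (q * t powr (q - 1))"
        using \<open>1 \<le> A\<close> that powr_add[of A 1 "q - 1"] by (simp add: powr_mult)
      then show ?thesis
        unfolding k_def using \<open>1 \<le> A\<close> \<open>0 < q\<close> by (simp add: ennreal_mult[symmetric])
    qed
    \<comment> \<open>The second piece reaches up to \<open>A * T\<close>, beyond \<open>T\<close>:
      replacing \<open>t\<close> by \<open>A * t\<close> brings it back to the range from
      \<open>t0\<close> to \<open>T\<close>, so the same finite \<open>I T\<close> occurs on both
      sides.\<close>
    have "I T \<le> (\<integral>\<^sup>+t. k t * indicator {t0<..<A * t0} t * \<phi> t + k t * indicator {A * t0<..<A * T} t * \<phi> t \<partial>lborel)"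
      unfolding I_def
    proof (rule nn_integral_mono_AE)
      have TA: "T \<le> A * T" using \<open>1 \<le> A\<close> that mult_right_mono[of 1 A T] by simp
      show "AE t in lborel. k t * indicator {t0<..<T} t * \<phi> t \<le>
          k t * indicator {t0<..<A * t0} t * \<phi> t + k t * indicator {A * t0<..<A * T} t * \<phi> t"
        using AE_lborel_singleton[of "A * t0"] by eventually_elim (use TA in \<open>auto split: split_indicator\<close>)
    qed
    also have "\<dots> = (\<integral>\<^sup>+t. k t * indicator {t0<..<A * t0} t * \<phi> t \<partial>lborel) + (\<integral>\<^sup>+t. k t * indicator {A * t0<..<A * T} t * \<phi> t \<partial>lborel)"
      by (intro nn_integral_add) measurable
    also have "\<dots> \<le> ennreal ((A * t0) powr q) * U + (ennreal (1 / 2) * I T + ennreal (A powr q * D) * \<Psi>)"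
    proof (rule add_mono)
      show "(\<integral>\<^sup>+t. k t * indicator {t0<..<A * t0} t * \<phi> t \<partial>lborel) \<le> ennreal ((A * t0) powr q) * U"
        using \<open>1 \<le> A\<close> \<open>0 \<le> t0\<close> by (intro int_le) auto
      have "(\<integral>\<^sup>+t. k t * indicator {A * t0<..<A * T} t * \<phi> t \<partial>lborel)
          = ennreal A * (\<integral>\<^sup>+t. k (A * t) * indicator {A * t0<..<A * T} (A * t) * \<phi> (A * t) \<partial>lborel)"
        using \<open>1 \<le> A\<close> by (subst nn_integral_real_affine[where c = A and t = 0]) auto
      also have "\<dots> = (\<integral>\<^sup>+t. ennreal A * (k (A * t) * indicator {A * t0<..<A * T} (A * t) * \<phi> (A * t)) \<partial>lborel)"
        by (intro nn_integral_cmult[symmetric]) measurable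
      also have "\<dots> \<le> (\<integral>\<^sup>+t. ennreal (A powr q * \<delta>) * (k t * indicator {t0<..<T} t * \<phi> t) + ennreal (A powr q * D) * (k t * indicator {0<..} t * \<psi> t) \<partial>lborel)"
      proof (intro nn_integral_mono)
        fix t
        show "ennreal A * (k (A * t) * indicator {A * t0<..<A * T} (A * t) * \<phi> (A * t))
          \<le> ennreal (A powr q * \<delta>) * (k t * indicator {t0<..<T} t * \<phi> t) + ennreal (A powr q * D) * (k t * indicator {0<..} t * \<psi> t)"
        proof (cases "t0 < t \<and> t < T")
          case True
          then have t: "t0 < t" "0 < t" using \<open>0 \<le> t0\<close> by auto
          have "ennreal A * (k (A * t) * indicator {A * t0<..<A * T} (A * t) * \<phi> (A * t)) \<le> (ennreal A * k (A * t)) * \<phi> (A * t)"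
            by (auto split: split_indicator simp: mult.assoc)
          also have "\<dots> = ennreal (A powr q) * k t * \<phi> (A * t)"
            using scale[OF t(2)] by simp
          also have "\<dots> \<le> ennreal (A powr q) * k t * (ennreal \<delta> * \<phi> t + ennreal D * \<psi> t)"
            by (intro mult_left_mono gl t) auto
          also have "\<dots> = ennreal (A powr q * \<delta>) * (k t * indicator {t0<..<T} t * \<phi> t) + ennreal (A powr q * D) * (k t * indicator {0<..} t * \<psi> t)"
            using True t \<open>0 \<le> \<delta>\<close> \<open>0 \<le> D\<close> by (simp add: ennreal_mult distrib_left mult_ac)
          finally show ?thesis .
        next
          case False
          then have "indicator {A * t0<..<A * T} (A * t) = (0 :: ennreal)"
            using \<open>1 \<le> A\<close> by (auto split: split_indicator)
          then show ?thesis by simp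
        qed
      qed
      also have "\<dots> = ennreal (A powr q * \<delta>) * I T + ennreal (A powr q * D) * \<Psi>"
        unfolding I_def \<Psi>_def k_def[symmetric] by (subst nn_integral_add) (auto simp: nn_integral_cmult)
      also have "\<dots> \<le> ennreal (1 / 2) * I T + ennreal (A powr q * D) * \<Psi>"
        using \<delta> by (intro add_right_mono mult_right_mono ennreal_leI) auto
      finally show "(\<integral>\<^sup>+t. k t * indicator {A * t0<..<A * T} t * \<phi> t \<partial>lborel) \<le> ennreal (1 / 2) * I T + ennreal (A powr q * D) * \<Psi>" .
    qed
    finally have "2 * I T \<le> 2 * (ennreal ((A * t0) powr q) * U + (ennreal (1 / 2) * I T + ennreal (A powr q * D) * \<Psi>))"
      by (intro mult_left_mono) auto
    also have "\<dots> = (2 * ennreal (1 / 2)) * I T + (ennreal (2 * (A * t0) powr q) * U + ennreal (2 * A powr q * D) * \<Psi>)"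
    proof -
      have *: "ennreal (2 * x) = 2 * ennreal x" if "0 \<le> x" for x
        using that by (simp add: ennreal_mult)
      have "ennreal (2 * (A * t0) powr q) = 2 * ennreal ((A * t0) powr q)" "ennreal (2 * (A powr q * D)) = 2 * ennreal (A powr q * D)"
        using \<open>0 \<le> D\<close> by (intro *; simp)+
      then show ?thesis
        by (simp only: distrib_left mult.assoc add_ac)
    qed
    also have "2 * ennreal (1 / 2) = 1"
      using ennreal_mult[of 2 "1 / 2"] by simp
    finally have "2 * I T \<le> 1 * I T + (ennreal (2 * (A * t0) powr q) * U + ennreal (2 * A powr q * D) * \<Psi>)" .
    then have "I T + I T \<le> I T + (ennreal (2 * (A * t0) powr q) * U + ennreal (2 * A powr q * D) * \<Psi>)"
      by (simp only: mult_2 mult_1)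
    then show ?thesis
      using fin by (auto simp: ennreal_add_left_cancel_le)
  qed
  \<comment> \<open>The limit of large \<open>T\<close> is taken as continuity from below of this
    measure.\<close>
  define \<nu> where "\<nu> = density lborel (\<lambda>t. k t * \<phi> t)"
  have \<nu>: "emeasure \<nu> X = (\<integral>\<^sup>+t. k t * indicator X t * \<phi> t \<partial>lborel)" if "X \<in> sets borel" for X
    unfolding \<nu>_def using that by (subst emeasure_density) (auto intro!: nn_integral_cong simp: mult_ac)
  have seteq: "{t0<..} = (\<Union>n. {t0<..<real (Suc n)})"
  proof (intro set_eqI iffI)
    fix x assume "x \<in> {t0<..}"
    moreover obtain n where "x < real n" using reals_Archimedean2 by blast
    ultimately have "x \<in> {t0<..<real (Suc n)}" by simp
    then show "x \<in> (\<Union>n. {t0<..<real (Suc n)})" by blast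
  qed auto
  have "(\<integral>\<^sup>+t. ennreal (q * t powr (q - 1)) * indicator {t0<..} t * \<phi> t \<partial>lborel) = emeasure \<nu> {t0<..}"
    by (simp add: \<nu> k_def)
  also have "emeasure \<nu> {t0<..} = (SUP n. emeasure \<nu> {t0<..<real (Suc n)})"
    unfolding seteq
    by (intro SUP_emeasure_incseq[symmetric]) (auto simp: \<nu>_def incseq_def)
  also have "\<dots> \<le> ennreal (2 * (A * t0) powr q) * U + ennreal (2 * A powr q * D) * \<Psi>"
    using I_bound by (intro SUP_least) (simp add: \<nu> I_def)
  finally show ?thesis by (simp add: \<Psi>_def)
qed

context stopping_balls
begin

text \<open>The layer cake of \<open>g\<close> on \<open>ball x0 r0\<close> is cut at
  \<open>t0\<close>. Below it, the trivial bound by the \<open>w\<close>-measure of that ball gives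
  the term with the average of \<open>g\<close>; above it, superlevel sets lie in \<open>E t\<close>
  up to null sets and the integrated good-\<lambda> inequality applies. The maximal function of
  \<open>h\<close> is then removed by its bound on \<open>L^q(w)\<close>.\<close>

lemma weighted_estimate:
  fixes A \<delta> \<gamma> :: real and h :: "'a \<Rightarrow> ennreal"
  assumes [measurable]: "h \<in> borel_measurable lebesgue"
    and gfin: "(\<integral>\<^sup>+z. g z \<partial>lebesgue) < top"
    and "1 \<le> A" "0 < \<gamma>" "0 \<le> \<delta>" and \<delta>: "A powr q * \<delta> \<le> 1 / 2"
    and est: "\<And>t y s z z'. 0 < t \<Longrightarrow> (\<integral>\<^sup>+z. g z \<partial>lebesgue) \<le> ennreal t * vol (ball x0 (\<kappa> * r0)) \<Longrightarrow>
       (y, s) \<in> bad t \<Longrightarrow> z \<in> ball y s \<Longrightarrow>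
       (\<And>y' s'. (y', s') \<in> bad t \<Longrightarrow> z \<in> ball y' s' \<Longrightarrow> s' < 2 * s) \<Longrightarrow>
       z' \<in> ball y s \<Longrightarrow> hl_max lebesgue (5 * r0) h z' \<le> ennreal (\<gamma> / 2 ^ DIM('a) * t) \<Longrightarrow>
       emeasure W (E (A * t) \<inter> ball y (5 * s)) \<le> ennreal \<delta> * emeasure W (ball y s)"
  shows "(\<integral>\<^sup>+x\<in>ball x0 r0. epow (g x) q \<partial>W) \<le>
      ennreal ((1 + 2 * A powr q * Aq_doubling DIM('a) q K) * ((4 / \<kappa>) ^ DIM('a)) powr q) *
        (epow ((\<integral>\<^sup>+z. g z \<partial>lebesgue) / vol (ball x0 (4 * r0))) q * emeasure W (ball x0 r0)) +
      ennreal (2 * A powr q * Aq_doubling DIM('a) q K * ((2 ^ DIM('a) / \<gamma>) powr q * Aq_maximal_const DIM('a) q K)) *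
        (\<integral>\<^sup>+x. epow (h x) q \<partial>W)"
proof -
  note [measurable_cong] = sets_W
  define D where "D = Aq_doubling DIM('a) q K"
  have D: "1 \<le> D" using W.D_ge_1 by (simp add: D_def)
  define G where "G = (\<integral>\<^sup>+z. g z \<partial>lebesgue)"
  define b where "b = vol (ball x0 (4 * r0))"
  have b: "b \<noteq> 0" "b \<noteq> top"
    using emeasure_lebesgue_ball_pos[of "4 * r0" x0] emeasure_lebesgue_ball_finite[of x0 "4 * r0"] r0 by (auto simp: b_def)
  have b\<kappa>: "vol (ball x0 (\<kappa> * r0)) = ennreal ((\<kappa> / 4) ^ DIM('a)) * b"
    unfolding b_def using \<kappa> r0 emeasure_lebesgue_ball_scale[of "\<kappa> / 4" "4 * r0" x0 x0] by simp
  \<comment> \<open>The level beyond which \<open>bad_radius\<close> applies: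
    \<open>(4 / \<kappa>) ^ DIM('a)\<close> is the ratio of the volumes of
    \<open>ball x0 (4 * r0)\<close> and \<open>ball x0 (\<kappa> * r0)\<close>.\<close>
  define t0 where "t0 = (4 / \<kappa>) ^ DIM('a) * enn2real (G / b)"
  have t0: "0 \<le> t0" using \<kappa> by (simp add: t0_def)
  have Gb: "G / b < top"
    using gfin b by (simp add: G_def ennreal_divide_eq_top_iff less_top[symmetric])
  have et0: "ennreal t0 = ennreal ((4 / \<kappa>) ^ DIM('a)) * (G / b)"
    using Gb \<kappa> by (simp add: t0_def ennreal_mult)
  have small: "G \<le> ennreal t * vol (ball x0 (\<kappa> * r0))" if "t0 < t" for t
  proof -
    have "G = G / b * b" using b by (simp add: ennreal_divide_times ennreal_divide_self less_top)
    also have "\<dots> = (ennreal ((4 / \<kappa>) ^ DIM('a)) * ennreal ((\<kappa> / 4) ^ DIM('a))) * (G / b * b)"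
      using \<kappa> by (simp add: ennreal_mult[symmetric] power_mult_distrib[symmetric])
    also have "\<dots> = ennreal t0 * vol (ball x0 (\<kappa> * r0))"
      unfolding b\<kappa> et0 by (simp only: mult_ac)
    also have "\<dots> \<le> ennreal t * vol (ball x0 (\<kappa> * r0))"
      using that by (intro mult_right_mono ennreal_leI) auto
    finally show ?thesis .
  qed
  define k where "k t = ennreal (q * t powr (q - 1))" for t
  have [measurable]: "k \<in> borel_measurable borel" unfolding k_def by measurable
  define \<phi> where "\<phi> t = emeasure W (E t)" for t
  define \<psi> where "\<psi> t = emeasure W {x. ennreal (\<gamma> / 2 ^ DIM('a) * t) < hl_max lebesgue (5 * r0) h x}" for t
  have anti: "antimono \<phi>"
    unfolding \<phi>_def antimono_def using E_mono by (auto intro!: emeasure_mono simp: sets_W)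
  have [measurable]: "\<phi> \<in> borel_measurable borel"
    by (rule borel_measurable_antimono_ennreal[OF anti])
  have "antimono \<psi>"
    unfolding \<psi>_def antimono_def
  proof (intro allI impI emeasure_mono)
    fix t t' :: real assume "t \<le> t'"
    then have "\<gamma> / 2 ^ DIM('a) * t \<le> \<gamma> / 2 ^ DIM('a) * t'"
      using \<open>0 < \<gamma>\<close> by (intro mult_left_mono) auto
    then show "{x. ennreal (\<gamma> / 2 ^ DIM('a) * t') < hl_max lebesgue (5 * r0) h x} \<subseteq> {x. ennreal (\<gamma> / 2 ^ DIM('a) * t) < hl_max lebesgue (5 * r0) h x}"
      by (auto intro: le_less_trans ennreal_leI)
  qed (auto simp: sets_W intro!: lebesgue.open_in_sets lebesgue.open_hl_max)
  then have [measurable]: "\<psi> \<in> borel_measurable borel"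
    by (rule borel_measurable_antimono_ennreal)
  have \<psi>_int: "(\<integral>\<^sup>+t. k t * indicator {0<..} t * \<psi> t \<partial>lborel) \<le>
      ennreal ((2 ^ DIM('a) / \<gamma>) powr q * Aq_maximal_const DIM('a) q K) * (\<integral>\<^sup>+x. epow (h x) q \<partial>W)"
  proof -
    define c where "c = 2 ^ DIM('a) / \<gamma>"
    have c: "0 < c" "\<gamma> / 2 ^ DIM('a) * t = t / c" for t using \<open>0 < \<gamma>\<close> by (auto simp: c_def)
    define M where "M = hl_max lebesgue (5 * r0) h"
    have [measurable]: "M \<in> borel_measurable lebesgue" unfolding M_def by (rule lebesgue.hl_max_measurable)
    then have [measurable]: "M \<in> borel_measurable W" by (simp add: measurable_cong_sets[OF sets_W refl])
    have iff: "ennreal (t / c) < v \<longleftrightarrow> ennreal t < ennreal c * v" if "0 < t" for t v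
      using c that by (cases v) (auto simp: ennreal_less_iff ennreal_mult[symmetric] ennreal_mult_top field_simps)
    have "(\<integral>\<^sup>+t. k t * indicator {0<..} t * \<psi> t \<partial>lborel) =
      (\<integral>\<^sup>+t. k t * indicator {0<..} t * emeasure W {x\<in>space W. ennreal t < ennreal c * M x} \<partial>lborel)"
    proof (intro nn_integral_cong)
      fix t
      have "\<psi> t = emeasure W {x\<in>space W. ennreal t < ennreal c * M x}" if "0 < t"
        unfolding \<psi>_def c(2) iff[OF that] M_def space_W by simp
      then show "k t * indicator {0<..} t * \<psi> t = k t * indicator {0<..} t * emeasure W {x\<in>space W. ennreal t < ennreal c * M x}"
        by (simp split: split_indicator)
    qed
    also have "\<dots> = (\<integral>\<^sup>+x. epow (ennreal c * M x) q \<partial>W)"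
      unfolding k_def using q_gt_1 by (intro layer_cake[symmetric] W.sigma_finite) auto
    also have "\<dots> = (\<integral>\<^sup>+x. ennreal (c powr q) * epow (M x) q \<partial>W)"
      using q_gt_1 c by (simp add: epow_mult epow_ennreal)
    also have "\<dots> = ennreal (c powr q) * (\<integral>\<^sup>+x. epow (M x) q \<partial>W)"
      by (intro nn_integral_cmult) measurable
    also have "\<dots> \<le> ennreal (c powr q) * (ennreal (Aq_maximal_const DIM('a) q K) * (\<integral>\<^sup>+x. epow (h x) q \<partial>W))"
      unfolding M_def by (intro mult_left_mono hl_max_bounded_Lq) auto
    also have "\<dots> = ennreal (c powr q * Aq_maximal_const DIM('a) q K) * (\<integral>\<^sup>+x. epow (h x) q \<partial>W)"
      by (simp add: ennreal_mult' mult.assoc)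
    finally show ?thesis by (simp add: c_def)
  qed
  define U where "U = emeasure W (ball x0 (2 * r0))"
  have gl: "(\<integral>\<^sup>+t. k t * indicator {t0<..} t * \<phi> t \<partial>lborel)
    \<le> ennreal (2 * (A * t0) powr q) * U + ennreal (2 * A powr q * D) * (\<integral>\<^sup>+t. k t * indicator {0<..} t * \<psi> t \<partial>lborel)"
    unfolding k_def
  proof (rule good_lambda_integrate[OF anti])
    show "\<phi> t \<le> U" if "t0 < t" for t
      unfolding \<phi>_def U_def using E_subset[of t] small[OF that] by (intro emeasure_mono) (auto simp: sets_W G_def)
    show "U < top" unfolding U_def by (rule W.ball_finite)
    show "\<phi> (A * t) \<le> ennreal \<delta> * \<phi> t + ennreal D * \<psi> t" if "t0 < t" for t
      unfolding \<phi>_def \<psi>_def D_def using that t0 small[OF that] \<open>1 \<le> A\<close>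
      by (intro good_lambda est) (auto simp: G_def)
  qed (use \<open>1 \<le> A\<close> q_gt_1 t0 \<open>0 \<le> \<delta>\<close> D \<delta> in auto)
  have U_le: "U \<le> ennreal D * emeasure W (ball x0 r0)"
  proof -
    have "U \<le> emeasure W (ball x0 (5 * r0))"
      unfolding U_def using r0 by (intro emeasure_mono subset_ball) (auto simp: sets_W)
    also have "\<dots> \<le> ennreal D * emeasure W (ball x0 r0)"
      unfolding D_def by (intro W_doubling r0)
    finally show ?thesis .
  qed
  define V where "V = emeasure W (ball x0 r0)"
  have "(\<integral>\<^sup>+x\<in>ball x0 r0. epow (g x) q \<partial>W) = (\<integral>\<^sup>+x. epow (g x * indicator (ball x0 r0) x) q \<partial>W)"
    by (intro nn_integral_cong) (auto split: split_indicator)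
  also have "\<dots> = (\<integral>\<^sup>+t. k t * indicator {0<..} t * emeasure W {x\<in>space W. ennreal t < g x * indicator (ball x0 r0) x} \<partial>lborel)"
    unfolding k_def using q_gt_1 by (intro layer_cake W.sigma_finite) auto
  also have "\<dots> \<le> (\<integral>\<^sup>+t. V * (k t * indicator {0<..<t0} t) + k t * indicator {t0<..} t * \<phi> t \<partial>lborel)"
  proof (rule nn_integral_mono_AE)
    have 1: "emeasure W {x\<in>space W. ennreal t < g x * indicator (ball x0 r0) x} \<le> V" for t
      unfolding V_def by (intro emeasure_mono) (auto simp: sets_W split: split_indicator_asm)
    have 2: "emeasure W {x\<in>space W. ennreal t < g x * indicator (ball x0 r0) x} \<le> \<phi> t" for t
      unfolding \<phi>_def
    proof (rule emeasure_mono_AE)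
      have "AE x in lebesgue. x \<in> {x\<in>space W. ennreal t < g x * indicator (ball x0 r0) x} \<longrightarrow> x \<in> E t"
        using AE_in_E[of t] by eventually_elim (auto split: split_indicator_asm)
      then show "AE x in W. x \<in> {x\<in>space W. ennreal t < g x * indicator (ball x0 r0) x} \<longrightarrow> x \<in> E t"
        unfolding W_def by (subst AE_density) auto
    qed (auto simp: sets_W)
    show "AE t in lborel. k t * indicator {0<..} t * emeasure W {x\<in>space W. ennreal t < g x * indicator (ball x0 r0) x} \<le>
      V * (k t * indicator {0<..<t0} t) + k t * indicator {t0<..} t * \<phi> t"
      using AE_lborel_singleton[of t0]
    proof eventually_elim
      case (elim t)
      consider "t \<le> 0" | "0 < t" "t < t0" | "t0 < t" "0 < t" using elim by linarith
      then show ?case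
      proof cases
        case 2
        then show ?thesis using mult_left_mono[OF 1[of t], of "k t"] by (simp add: mult.commute)
      next
        case 3
        then show ?thesis using mult_left_mono[OF 2[of t], of "k t"] by simp
      qed simp
    qed
  qed
  also have "\<dots> = V * (\<integral>\<^sup>+t. k t * indicator {0<..<t0} t \<partial>lborel) + (\<integral>\<^sup>+t. k t * indicator {t0<..} t * \<phi> t \<partial>lborel)"
    by (subst nn_integral_add) (auto simp: nn_integral_cmult)
  also have "(\<integral>\<^sup>+t. k t * indicator {0<..<t0} t \<partial>lborel) = ennreal (t0 powr q)"
    unfolding k_def using q_gt_1 t0 by (intro nn_integral_powr_Ioo) auto
  also have "V * ennreal (t0 powr q) + (\<integral>\<^sup>+t. k t * indicator {t0<..} t * \<phi> t \<partial>lborel)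
    \<le> V * ennreal (t0 powr q) + (ennreal (2 * (A * t0) powr q) * (ennreal D * V) + ennreal (2 * A powr q * D) *
        (ennreal ((2 ^ DIM('a) / \<gamma>) powr q * Aq_maximal_const DIM('a) q K) * (\<integral>\<^sup>+x. epow (h x) q \<partial>W)))"
    using U_le \<psi>_int by (intro add_left_mono order_trans[OF gl] add_mono mult_left_mono) (auto simp: V_def)
  also have "\<dots> = (V * ennreal (t0 powr q) + ennreal (2 * (A * t0) powr q) * (ennreal D * V)) +
      ennreal (2 * A powr q * D * ((2 ^ DIM('a) / \<gamma>) powr q * Aq_maximal_const DIM('a) q K)) * (\<integral>\<^sup>+x. epow (h x) q \<partial>W)"
    using D by (subst (3) ennreal_mult') (simp_all add: add.assoc mult.assoc)
  also have "V * ennreal (t0 powr q) + ennreal (2 * (A * t0) powr q) * (ennreal D * V)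
     = ennreal (t0 powr q + 2 * (A * t0) powr q * D) * V"
    using D by (subst ennreal_plus) (simp_all add: distrib_left distrib_right ennreal_mult mult_ac)
  also have "t0 powr q + 2 * (A * t0) powr q * D = (1 + 2 * A powr q * D) * t0 powr q"
    using \<open>1 \<le> A\<close> t0 by (simp add: powr_mult algebra_simps)
  also have "ennreal ((1 + 2 * A powr q * D) * t0 powr q) = ennreal ((1 + 2 * A powr q * D) * ((4 / \<kappa>) ^ DIM('a)) powr q) * epow (G / b) q"
  proof -
    have "ennreal (t0 powr q) = epow (ennreal ((4 / \<kappa>) ^ DIM('a)) * (G / b)) q"
      using t0 by (simp add: et0[symmetric] epow_ennreal)
    also have "\<dots> = ennreal (((4 / \<kappa>) ^ DIM('a)) powr q) * epow (G / b) q"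
      using q_gt_1 \<kappa> by (simp add: epow_mult epow_ennreal)
    finally show ?thesis
      using D by (simp add: ennreal_mult mult.assoc)
  qed
  finally show ?thesis
    by (simp add: G_def b_def D_def V_def mult.assoc)
qed

end

text \<open>The quantifiers record the dependence of the constants: \<open>a\<close>, which will
  limit \<open>\<eta>0\<close>, comes before \<open>\<gamma>\<close>, which will absorb
  \<open>N1\<close>, and \<open>C\<close> may depend on both; all of them precede the weight and the
  functions.\<close>

lemma weighted_real_variable:
  fixes q q1 K \<kappa> C2 :: real
  assumes "1 < q" "q < q1" "1 \<le> K" "0 < \<kappa>" "\<kappa> \<le> 1 / 700" "0 \<le> C2"
  shows "\<exists>a>0. \<forall>\<gamma>>0. \<exists>C\<ge>0. \<forall>(w :: 'a::euclidean_space \<Rightarrow> real) \<sigma> x0 r0 g h.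
    muckenhoupt w \<sigma> q K \<and> 0 < r0 \<and> g \<in> borel_measurable lebesgue \<and> h \<in> borel_measurable lebesgue \<and>
    (\<integral>\<^sup>+z. g z \<partial>lebesgue) < top \<and>
    local_decomposition (muckenhoupt.W w) q1 \<kappa> C2 a \<gamma> x0 r0 g h
    \<longrightarrow> (\<integral>\<^sup>+x\<in>ball x0 r0. epow (g x) q \<partial>muckenhoupt.W w) \<le>
      ennreal C * (epow ((\<integral>\<^sup>+z. g z \<partial>lebesgue) / vol (ball x0 (4 * r0))) q * emeasure (muckenhoupt.W w) (ball x0 r0)) +
      ennreal C * (\<integral>\<^sup>+x. epow (h x) q \<partial>muckenhoupt.W w)"
proof -
  define d where "d = DIM('a)"
  define D where "D = Aq_doubling d q K"
  define C3 where "C3 = K powr (q1 / q) * maximal_const D (q1 / q)"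
  have D: "1 \<le> D"
  proof -
    have "1 * 1 \<le> K * (5 ^ d) powr q"
      using assms by (intro mult_mono ge_one_powr_ge_zero) auto
    then show ?thesis by (simp add: D_def Aq_doubling_def)
  qed
  have C3: "0 \<le> C3"
    using D assms unfolding C3_def maximal_const_def by (intro mult_nonneg_nonneg divide_nonneg_nonneg) auto
  define X where "X = D\<^sup>2 * (C3 * C2 * (2 ^ (d + 1)) powr q1)"
  have X: "0 \<le> X" using C3 assms by (simp add: X_def)
  \<comment> \<open>\<open>X * A powr (- q1)\<close> is the share of the second function in
    \<open>\<delta>\<close>. As \<open>q < q1\<close>, a large \<open>A\<close> brings
    \<open>X * A powr (q - q1)\<close> down to \<open>1 / 4\<close>; the bound \<open>7 ^ d\<close>
    serves the comparison of stopping balls.\<close>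
  define A where "A = max (7 ^ d) ((4 * X) powr (1 / (q1 - q)))"
  have A7: "7 ^ d \<le> A" by (simp add: A_def)
  then have A1: "1 \<le> A" using one_le_power[of "7::real" d] by linarith
  have AX: "X * A powr (q - q1) \<le> 1 / 4"
  proof -
    have "4 * X = ((4 * X) powr (1 / (q1 - q))) powr (q1 - q)"
      using X assms by (simp add: powr_powr)
    also have "\<dots> \<le> A powr (q1 - q)"
      using assms by (intro powr_mono2) (auto simp: A_def)
    finally have "4 * X * A powr (q - q1) \<le> A powr (q1 - q) * A powr (q - q1)"
      by (intro mult_right_mono) auto
    also have "\<dots> = 1" using A1 by (simp add: powr_add[symmetric])
    finally show ?thesis by simp
  qed
  \<comment> \<open>Makes the first function contribute exactly \<open>1 / 4\<close> to
    \<open>A powr q * \<delta>\<close>, which together with the other quarter permits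
    absorption.\<close>
  define \<epsilon> where "\<epsilon> = A powr (- q) / (4 * D\<^sup>2)"
  have \<epsilon>: "0 < \<epsilon>" using A1 D by (simp add: \<epsilon>_def)
  obtain \<alpha> where \<alpha>: "0 < \<alpha>" "\<And>(w :: 'a \<Rightarrow> real) \<sigma> x r E. muckenhoupt w \<sigma> q K \<Longrightarrow> 0 < r \<Longrightarrow> E \<in> sets lebesgue \<Longrightarrow>
     E \<subseteq> ball x r \<Longrightarrow> vol E \<le> ennreal \<alpha> * vol (ball x r) \<Longrightarrow>
     emeasure (muckenhoupt.W w) E \<le> ennreal \<epsilon> * emeasure (muckenhoupt.W w) (ball x r)"
    using A_infinity[OF \<epsilon> \<open>1 \<le> K\<close>, of q, where 'a = 'a] by metis
  \<comment> \<open>The largest value for which the weak-type bound keeps the set where the maximal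
    function of the first part is large within the volume fraction \<open>\<alpha>\<close>.\<close>
  define a where "a = \<alpha> * A / (5 ^ d * 2 ^ (d + 1))"
  have a: "0 < a" "5 ^ d * 2 ^ (d + 1) * a \<le> \<alpha> * A"
    using \<alpha>(1) A1 by (auto simp: a_def)
  define \<delta> where "\<delta> = D\<^sup>2 * (\<epsilon> + C3 * C2 * (2 ^ (d + 1) / A) powr q1)"
  have \<delta>0: "0 \<le> \<delta>" using \<epsilon> C3 assms by (simp add: \<delta>_def)
  have \<delta>: "A powr q * \<delta> \<le> 1 / 2"
  proof -
    have "A powr q * \<delta> = A powr q * (D\<^sup>2 * \<epsilon>) + X * (A powr q / A powr q1)"
      by (simp add: \<delta>_def X_def powr_divide algebra_simps)
    also have "A powr q / A powr q1 = A powr (q - q1)" using A1 by (simp add: powr_diff)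
    also have "A powr q * (D\<^sup>2 * \<epsilon>) = 1 / 4" using A1 D by (simp add: \<epsilon>_def powr_minus field_simps)
    finally show ?thesis using AX by simp
  qed
  define c1 c2 where "c1 = (1 + 2 * A powr q * D) * ((4 / \<kappa>) ^ d) powr q"
    and "c2 \<gamma> = 2 * A powr q * D * ((2 ^ d / \<gamma>) powr q * Aq_maximal_const d q K)" for \<gamma>
  show ?thesis
  proof (rule exI[of _ a], intro conjI allI impI, goal_cases)
    case 1
    show ?case by (rule a)
  next
    case \<gamma>: (2 \<gamma>)
    define C where "C = max 0 (max c1 (c2 \<gamma>))"
    show ?case
    proof (intro exI[of _ C] conjI allI impI, goal_cases)
      case 1
      show ?case by (simp add: C_def)
    next
      case (2 w \<sigma> x0 r0 g h)
      then interpret muckenhoupt w \<sigma> q K by simp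
      interpret stopping_balls w \<sigma> q K x0 r0 \<kappa> g
        using 2 assms by unfold_locales auto
      have "(\<integral>\<^sup>+x\<in>ball x0 r0. epow (g x) q \<partial>W) \<le>
        ennreal c1 * (epow ((\<integral>\<^sup>+z. g z \<partial>lebesgue) / vol (ball x0 (4 * r0))) q * emeasure W (ball x0 r0)) +
        ennreal (c2 \<gamma>) * (\<integral>\<^sup>+x. epow (h x) q \<partial>W)"
        unfolding c1_def c2_def D_def d_def
      proof (rule weighted_estimate)
        fix t y s z z'
        assume *: "0 < t" "(\<integral>\<^sup>+z. g z \<partial>lebesgue) \<le> ennreal t * vol (ball x0 (\<kappa> * r0))"
          "(y, s) \<in> bad t" "z \<in> ball y s"
          "\<And>y' s'. (y', s') \<in> bad t \<Longrightarrow> z \<in> ball y' s' \<Longrightarrow> s' < 2 * s"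
          "z' \<in> ball y s" "hl_max lebesgue (5 * r0) h z' \<le> ennreal (\<gamma> / 2 ^ DIM('a) * t)"
        show "emeasure W (E (A * t) \<inter> ball y (5 * s)) \<le> ennreal \<delta> * emeasure W (ball y s)"
          unfolding \<delta>_def C3_def D_def d_def
        proof (rule stopping_ball_estimate[OF *(1,2) assms(2,6) \<gamma> _ _ _ _ _ _ *(3-7)])
          show "7 ^ DIM('a) \<le> A" "0 \<le> a" "5 ^ DIM('a) * 2 ^ (DIM('a) + 1) * a \<le> \<alpha> * A" "0 \<le> \<epsilon>"
            using A7 a \<epsilon> by (auto simp: d_def)
          show "emeasure W E \<le> ennreal \<epsilon> * emeasure W (ball x r)"
            if "0 < r" "E \<in> sets lebesgue" "E \<subseteq> ball x r" "vol E \<le> ennreal \<alpha> * vol (ball x r)" for x r E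
            by (rule \<alpha>(2)[OF muckenhoupt_axioms that])
        qed (use 2 in blast)
      qed (use 2 A1 \<gamma> \<delta>0 \<delta> in auto)
      also have "\<dots> \<le> ennreal C * (epow ((\<integral>\<^sup>+z. g z \<partial>lebesgue) / vol (ball x0 (4 * r0))) q * emeasure W (ball x0 r0)) +
        ennreal C * (\<integral>\<^sup>+x. epow (h x) q \<partial>W)"
        by (intro add_mono mult_right_mono ennreal_leI) (auto simp: C_def)
      finally show ?case .
    qed
  qed
qed

section \<open>Proof of the theorem\<close>

lemma AE_lebesgue_all_balls:
  assumes "\<And>n::nat. AE x in lebesgue. x \<in> ball (0::'a::euclidean_space) (real n) \<longrightarrow> P x"
  shows "AE x in lebesgue. P x"
proof -
  have "AE x in lebesgue. \<forall>n::nat. x \<in> ball (0::'a) (real n) \<longrightarrow> P x"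
    by (subst AE_all_countable) (use assms in blast)
  then show ?thesis
  proof eventually_elim
    case (elim x)
    obtain n :: nat where "norm x < real n" using reals_Archimedean2 by blast
    then show ?case using elim by auto
  qed
qed

lemma Aq_weight_ball_finite:
  assumes "Aq_weight q w"
  shows "(\<integral>\<^sup>+y\<in>ball x r. ennreal (w y) \<partial>lebesgue) < top"
proof -
  have "set_integrable lebesgue (cball x r) w"
    using assms by (simp add: Aq_weight_def)
  then have "(\<integral>\<^sup>+y. ennreal (norm (indicator (cball x r) y *\<^sub>R w y)) \<partial>lebesgue) < \<infinity>"
    unfolding set_integrable_def integrable_iff_bounded by simp
  moreover have "(\<integral>\<^sup>+y\<in>ball x r. ennreal (w y) \<partial>lebesgue) \<le> (\<integral>\<^sup>+y. ennreal (norm (indicator (cball x r) y *\<^sub>R w y)) \<partial>lebesgue)"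
    by (intro nn_integral_mono) (auto split: split_indicator intro!: ennreal_leI)
  ultimately show ?thesis by (simp add: le_less_trans)
qed

text \<open>A nonzero \<open>A\<^sub>q\<close> weight is positive almost everywhere, because the average of \<open>w\<^sup>-\<^sup>1\<^sup>/\<^sup>(\<^sup>q\<^sup>-\<^sup>1\<^sup>)\<close> is then
  finite on every ball (with \<open>0 \<cdot> \<infinity> = 0\<close>, the zero weight itself satisfies the \<open>A\<^sub>q\<close> inequality).\<close>

lemma Aq_weight_muckenhoupt:
  fixes w :: "'a::euclidean_space \<Rightarrow> real"
  assumes w: "Aq_weight q w" and K: "Aq_const q w = K" and nz: "\<not> (AE x in lebesgue. w x = 0)"
  obtains w' where "AE x in lebesgue. w x = w' x" "muckenhoupt w' (\<lambda>x. w' x powr (- 1 / (q - 1))) q (\<bar>K\<bar> + 1)"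
proof -
  have q: "1 < q" and w0: "\<And>x. 0 \<le> w x" and [measurable]: "w \<in> borel_measurable lebesgue"
    using w by (auto simp: Aq_weight_def)
  define v where "v y = epow (inverse (ennreal (w y))) (1 / (q - 1))" for y
  have [measurable]: "v \<in> borel_measurable lebesgue" unfolding v_def by measurable
  have "{C. Aq_ineq q w C} \<noteq> {}" using w by (auto simp: Aq_weight_def)
  \<comment> \<open>Some admissible constant lies below \<open>\<bar>K\<bar> + 1\<close>, so
    attainment of the infimum \<open>K\<close> is no issue; this number is also visibly at least
    1.\<close>
  moreover have "Inf {C. Aq_ineq q w C} < \<bar>K\<bar> + 1" using K by (simp add: Aq_const_def)
  ultimately obtain C where C: "Aq_ineq q w C" "C < \<bar>K\<bar> + 1"
    using cInf_lessD[of "{C. Aq_ineq q w C}" "\<bar>K\<bar> + 1"] by auto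
  define I where "I x r = (\<integral>\<^sup>+y\<in>ball x r. ennreal (w y) \<partial>lebesgue)" for x r
  define J where "J x r = lint (ball x r) v" for x r
  have ineq: "I x r / vol (ball x r) * epow (J x r / vol (ball x r)) (q - 1) \<le> ennreal (\<bar>K\<bar> + 1)"
    if "0 < r" for x r
  proof -
    have "I x r / vol (ball x r) * epow (J x r / vol (ball x r)) (q - 1) \<le> ennreal C"
      using C(1) that by (simp add: Aq_ineq_def avg_def I_def J_def v_def)
    also have "\<dots> \<le> ennreal (\<bar>K\<bar> + 1)" using C(2) by (intro ennreal_leI) auto
    finally show ?thesis .
  qed
  obtain n :: nat where n: "I 0 (real n) \<noteq> 0"
  proof (rule ccontr)
    assume "\<not> thesis"
    then have I0: "I 0 (real n) = 0" for n using that by blast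
    have "AE x in lebesgue. w x = 0"
    proof (rule AE_lebesgue_all_balls)
      fix n
      have "AE x in lebesgue. ennreal (w x) * indicator (ball 0 (real n)) x = 0"
        using I0[of n] unfolding I_def by (subst (asm) nn_integral_0_iff_AE) auto
      then show "AE x in lebesgue. x \<in> ball 0 (real n) \<longrightarrow> w x = 0"
        by eventually_elim (use w0 in \<open>auto simp: ennreal_eq_0_iff intro: antisym\<close>)
    qed
    then show False using nz by simp
  qed
  \<comment> \<open>On a ball that also contains \<open>ball 0 (real n)\<close> the average of
    \<open>w\<close> is nonzero, so the \<open>A_q\<close> inequality there excludes an infinite
    integral of \<open>v\<close>.\<close>
  have Jfin: "J x r < top" for x r
  proof -
    define R where "R = max 1 (max (real n) (norm x + r))"
    have R: "0 < R" "ball 0 (real n) \<subseteq> ball (0::'a) R" "ball x r \<subseteq> ball 0 R"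
      by (auto simp: R_def ball_subset_ball_iff)
    have b: "vol (ball (0::'a) R) \<noteq> 0" "vol (ball (0::'a) R) \<noteq> top"
      using emeasure_lebesgue_ball_pos[OF R(1), of "0::'a"] emeasure_lebesgue_ball_finite[of "0::'a" R] by auto
    have "I 0 (real n) \<le> I 0 R"
      unfolding I_def using R by (intro nn_integral_mono) (auto split: split_indicator)
    then have "I 0 R \<noteq> 0" using n by auto
    then have Ib: "I 0 R / vol (ball (0::'a) R) \<noteq> 0" using b by simp
    have "J 0 R \<noteq> top"
    proof
      assume "J 0 R = top"
      then have "epow (J 0 R / vol (ball (0::'a) R)) (q - 1) = top"
        using b by (simp add: ennreal_top_divide)
      then have "I 0 R / vol (ball (0::'a) R) * epow (J 0 R / vol (ball (0::'a) R)) (q - 1) = top"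
        using Ib by (simp only: ennreal_mult_top) simp
      then show False using ineq[OF R(1), of 0] by (simp add: top_unique)
    qed
    moreover have "J x r \<le> J 0 R"
      unfolding J_def using R by (intro nn_integral_mono) (auto split: split_indicator)
    ultimately show ?thesis by (simp add: less_top le_less_trans)
  qed
  define w' where "w' x = (if 0 < w x then w x else 1)" for x
  define \<sigma> where "\<sigma> x = w' x powr (- 1 / (q - 1))" for x
  have w'_pos: "0 < w' x" for x by (simp add: w'_def)
  have [measurable]: "w' \<in> borel_measurable lebesgue" unfolding w'_def by measurable
  have pos: "AE x in lebesgue. 0 < w x"
  proof (rule AE_lebesgue_all_balls)
    fix n
    have "AE x in lebesgue. v x * indicator (ball 0 (real n)) x \<noteq> \<infinity>"
      using Jfin[of 0 "real n"] by (intro nn_integral_PInf_AE) (auto simp: J_def)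
    then show "AE x in lebesgue. x \<in> ball 0 (real n) \<longrightarrow> 0 < w x"
    proof eventually_elim
      case (elim x)
      show ?case
      proof
        assume "x \<in> ball 0 (real n)"
        then have "v x \<noteq> top" using elim by simp
        then have "w x \<noteq> 0" by (auto simp: v_def)
        then show "0 < w x" using w0[of x] by simp
      qed
    qed
  qed
  then have ae: "AE x in lebesgue. w x = w' x"
    by eventually_elim (simp add: w'_def)
  have \<sigma>v: "AE x in lebesgue. v x = ennreal (\<sigma> x)"
    using pos by eventually_elim
      (simp add: v_def \<sigma>_def w'_def inverse_ennreal epow_ennreal powr_minus[symmetric] inverse_powr)
  have [measurable]: "\<sigma> \<in> borel_measurable lebesgue" unfolding \<sigma>_def by measurable
  have W: "emeasure (density lebesgue (\<lambda>x. ennreal (w' x))) (ball x r) = I x r" for x r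
  proof -
    have "emeasure (density lebesgue (\<lambda>x. ennreal (w' x))) (ball x r) = (\<integral>\<^sup>+y\<in>ball x r. ennreal (w' y) \<partial>lebesgue)"
      by (subst emeasure_density) auto
    also have "\<dots> = I x r"
      unfolding I_def by (rule nn_integral_cong_AE) (use ae in \<open>eventually_elim, simp\<close>)
    finally show ?thesis .
  qed
  have S: "emeasure (density lebesgue (\<lambda>x. ennreal (\<sigma> x))) (ball x r) = J x r" for x r
  proof -
    have "emeasure (density lebesgue (\<lambda>x. ennreal (\<sigma> x))) (ball x r) = (\<integral>\<^sup>+y\<in>ball x r. ennreal (\<sigma> y) \<partial>lebesgue)"
      by (subst emeasure_density) auto
    also have "\<dots> = J x r"
      unfolding J_def by (rule nn_integral_cong_AE) (use \<sigma>v in \<open>eventually_elim, simp\<close>)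
    finally show ?thesis .
  qed
  have "muckenhoupt w' \<sigma> q (\<bar>K\<bar> + 1)"
  proof (unfold_locales, goal_cases)
    case (8 r x)
    define b where "b = vol (ball x r)"
    have b: "b \<noteq> 0" "b < top"
      using emeasure_lebesgue_ball_pos[OF 8, of x] emeasure_lebesgue_ball_finite[of x r] by (auto simp: b_def)
    have e: "X = X / b * b" for X
      using b by (simp add: ennreal_divide_times ennreal_divide_self)
    have "I x r * epow (J x r) (q - 1) = (I x r / b * b) * epow (J x r / b * b) (q - 1)"
      using e by metis
    also have "\<dots> = (I x r / b * epow (J x r / b) (q - 1)) * (b * epow b (q - 1))"
      using q by (simp add: epow_mult mult_ac)
    also have "b * epow b (q - 1) = epow b q"
      using epow_add[of 1 "q - 1" b] q by simp
    also have "(I x r / b * epow (J x r / b) (q - 1)) * epow b q \<le> ennreal (\<bar>K\<bar> + 1) * epow b q"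
      unfolding b_def by (intro mult_right_mono ineq 8) auto
    finally show ?case by (simp only: W S b_def)
  qed (use q w'_pos Jfin Aq_weight_ball_finite[OF w] in \<open>auto simp: W S I_def, simp add: \<sigma>_def\<close>)
  then show thesis
    using that ae by (simp add: \<sigma>_def[abs_def])
qed

section \<open>From averages of \<open>F\<close> and \<open>f\<close> to the local
  decomposition\<close>

lemma avg_mult_ball:
  "0 < r \<Longrightarrow> avg (ball (x::'a::euclidean_space) r) u * vol (ball x r) = lint (ball x r) u"
  using emeasure_lebesgue_ball_pos[of r x] emeasure_lebesgue_ball_finite[of x r]
  by (simp add: avg_def ennreal_divide_times ennreal_divide_self)

lemma avg_le_ball:
  assumes "0 < r" "lint (ball x r) u \<le> c * vol (ball (x::'a::euclidean_space) r)"
  shows "avg (ball x r) u \<le> c"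
  unfolding avg_def using assms emeasure_lebesgue_ball_pos[of r x] by (intro divide_le_posI_ennreal) (simp_all add: mult.commute)

lemma epow_powr_cancel: "0 < a \<Longrightarrow> epow x (1 / a) \<le> ennreal y \<Longrightarrow> 0 \<le> y \<Longrightarrow> x \<le> ennreal (y powr a)"
  using epow_mono[of a "epow x (1 / a)" "ennreal y"] by (simp add: epow_epow epow_ennreal)

definition approximable ::
  "real \<Rightarrow> real \<Rightarrow> real \<Rightarrow> real \<Rightarrow> real \<Rightarrow> real \<Rightarrow> ('a::euclidean_space \<Rightarrow> real) \<Rightarrow> 'a \<Rightarrow> real \<Rightarrow>
    ('a \<Rightarrow> real) \<Rightarrow> ('a \<Rightarrow> real) \<Rightarrow> bool" where
  "approximable p0 p1 c1 N1 N2 \<eta> w x0 r0 F f \<longleftrightarrow>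
      (\<forall>x r. r > 0 \<and> ball x r \<subseteq> ball x0 (2 * r0) \<and>
             measure lebesgue (ball x r) \<le> c1 * measure lebesgue (ball x0 r0) \<longrightarrow>
         (\<exists>FB RB :: 'a \<Rightarrow> real.
            FB \<in> borel_measurable lebesgue \<and> RB \<in> borel_measurable lebesgue \<and>
            (\<forall>y\<in>ball x (2 * r). \<bar>F y\<bar> \<le> \<bar>FB y\<bar> + \<bar>RB y\<bar>) \<and>
            epow (avg (ball x (2 * r)) (\<lambda>y. ennreal (\<bar>FB y\<bar> powr p0))) (1 / p0)
              \<le> ennreal N1 *
                  (SUP (y, s) \<in> {(y, s). s > 0 \<and> ball x r \<subseteq> ball y s \<and> ball y s \<subseteq> ball x0 (4 * r0)}.
                     epow (avg (ball y s) (\<lambda>z. ennreal (\<bar>f z\<bar> powr p0))) (1 / p0))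
                + ennreal \<eta> * epow (avg (ball x (100 * r)) (\<lambda>y. ennreal (\<bar>F y\<bar> powr p0))) (1 / p0) \<and>
            epow (avg (ball x (2 * r)) (\<lambda>y. ennreal (\<bar>RB y\<bar> powr p1 * w y))) (1 / p1)
              \<le> ennreal N2 *
                  (epow (avg (ball x (100 * r)) (\<lambda>y. ennreal (\<bar>F y\<bar> powr p0))) (1 / p0)
                   + (SUP (y, s) \<in> {(y, s). s > 0 \<and> ball x r \<subseteq> ball y s \<and> ball y s \<subseteq> ball x0 (4 * r0)}.
                       epow (avg (ball y s) (\<lambda>z. ennreal (\<bar>f z\<bar> powr p0))) (1 / p0)))
                * epow (avg (ball x r) (\<lambda>y. ennreal (w y))) (1 / p1)))"

text \<open>With \<open>L = \<Lambda> powr (1 / p0)\<close>, the average of \<open>F\<close> and the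
  supremum over \<open>f\<close> become multiples of \<open>L\<close>. The choice of
  \<open>\<gamma>\<close> turns \<open>N1\<close> times the supremum into at most
  \<open>\<eta>0 * L\<close>, so the first function is governed by \<open>\<eta>0\<close> alone. In
  \<open>(4 * N2) powr p1\<close>, one factor 2 comes from splitting the power of a sum, the other
  from adding two terms of size at most \<open>L\<close>; \<open>2 ^ DIM('a)\<close> is for passing
  from the doubled ball to the ball.\<close>

lemma local_decomposition_of_approximable:
  fixes w w' :: "'a::euclidean_space \<Rightarrow> real"
  assumes p: "0 < p0" "p0 < p1" and c1: "0 < c1" "c1 < 1" and N: "1 < N1" "1 < N2" and \<eta>: "0 \<le> \<eta>" "\<eta> \<le> \<eta>0"
    and r0: "0 < r0" and [measurable]: "w \<in> borel_measurable lebesgue" and w0: "\<And>x. 0 \<le> w x"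
    and [measurable]: "F \<in> borel_measurable lebesgue" "f \<in> borel_measurable lebesgue"
    and ae: "AE x in lebesgue. w x = w' x" and muck: "muckenhoupt w' \<sigma> q K"
    and \<eta>0: "0 < \<eta>0" "2 powr p0 * 2 ^ DIM('a) * (2 * \<eta>0) powr p0 \<le> a"
    and \<gamma>: "0 < \<gamma>" "N1 * \<gamma> powr (1 / p0) = \<eta>0" "\<gamma> powr (1 / p0) \<le> 1"
    and approx: "approximable p0 p1 c1 N1 N2 \<eta> w x0 r0 F f"
  shows "local_decomposition (muckenhoupt.W w') (p1 / p0) (c1 / 1400) (2 ^ DIM('a) * (4 * N2) powr p1) a \<gamma> x0 r0
    (\<lambda>y. ennreal (\<bar>F y\<bar> powr p0) * indicator (ball x0 (4 * r0)) y) (\<lambda>y. ennreal (\<bar>f y\<bar> powr p0) * indicator (ball x0 (4 * r0)) y)"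
    (is "local_decomposition _ _ _ _ _ _ _ _ ?g ?h")
  unfolding local_decomposition_def
proof (intro allI impI, elim conjE)
  fix x :: 'a and r \<Lambda> :: real
  assume r: "0 < r" and sub: "ball x r \<subseteq> ball x0 (2 * r0)" and small: "r \<le> 14 * (c1 / 1400) * r0" and \<Lambda>: "0 < \<Lambda>"
    and g: "lint (ball x (100 * r)) ?g \<le> ennreal \<Lambda> * vol (ball x (100 * r))"
    and h: "\<forall>y s. 0 < s \<and> ball x r \<subseteq> ball y s \<and> ball y s \<subseteq> ball x0 (4 * r0) \<longrightarrow>
         (lint (ball y s) ?h) \<le> ennreal (\<gamma> * \<Lambda>) * vol (ball y s)"
  interpret muckenhoupt w' \<sigma> q K by (rule muck)
  have p1: "0 < p1" using p by simp
  note int_W = nn_integral_W_AE_eq[OF ae]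
  define L where "L = \<Lambda> powr (1 / p0)"
  have L: "0 < L" "L powr p0 = \<Lambda>" "L powr p1 = \<Lambda> powr (p1 / p0)"
    using \<Lambda> p by (auto simp: L_def powr_powr)
  \<comment> \<open>Since \<open>14 * (c1 / 1400) = c1 / 100\<close>, the radius
    \<open>100 * r\<close> is at most \<open>r0\<close>, while the centre lies in
    \<open>ball x0 (2 * r0)\<close>.\<close>
  have 100: "ball x (100 * r) \<subseteq> ball x0 (4 * r0)"
  proof -
    have "dist x x0 + r \<le> 2 * r0" using sub r by (simp add: ball_subset_ball_iff)
    moreover have "100 * r \<le> 1 * r0" using small c1 r0 by (intro order_trans[OF _ mult_right_mono[of c1 1 r0]]) auto
    ultimately show ?thesis using r r0 by (simp add: ball_subset_ball_iff)
  qed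
  have meas: "measure lebesgue (ball x r) \<le> c1 * measure lebesgue (ball x0 r0)"
  proof -
    have "r ^ DIM('a) \<le> (c1 / 100 * r0) ^ DIM('a)"
      using small r by (intro power_mono) auto
    also have "\<dots> = (c1 / 100) ^ DIM('a) * r0 ^ DIM('a)" by (rule power_mult_distrib)
    also have "\<dots> \<le> (c1 / 100) ^ 1 * r0 ^ DIM('a)"
      using c1 r0 DIM_positive[where 'a = 'a] by (intro mult_right_mono power_decreasing) auto
    also have "\<dots> \<le> c1 * r0 ^ DIM('a)"
      using c1 r0 by (intro mult_right_mono) auto
    finally have "unit_ball_vol DIM('a) * r ^ DIM('a) \<le> unit_ball_vol DIM('a) * (c1 * r0 ^ DIM('a))"
      by (intro mult_left_mono) auto
    then show ?thesis using r r0 by (simp add: content_ball mult_ac)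
  qed
  define S where "S = (SUP (y, s) \<in> {(y, s). s > 0 \<and> ball x r \<subseteq> ball y s \<and> ball y s \<subseteq> ball x0 (4 * r0)}.
                     epow (avg (ball y s) (\<lambda>z. ennreal (\<bar>f z\<bar> powr p0))) (1 / p0))"
  define G where "G = epow (avg (ball x (100 * r)) (\<lambda>y. ennreal (\<bar>F y\<bar> powr p0))) (1 / p0)"
  obtain FB RB where [measurable]: "FB \<in> borel_measurable lebesgue" "RB \<in> borel_measurable lebesgue"
    and FR: "\<And>y. y \<in> ball x (2 * r) \<Longrightarrow> \<bar>F y\<bar> \<le> \<bar>FB y\<bar> + \<bar>RB y\<bar>"
    and FB: "epow (avg (ball x (2 * r)) (\<lambda>y. ennreal (\<bar>FB y\<bar> powr p0))) (1 / p0) \<le> ennreal N1 * S + ennreal \<eta> * G"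
    and RB: "epow (avg (ball x (2 * r)) (\<lambda>y. ennreal (\<bar>RB y\<bar> powr p1 * w y))) (1 / p1)
              \<le> ennreal N2 * (G + S) * epow (avg (ball x r) (\<lambda>y. ennreal (w y))) (1 / p1)"
    using approx[unfolded approximable_def, rule_format, of r x] r sub meas unfolding S_def G_def by blast
  have GL: "G \<le> ennreal L"
  proof -
    have "(\<integral>\<^sup>+z\<in>ball x (100 * r). ennreal (\<bar>F z\<bar> powr p0) \<partial>lebesgue) = lint (ball x (100 * r)) ?g"
      using 100 by (intro nn_integral_cong) (auto split: split_indicator)
    then have "avg (ball x (100 * r)) (\<lambda>y. ennreal (\<bar>F y\<bar> powr p0)) \<le> ennreal \<Lambda>"
      using g r by (intro avg_le_ball) auto
    then have "G \<le> epow (ennreal \<Lambda>) (1 / p0)" unfolding G_def using p by simp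
    then show ?thesis using \<Lambda> by (simp add: epow_ennreal L_def)
  qed
  have SL: "S \<le> ennreal (\<gamma> powr (1 / p0) * L)"
    unfolding S_def
  proof (rule SUP_least, clarify)
    fix y s assume ys: "0 < s" "ball x r \<subseteq> ball y s" "ball y s \<subseteq> ball x0 (4 * r0)"
    have "(\<integral>\<^sup>+z\<in>ball y s. ennreal (\<bar>f z\<bar> powr p0) \<partial>lebesgue) = lint (ball y s) ?h"
      using ys by (intro nn_integral_cong) (auto split: split_indicator)
    then have "avg (ball y s) (\<lambda>z. ennreal (\<bar>f z\<bar> powr p0)) \<le> ennreal (\<gamma> * \<Lambda>)"
      using h ys by (intro avg_le_ball) auto
    then have "epow (avg (ball y s) (\<lambda>z. ennreal (\<bar>f z\<bar> powr p0))) (1 / p0) \<le> epow (ennreal (\<gamma> * \<Lambda>)) (1 / p0)"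
      using p by simp
    then show "epow (avg (ball y s) (\<lambda>z. ennreal (\<bar>f z\<bar> powr p0))) (1 / p0) \<le> ennreal (\<gamma> powr (1 / p0) * L)"
      using \<Lambda> \<gamma> by (simp add: epow_ennreal L_def powr_mult)
  qed
  have b2: "vol (ball x (2 * r)) = ennreal (2 ^ DIM('a)) * vol (ball x r)"
    using r by (intro emeasure_lebesgue_ball_scale) auto
  have sub2: "y \<in> ball x (2 * r)" if "y \<in> ball x r" for y using that r by auto
  define u where "u y = ennreal (2 powr p0) * ennreal (\<bar>FB y\<bar> powr p0)" for y
  define v where "v y = ennreal (2 powr p0) * ennreal (\<bar>RB y\<bar> powr p0)" for y
  have [measurable]: "u \<in> borel_measurable lebesgue" "v \<in> borel_measurable lebesgue"
    unfolding u_def v_def by measurable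
  show "\<exists>u v. u \<in> borel_measurable lebesgue \<and> v \<in> borel_measurable lebesgue \<and> (\<forall>y\<in>ball x r. ?g y \<le> u y + v y) \<and>
        (lint (ball x r) u) \<le> ennreal (a * \<Lambda>) * vol (ball x r) \<and>
        (\<integral>\<^sup>+z\<in>ball x r. epow (v z) (p1 / p0) \<partial>W) \<le> ennreal (2 ^ DIM('a) * (4 * N2) powr p1 * \<Lambda> powr (p1 / p0)) * emeasure W (ball x r)"
  proof (rule exI[of _ u], rule exI[of _ v], intro conjI ballI)
    fix y assume y: "y \<in> ball x r"
    have "?g y \<le> ennreal (\<bar>F y\<bar> powr p0)" by (auto split: split_indicator)
    also have "\<dots> \<le> ennreal ((\<bar>FB y\<bar> + \<bar>RB y\<bar>) powr p0)"
      using FR[OF sub2[OF y]] p by (intro ennreal_leI powr_mono2) auto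
    also have "\<dots> = epow (ennreal \<bar>FB y\<bar> + ennreal \<bar>RB y\<bar>) p0"
      by (simp add: epow_ennreal ennreal_plus[symmetric] del: ennreal_plus)
    also have "\<dots> \<le> ennreal (2 powr p0) * (epow (ennreal \<bar>FB y\<bar>) p0 + epow (ennreal \<bar>RB y\<bar>) p0)"
      using p by (intro epow_add_le)
    finally show "?g y \<le> u y + v y"
      by (simp add: u_def v_def epow_ennreal distrib_left)
  next
    have "epow (avg (ball x (2 * r)) (\<lambda>y. ennreal (\<bar>FB y\<bar> powr p0))) (1 / p0) \<le> ennreal N1 * ennreal (\<gamma> powr (1 / p0) * L) + ennreal \<eta>0 * ennreal L"
      using SL GL \<eta> by (intro order_trans[OF FB] add_mono mult_mono ennreal_leI) auto
    also have "\<dots> = ennreal (N1 * \<gamma> powr (1 / p0) * L + \<eta>0 * L)"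
      using N \<eta>0 L by (simp add: ennreal_mult ennreal_plus mult.assoc)
    also have "N1 * \<gamma> powr (1 / p0) * L + \<eta>0 * L = 2 * \<eta>0 * L"
      unfolding \<gamma>(2) by simp
    finally have "avg (ball x (2 * r)) (\<lambda>y. ennreal (\<bar>FB y\<bar> powr p0)) \<le> ennreal ((2 * \<eta>0 * L) powr p0)"
      using p \<eta>0 L by (intro epow_powr_cancel) auto
    also have "(2 * \<eta>0 * L) powr p0 = (2 * \<eta>0) powr p0 * \<Lambda>"
      using \<eta>0 L by (simp add: powr_mult)
    finally have avgF: "avg (ball x (2 * r)) (\<lambda>y. ennreal (\<bar>FB y\<bar> powr p0)) \<le> ennreal ((2 * \<eta>0) powr p0 * \<Lambda>)" .
    have "lint (ball x r) u \<le> (\<integral>\<^sup>+z. ennreal (2 powr p0) * (ennreal (\<bar>FB z\<bar> powr p0) * indicator (ball x (2 * r)) z) \<partial>lebesgue)"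
      using sub2 by (intro nn_integral_mono) (auto simp: u_def split: split_indicator)
    also have "\<dots> = ennreal (2 powr p0) * (\<integral>\<^sup>+z\<in>ball x (2 * r). ennreal (\<bar>FB z\<bar> powr p0) \<partial>lebesgue)"
      by (intro nn_integral_cmult) measurable
    also have "\<dots> = ennreal (2 powr p0) * (avg (ball x (2 * r)) (\<lambda>y. ennreal (\<bar>FB y\<bar> powr p0)) * vol (ball x (2 * r)))"
      using r by (subst avg_mult_ball) auto
    also have "\<dots> \<le> ennreal (2 powr p0) * (ennreal ((2 * \<eta>0) powr p0 * \<Lambda>) * vol (ball x (2 * r)))"
      by (intro mult_left_mono mult_right_mono avgF) auto
    also have "\<dots> = ennreal (2 powr p0 * 2 ^ DIM('a) * (2 * \<eta>0) powr p0 * \<Lambda>) * vol (ball x r)"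
      unfolding b2 using \<Lambda> by (simp add: ennreal_mult mult_ac)
    also have "\<dots> \<le> ennreal (a * \<Lambda>) * vol (ball x r)"
      using \<Lambda> by (intro mult_right_mono ennreal_leI \<eta>0) auto
    finally show "lint (ball x r) u \<le> ennreal (a * \<Lambda>) * vol (ball x r)" .
  next
    define X where "X = avg (ball x (2 * r)) (\<lambda>y. ennreal (\<bar>RB y\<bar> powr p1 * w y))"
    define Y where "Y = avg (ball x r) (\<lambda>y. ennreal (w y))"
    have "G + S \<le> ennreal L + ennreal (1 * L)"
      using SL GL \<gamma> L by (intro add_mono) (auto elim!: order_trans intro!: ennreal_leI)
    also have "\<dots> = ennreal (2 * L)" using L by (simp add: ennreal_plus[symmetric] del: ennreal_plus)
    finally have "ennreal N2 * (G + S) * epow Y (1 / p1) \<le> ennreal N2 * ennreal (2 * L) * epow Y (1 / p1)"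
      by (intro mult_right_mono mult_left_mono) auto
    then have "epow X (1 / p1) \<le> ennreal N2 * ennreal (2 * L) * epow Y (1 / p1)"
      using RB unfolding X_def Y_def by (rule order_trans[rotated])
    also have "ennreal N2 * ennreal (2 * L) = ennreal (2 * N2 * L)"
      using N L by (simp add: ennreal_mult[symmetric] mult_ac)
    finally have "epow (epow X (1 / p1)) p1 \<le> epow (ennreal (2 * N2 * L) * epow Y (1 / p1)) p1"
      using p1 by simp
    then have XY: "X \<le> ennreal ((2 * N2) powr p1 * \<Lambda> powr (p1 / p0)) * Y"
      using p1 N L by (simp add: epow_mult epow_epow epow_ennreal powr_mult)
    have "(\<integral>\<^sup>+z\<in>ball x r. epow (v z) (p1 / p0) \<partial>W) = (\<integral>\<^sup>+z. ennreal (w z) * (epow (v z) (p1 / p0) * indicator (ball x r) z) \<partial>lebesgue)"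
      by (intro int_W) measurable
    also have "\<dots> \<le> (\<integral>\<^sup>+z. ennreal (2 powr p1) * (ennreal (\<bar>RB z\<bar> powr p1 * w z) * indicator (ball x (2 * r)) z) \<partial>lebesgue)"
    proof (intro nn_integral_mono)
      fix z
      have "epow (v z) (p1 / p0) = ennreal (2 powr p1) * ennreal (\<bar>RB z\<bar> powr p1)"
        using p by (simp add: v_def epow_mult epow_ennreal powr_powr)
      then show "ennreal (w z) * (epow (v z) (p1 / p0) * indicator (ball x r) z)
          \<le> ennreal (2 powr p1) * (ennreal (\<bar>RB z\<bar> powr p1 * w z) * indicator (ball x (2 * r)) z)"
        using sub2[of z] w0[of z] by (auto simp: ennreal_mult mult_ac split: split_indicator)
    qed
    also have "\<dots> = ennreal (2 powr p1) * (\<integral>\<^sup>+z\<in>ball x (2 * r). ennreal (\<bar>RB z\<bar> powr p1 * w z) \<partial>lebesgue)"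
      by (intro nn_integral_cmult) measurable
    also have "\<dots> = ennreal (2 powr p1) * (X * vol (ball x (2 * r)))"
      unfolding X_def using r by (subst avg_mult_ball) auto
    also have "\<dots> \<le> ennreal (2 powr p1) * ((ennreal ((2 * N2) powr p1 * \<Lambda> powr (p1 / p0)) * Y) * vol (ball x (2 * r)))"
      by (intro mult_left_mono mult_right_mono XY) auto
    also have "\<dots> = ennreal (2 ^ DIM('a) * (2 powr p1 * (2 * N2) powr p1) * \<Lambda> powr (p1 / p0)) * (Y * vol (ball x r))"
      unfolding b2 by (simp add: ennreal_mult mult_ac)
    also have "2 powr p1 * (2 * N2) powr p1 = (4 * N2) powr p1"
      using N by (simp add: powr_mult[symmetric])
    also have "Y * vol (ball x r) = emeasure W (ball x r)"
    proof -
      have "Y * vol (ball x r) = (\<integral>\<^sup>+z\<in>ball x r. ennreal (w z) \<partial>lebesgue)"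
        unfolding Y_def using r by (rule avg_mult_ball)
      also have "\<dots> = (\<integral>\<^sup>+z. indicator (ball x r) z \<partial>W)"
        by (rule int_W[symmetric]) simp
      finally show ?thesis by (simp add: sets_W)
    qed
    finally show "(\<integral>\<^sup>+z\<in>ball x r. epow (v z) (p1 / p0) \<partial>W)
        \<le> ennreal (2 ^ DIM('a) * (4 * N2) powr p1 * \<Lambda> powr (p1 / p0)) * emeasure W (ball x r)" .
  qed measurable
qed

theorem theorem2p1:
  fixes p0 p p1 c1 N2 K :: real
  assumes "0 < p0" "p0 < p" "p < p1"
    and "0 < c1" "c1 < 1" "N2 > 1"
  shows "\<exists>\<eta>0>0. \<forall>N1::real. N1 > 1 \<longrightarrow> (\<exists>C::real.
    \<forall>(w::'a::euclidean_space \<Rightarrow> real) x0 r0 (F::'a \<Rightarrow> real) (f::'a \<Rightarrow> real) \<eta>.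
      Aq_weight (p / p0) w \<and> Aq_const (p / p0) w = K \<and>
      r0 > 0 \<and>
      F \<in> borel_measurable lebesgue \<and> f \<in> borel_measurable lebesgue \<and>
      (\<integral>\<^sup>+ y. ennreal (\<bar>F y\<bar> powr p) * indicator (ball x0 (4 * r0)) y \<partial>lebesgue) < top \<and>
      (\<integral>\<^sup>+ y. ennreal (\<bar>f y\<bar> powr p) * indicator (ball x0 (4 * r0)) y \<partial>lebesgue) < top \<and>
      0 \<le> \<eta> \<and> \<eta> \<le> \<eta>0 \<and>
      (\<forall>x r. r > 0 \<and> ball x r \<subseteq> ball x0 (2 * r0) \<and>
             measure lebesgue (ball x r) \<le> c1 * measure lebesgue (ball x0 r0) \<longrightarrow>
         (\<exists>FB RB :: 'a \<Rightarrow> real.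
            FB \<in> borel_measurable lebesgue \<and> RB \<in> borel_measurable lebesgue \<and>
            (\<forall>y\<in>ball x (2 * r). \<bar>F y\<bar> \<le> \<bar>FB y\<bar> + \<bar>RB y\<bar>) \<and>
            epow (avg (ball x (2 * r)) (\<lambda>y. ennreal (\<bar>FB y\<bar> powr p0))) (1 / p0)
              \<le> ennreal N1 *
                  (SUP (y, s) \<in> {(y, s). s > 0 \<and> ball x r \<subseteq> ball y s \<and> ball y s \<subseteq> ball x0 (4 * r0)}.
                     epow (avg (ball y s) (\<lambda>z. ennreal (\<bar>f z\<bar> powr p0))) (1 / p0))
                + ennreal \<eta> * epow (avg (ball x (100 * r)) (\<lambda>y. ennreal (\<bar>F y\<bar> powr p0))) (1 / p0) \<and>
            epow (avg (ball x (2 * r)) (\<lambda>y. ennreal (\<bar>RB y\<bar> powr p1 * w y))) (1 / p1)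
              \<le> ennreal N2 *
                  (epow (avg (ball x (100 * r)) (\<lambda>y. ennreal (\<bar>F y\<bar> powr p0))) (1 / p0)
                   + (SUP (y, s) \<in> {(y, s). s > 0 \<and> ball x r \<subseteq> ball y s \<and> ball y s \<subseteq> ball x0 (4 * r0)}.
                       epow (avg (ball y s) (\<lambda>z. ennreal (\<bar>f z\<bar> powr p0))) (1 / p0)))
                * epow (avg (ball x r) (\<lambda>y. ennreal (w y))) (1 / p1)))
      \<longrightarrow>
      epow (avg (ball x0 r0) (\<lambda>y. ennreal (\<bar>F y\<bar> powr p * w y))) (1 / p)
        \<le> ennreal C * epow (avg (ball x0 (4 * r0)) (\<lambda>y. ennreal (\<bar>f y\<bar> powr p * w y))) (1 / p)
          + ennreal C * epow (avg (ball x0 (4 * r0)) (\<lambda>y. ennreal (\<bar>F y\<bar> powr p0))) (1 / p0)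
              * epow (avg (ball x0 r0) (\<lambda>y. ennreal (w y))) (1 / p))"
proof -
  define q q1 where "q = p / p0" and "q1 = p1 / p0"
  define \<kappa> where "\<kappa> = c1 / 1400"
  define C2 where "C2 = 2 ^ DIM('a) * (4 * N2) powr p1"
  have q: "1 < q" "q < q1" "q1 * p0 = p1" "p0 * q1 = p1" "p0 * q = p" "0 < q1"
    using assms by (auto simp: q_def q1_def divide_strict_right_mono)
  have p: "0 < p" "0 < p1" using assms by auto
  have \<kappa>: "0 < \<kappa>" "\<kappa> \<le> 1 / 700" using assms by (auto simp: \<kappa>_def)
  have K1: "1 \<le> \<bar>K\<bar> + 1" by simp
  have C2: "0 \<le> C2" by (simp add: C2_def)
  show ?thesis
    using weighted_real_variable[OF q(1,2) K1 \<kappa> C2, where 'a = 'a]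
  proof (elim exE conjE, goal_cases)
    case (1 a)
    then have "0 < a" by simp
    note core = 1(2)[rule_format]
    \<comment> \<open>The second entry solves
      \<open>2 powr p0 * 2 ^ DIM('a) * (2 * \<eta>0) powr p0 = a\<close>; the cap at 1 ensures
      \<open>\<gamma> powr (1 / p0) \<le> 1\<close> below.\<close>
    define \<eta>0 where "\<eta>0 = min 1 ((a / (2 powr p0 * 2 ^ DIM('a))) powr (1 / p0) / 2)"
    have \<eta>0: "0 < \<eta>0" "\<eta>0 \<le> 1" using \<open>0 < a\<close> by (auto simp: \<eta>0_def)
    have \<eta>0_a: "2 powr p0 * 2 ^ DIM('a) * (2 * \<eta>0) powr p0 \<le> a"
    proof -
      have "\<eta>0 \<le> (a / (2 powr p0 * 2 ^ DIM('a))) powr (1 / p0) / 2"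
        unfolding \<eta>0_def by (rule min.cobounded2)
      then have "(2 * \<eta>0) powr p0 \<le> ((a / (2 powr p0 * 2 ^ DIM('a))) powr (1 / p0)) powr p0"
        using \<eta>0 assms by (intro powr_mono2) auto
      also have "\<dots> = a / (2 powr p0 * 2 ^ DIM('a))"
        using \<open>0 < a\<close> assms by (simp add: powr_powr)
      finally show ?thesis by (simp add: field_simps)
    qed
    show ?thesis
    proof (rule exI[of _ \<eta>0], intro conjI allI impI, goal_cases)
      case 1
      show ?case by (rule \<eta>0)
    next
      case (2 N1)
      \<comment> \<open>\<open>N1\<close> is absorbed here, after \<open>\<eta>0\<close> has been
        fixed; it reaches \<open>C\<close> through \<open>\<gamma>\<close>.\<close>
      define \<gamma> where "\<gamma> = (\<eta>0 / N1) powr p0"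
      have \<gamma>: "0 < \<gamma>" "N1 * \<gamma> powr (1 / p0) = \<eta>0" "\<gamma> powr (1 / p0) \<le> 1"
        using \<eta>0 2 assms by (auto simp: \<gamma>_def powr_powr)
      obtain C where "0 \<le> C" and C: "\<And>(w :: 'a \<Rightarrow> real) \<sigma> x0 r0 g h.
        muckenhoupt w \<sigma> q (\<bar>K\<bar> + 1) \<Longrightarrow> 0 < r0 \<Longrightarrow> g \<in> borel_measurable lebesgue \<Longrightarrow> h \<in> borel_measurable lebesgue \<Longrightarrow>
        (\<integral>\<^sup>+z. g z \<partial>lebesgue) < top \<Longrightarrow> local_decomposition (muckenhoupt.W w) q1 \<kappa> C2 a \<gamma> x0 r0 g h \<Longrightarrow>
        (\<integral>\<^sup>+x\<in>ball x0 r0. epow (g x) q \<partial>muckenhoupt.W w) \<le>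
          ennreal C * (epow ((\<integral>\<^sup>+z. g z \<partial>lebesgue) / vol (ball x0 (4 * r0))) q * emeasure (muckenhoupt.W w) (ball x0 r0)) +
          ennreal C * (\<integral>\<^sup>+x. epow (h x) q \<partial>muckenhoupt.W w)"
        using core[OF \<gamma>(1)] by blast
      \<comment> \<open>The factor 2 comes from the power of a sum, \<open>4 ^ DIM('a)\<close> from
        averaging over the fourfold ball.\<close>
      define C' where "C' = (2 * (C * 4 ^ DIM('a))) powr (1 / p)"
      show ?case
      proof (intro exI[of _ C'] allI impI, elim conjE, goal_cases)
        case (1 w x0 r0 F f \<eta>)
        have r0: "0 < r0" and w: "Aq_weight q w" and [measurable]: "F \<in> borel_measurable lebesgue" "f \<in> borel_measurable lebesgue"
          using 1 by (auto simp: q_def)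
        then have w0: "\<And>x. 0 \<le> w x" and [measurable]: "w \<in> borel_measurable lebesgue"
          by (auto simp: Aq_weight_def)
        have approx: "approximable p0 p1 c1 N1 N2 \<eta> w x0 r0 F f"
          unfolding approximable_def by (rule 1)
        show ?case
        \<comment> \<open>The vanishing weight has no positive version, but it makes the left-hand
          side zero.\<close>
        proof (cases "AE x in lebesgue. w x = 0")
          case True
          have "(\<integral>\<^sup>+y\<in>ball x0 r0. ennreal (\<bar>F y\<bar> powr p * w y) \<partial>lebesgue) = (\<integral>\<^sup>+y. 0 \<partial>(lebesgue :: 'a measure))"
            by (rule nn_integral_cong_AE) (use True in \<open>eventually_elim, simp\<close>)
          then have "avg (ball x0 r0) (\<lambda>y. ennreal (\<bar>F y\<bar> powr p * w y)) = 0"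
            by (simp add: avg_def)
          then show ?thesis by simp
        next
          case False
          have K: "Aq_const q w = K" using 1 by (simp add: q_def)
          obtain w' where ae: "AE x in lebesgue. w x = w' x" and muck: "muckenhoupt w' (\<lambda>x. w' x powr (- 1 / (q - 1))) q (\<bar>K\<bar> + 1)"
            by (rule Aq_weight_muckenhoupt[OF w K False])
          interpret muckenhoupt w' "\<lambda>x. w' x powr (- 1 / (q - 1))" q "\<bar>K\<bar> + 1" by (rule muck)
          note int_W = nn_integral_W_AE_eq[OF ae]
          define g where "g y = ennreal (\<bar>F y\<bar> powr p0) * indicator (ball x0 (4 * r0)) y" for y
          define h where "h y = ennreal (\<bar>f y\<bar> powr p0) * indicator (ball x0 (4 * r0)) y" for y
          have [measurable]: "g \<in> borel_measurable lebesgue" "h \<in> borel_measurable lebesgue"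
            unfolding g_def h_def by measurable
          have gfin: "(\<integral>\<^sup>+z. g z \<partial>lebesgue) < top"
          proof -
            have "(\<integral>\<^sup>+z. g z \<partial>lebesgue) \<le> (\<integral>\<^sup>+z. indicator (ball x0 (4 * r0)) z + ennreal (\<bar>F z\<bar> powr p) * indicator (ball x0 (4 * r0)) z \<partial>lebesgue)"
            proof (intro nn_integral_mono)
              fix z
              \<comment> \<open>As \<open>p0 < p\<close> and the ball has finite volume, finiteness
                passes from the power \<open>p\<close> to the power \<open>p0\<close>.\<close>
              have "\<bar>F z\<bar> powr p0 \<le> 1 + \<bar>F z\<bar> powr p"
              proof (cases "\<bar>F z\<bar> \<le> 1")
                case True
                then have "\<bar>F z\<bar> powr p0 \<le> 1" using assms by (intro powr_le1) auto
                then show ?thesis by (simp add: add_increasing2)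
              next
                case False
                then have "\<bar>F z\<bar> powr p0 \<le> \<bar>F z\<bar> powr p" using assms by (intro powr_mono) auto
                then show ?thesis by simp
              qed
              then have "ennreal (\<bar>F z\<bar> powr p0) \<le> 1 + ennreal (\<bar>F z\<bar> powr p)"
                by (metis ennreal_1 ennreal_leI ennreal_plus powr_ge_zero zero_le_one)
              then show "g z \<le> indicator (ball x0 (4 * r0)) z + ennreal (\<bar>F z\<bar> powr p) * indicator (ball x0 (4 * r0)) z"
                by (auto simp: g_def split: split_indicator)
            qed
            also have "\<dots> = vol (ball x0 (4 * r0)) + (\<integral>\<^sup>+z\<in>ball x0 (4 * r0). ennreal (\<bar>F z\<bar> powr p) \<partial>lebesgue)"
              by (subst nn_integral_add) auto
            also have "\<dots> < top"
              using 1 emeasure_lebesgue_ball_finite[of x0 "4 * r0"] by simp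
            finally show ?thesis .
          qed
          have "local_decomposition W q1 \<kappa> C2 a \<gamma> x0 r0 g h"
            unfolding q1_def \<kappa>_def C2_def g_def[abs_def] h_def[abs_def]
            by (rule local_decomposition_of_approximable[OF _ _ _ _ _ _ _ _ r0 _ w0 _ _ ae muck \<eta>0(1) \<eta>0_a \<gamma> approx])
               (use assms 1 2 in auto)
          note le = C[OF muck r0 _ _ gfin this]
          define b where "b = vol (ball x0 r0)"
          have b: "b \<noteq> 0" "b \<noteq> top"
            using emeasure_lebesgue_ball_pos[OF r0, of x0] emeasure_lebesgue_ball_finite[of x0 r0] by (auto simp: b_def)
          have b4: "vol (ball x0 (4 * r0)) = ennreal (4 ^ DIM('a)) * b"
            unfolding b_def using r0 by (intro emeasure_lebesgue_ball_scale) auto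
          define P where "P = avg (ball x0 r0) (\<lambda>y. ennreal (\<bar>F y\<bar> powr p * w y))"
          define Q where "Q = avg (ball x0 (4 * r0)) (\<lambda>y. ennreal (\<bar>f y\<bar> powr p * w y))"
          define V where "V = avg (ball x0 r0) (\<lambda>y. ennreal (w y))"
          define X where "X = avg (ball x0 (4 * r0)) (\<lambda>y. ennreal (\<bar>F y\<bar> powr p0))"
          have pw: "epow (ennreal (c powr p0)) q = ennreal (c powr p)" for c
            using q(5) by (simp add: epow_ennreal powr_powr)
          have I1: "(\<integral>\<^sup>+x\<in>ball x0 r0. epow (g x) q \<partial>W) = P * b"
          proof -
            have "(\<integral>\<^sup>+x\<in>ball x0 r0. epow (g x) q \<partial>W) = (\<integral>\<^sup>+x. ennreal (w x) * (epow (g x) q * indicator (ball x0 r0) x) \<partial>lebesgue)"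
              by (rule int_W) measurable
            also have "\<dots> = (\<integral>\<^sup>+x\<in>ball x0 r0. ennreal (\<bar>F x\<bar> powr p * w x) \<partial>lebesgue)"
              using w0 r0 by (intro nn_integral_cong) (auto simp: g_def pw ennreal_mult mult.commute split: split_indicator)
            also have "\<dots> = P * b"
              unfolding P_def b_def by (rule avg_mult_ball[OF r0, symmetric])
            finally show ?thesis .
          qed
          have I2: "(\<integral>\<^sup>+x. epow (h x) q \<partial>W) = ennreal (4 ^ DIM('a)) * Q * b"
          proof -
            have "(\<integral>\<^sup>+x. epow (h x) q \<partial>W) = (\<integral>\<^sup>+x. ennreal (w x) * epow (h x) q \<partial>lebesgue)"
              by (rule int_W) measurable
            also have "\<dots> = (\<integral>\<^sup>+x\<in>ball x0 (4 * r0). ennreal (\<bar>f x\<bar> powr p * w x) \<partial>lebesgue)"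
              using w0 by (intro nn_integral_cong) (auto simp: h_def pw ennreal_mult mult.commute split: split_indicator)
            also have "\<dots> = Q * vol (ball x0 (4 * r0))"
              unfolding Q_def using r0 by (intro avg_mult_ball[symmetric]) auto
            finally show ?thesis unfolding b4 by (simp only: mult_ac)
          qed
          have I3: "emeasure W (ball x0 r0) = V * b"
          proof -
            have "emeasure W (ball x0 r0) = (\<integral>\<^sup>+z. indicator (ball x0 r0) z \<partial>W)"
              by (simp add: sets_W)
            also have "\<dots> = (\<integral>\<^sup>+z\<in>ball x0 r0. ennreal (w z) \<partial>lebesgue)"
              by (rule int_W) simp
            also have "\<dots> = V * b"
              unfolding V_def b_def by (rule avg_mult_ball[OF r0, symmetric])
            finally show ?thesis .
          qed
          have I4: "(\<integral>\<^sup>+z. g z \<partial>lebesgue) / vol (ball x0 (4 * r0)) = X"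
            by (simp add: X_def avg_def g_def)
          define M where "M = C * 4 ^ DIM('a)"
          have M: "0 \<le> M" "C \<le> M" "ennreal M = ennreal C * ennreal (4 ^ DIM('a))"
            using \<open>0 \<le> C\<close> one_le_power[of "4::real" "DIM('a)"] mult_left_mono[of 1 "4 ^ DIM('a)" C]
            by (auto simp: M_def ennreal_mult)
          have "b * P = P * b" by (rule mult.commute)
          also have "\<dots> \<le> ennreal C * (epow X q * (V * b)) + ennreal C * (ennreal (4 ^ DIM('a)) * Q * b)"
            using le unfolding I1 I2 I3 I4 by simp
          also have "\<dots> \<le> ennreal M * (epow X q * (V * b)) + ennreal C * (ennreal (4 ^ DIM('a)) * Q * b)"
            using M by (intro add_right_mono mult_right_mono ennreal_leI) auto
          also have "\<dots> = b * (ennreal M * (Q + epow X q * V))"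
            unfolding M(3) by (simp add: distrib_left distrib_right mult_ac)
          finally have "P \<le> ennreal M * (Q + epow X q * V)"
            using b by (simp add: ennreal_mult_le_mult_iff)
          then have "epow P (1 / p) \<le> epow (ennreal M * (Q + epow X q * V)) (1 / p)"
            using p by simp
          also have "\<dots> = ennreal (M powr (1 / p)) * epow (Q + epow X q * V) (1 / p)"
            using p M(1) by (simp add: epow_mult epow_ennreal)
          also have "\<dots> \<le> ennreal (M powr (1 / p)) * (ennreal (2 powr (1 / p)) * (epow Q (1 / p) + epow (epow X q * V) (1 / p)))"
            using p by (intro mult_left_mono epow_add_le) auto
          also have "epow (epow X q * V) (1 / p) = epow X (1 / p0) * epow V (1 / p)"
            using p by (simp add: epow_mult epow_epow q_def)
          also have "ennreal (M powr (1 / p)) * (ennreal (2 powr (1 / p)) * (epow Q (1 / p) + epow X (1 / p0) * epow V (1 / p)))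
            = ennreal C' * (epow Q (1 / p) + epow X (1 / p0) * epow V (1 / p))"
            using M(1) by (simp add: C'_def M_def[symmetric] powr_mult ennreal_mult mult_ac)
          finally show ?thesis
            by (simp add: P_def Q_def X_def V_def distrib_left mult.assoc)
        qed
      qed
    qed
  qed
qed

end
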